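(* Let $n>m$, $\nu=w\mu$ with $w$ a probability density w.r.t. $\mu$ satisfying $w\ge\alpha w_m$ for some $\alpha\in(0,1]$, and $\mathbf x\sim\gamma_n^\nu$, using weighted least squares with weight $w$. Let $0<\delta<1$, $0<\eta<1$, and assume $$n\ge m+c_\delta^{-1}\alpha^{-1}m\log(m\eta^{-1}).$$ Then $S=\{\lambda_{\min}(\mathbf G^w(\mathbf x))\ge(1-\delta)\frac{n-m}{n}\}$ satisfies $\mathbb P(S)\ge1-\eta$, and for every $f\in L^2_\mu$, with $\hat f_m=\hat P_{V_m}f$, $\beta=1+(\alpha^{-1}-1)\frac mn$, and $\xi=0$ if $\nu=\nu_m$, $\xi=1$ if $\nu\ne\nu_m$: $$\mathbb E(\|f-\hat f_m\|^2\mid S)\le\Big(1+(1-\eta)^{-1}(1-\delta)^{-1}\big(1-\tfrac mn\big)^{-1}\beta\Big)\inf_{g\in V_m}\|f-g\|^2,$$ $$\mathbb E(\|f-\hat f_m\|^2\mid S)\le\Big(1+(1-\eta)^{-1}(1-\delta)^{-2}\big(1-\tfrac mn\big)^{-2}\tfrac mn\alpha^{-1}(\beta+\xi m\alpha^{-1})\Big)\inf_{g\in V_m}\|f-g\|^2.$$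
   Context: $\mathcal X$ is a Polish space with Borel probability measure $\mu$; $\|\cdot\|$ is the $L^2_\mu$ norm. $V_m\subset L^2_\mu$ has $L^2_\mu$-orthonormal basis $\varphi_1,\dots,\varphi_m$, $\boldsymbol\varphi=(\varphi_1,\dots,\varphi_m)^T$, $w_m(x)=\frac1m\|\boldsymbol\varphi(x)\|_2^2$, $\nu_m=w_m\mu$. For points $\mathbf x=(x_1,\dots,x_n)$ and weight $w$: $\|f\|_n^2=\frac1n\sum_iw(x_i)^{-1}f(x_i)^2$; $\Phi^w(\mathbf x)$ has rows $w(x_i)^{-1/2}\boldsymbol\varphi(x_i)^T$; $\mathbf G^w(\mathbf x)=\frac1n\Phi^w(\mathbf x)^T\Phi^w(\mathbf x)$; $\hat P_{V_m}f$ is the unique minimizer over $g\in V_m$ of $\|f-g\|_n$ (when $\mathbf G^w$ invertible). $\gamma_n^\nu$ is the probability measure on $\mathcal X^n$ with $d\gamma_n^\nu(\mathbf x)=\frac{(n-m)!}{n!}\det(\Phi^w(\mathbf x)^T\Phi^w(\mathbf x))\,d\nu^{\otimes n}(\mathbf x)$. $c_\delta=\delta+(1-\delta)\log(1-\delta)$. *)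

theory Defs
  imports "HOL-Probability.Probability"
begin

text \<open>Dimension m = CARD('m) (index type of the basis), sample size n = CARD('n)
  (index type of the sample points). Basis functions: phi :: 'm => 'a => real.\<close>

definition L2_norm_sq :: "'a measure \<Rightarrow> ('a \<Rightarrow> real) \<Rightarrow> real" where
  "L2_norm_sq M f = (\<integral>y. (f y)\<^sup>2 \<partial>M)"

definition in_L2 :: "'a measure \<Rightarrow> ('a \<Rightarrow> real) \<Rightarrow> bool" where
  "in_L2 M f \<longleftrightarrow> f \<in> borel_measurable M \<and> integrable M (\<lambda>y. (f y)\<^sup>2)"

definition Vspace :: "('m::finite \<Rightarrow> 'a \<Rightarrow> real) \<Rightarrow> ('a \<Rightarrow> real) set" where
  "Vspace phi = {g. \<exists>c::'m \<Rightarrow> real. g = (\<lambda>y. \<Sum>j\<in>UNIV. c j * phi j y)}"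

definition wm :: "('m::finite \<Rightarrow> 'a \<Rightarrow> real) \<Rightarrow> 'a \<Rightarrow> real" where
  "wm phi x = (1 / real CARD('m)) * (\<Sum>j\<in>UNIV. (phi j x)\<^sup>2)"

definition emp_norm_sq :: "('a \<Rightarrow> real) \<Rightarrow> ('n::finite \<Rightarrow> 'a) \<Rightarrow> ('a \<Rightarrow> real) \<Rightarrow> real" where
  "emp_norm_sq w x f = (1 / real CARD('n)) * (\<Sum>i\<in>UNIV. inverse (w (x i)) * (f (x i))\<^sup>2)"

definition Phi_w :: "('m::finite \<Rightarrow> 'a \<Rightarrow> real) \<Rightarrow> ('a \<Rightarrow> real) \<Rightarrow> ('n::finite \<Rightarrow> 'a) \<Rightarrow> real^'m^'n" where
  "Phi_w phi w x = (\<chi> i j. inverse (sqrt (w (x i))) * phi j (x i))"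

definition G_w :: "('m::finite \<Rightarrow> 'a \<Rightarrow> real) \<Rightarrow> ('a \<Rightarrow> real) \<Rightarrow> ('n::finite \<Rightarrow> 'a) \<Rightarrow> real^'m^'m" where
  "G_w phi w x = (1 / real CARD('n)) *\<^sub>R (transpose (Phi_w phi w x) ** Phi_w phi w x)"

definition lambda_min :: "real^'m::finite^'m \<Rightarrow> real" where
  "lambda_min A = Min {l. \<exists>v. v \<noteq> 0 \<and> A *v v = l *\<^sub>R v}"

text \<open>Weighted least-squares projection hat P_{V_m} f: the unique minimiser over V_m of
  ||f - g||_n (meaningful when G^w(x) is invertible).\<close>
definition wls_proj :: "('m::finite \<Rightarrow> 'a \<Rightarrow> real) \<Rightarrow> ('a \<Rightarrow> real) \<Rightarrow> ('n::finite \<Rightarrow> 'a)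
    \<Rightarrow> ('a \<Rightarrow> real) \<Rightarrow> ('a \<Rightarrow> real)" where
  "wls_proj phi w x f = (THE g. g \<in> Vspace phi \<and>
      (\<forall>h\<in>Vspace phi. emp_norm_sq w x (\<lambda>y. f y - g y) \<le> emp_norm_sq w x (\<lambda>y. f y - h y)))"

definition gamma_meas :: "('m::finite \<Rightarrow> 'a \<Rightarrow> real) \<Rightarrow> ('a \<Rightarrow> real) \<Rightarrow> 'a measure
    \<Rightarrow> ('n::finite \<Rightarrow> 'a) measure" where
  "gamma_meas phi w nu = density (PiM (UNIV::'n set) (\<lambda>_. nu))
     (\<lambda>x. ennreal (fact (CARD('n) - CARD('m)) / fact CARD('n)
                  * det (transpose (Phi_w phi w x) ** Phi_w phi w x)))"

definition cond_exp_event :: "'b measure \<Rightarrow> 'b set \<Rightarrow> ('b \<Rightarrow> real) \<Rightarrow> ennreal" where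
  "cond_exp_event P S Z = (\<integral>\<^sup>+ x. indicator S x * ennreal (Z x) \<partial>P) / emeasure P S"

definition c_delta :: "real \<Rightarrow> real" where
  "c_delta d = d + (1 - d) * ln (1 - d)"

end

theory Submission
  imports Defs
begin

text \<open>
  Write \<open>v = w\<^sup>-\<^sup>1\<^sup>/\<^sup>2 \<phi>\<close>, so that \<open>v v\<^sup>T\<close> has mean \<open>I\<close> and \<open>|v|\<^sup>2 \<le> K = m/\<alpha>\<close> under \<open>\<nu>\<close>. By a
  Cauchy--Binet expansion over injections \<open>f\<close> of the basis indices into the sample indices, the
  density of \<open>\<gamma>\<close> is a mixture of the squared determinants of \<open>(v(x\<^sub>f\<^sub>(\<^sub>j\<^sub>)))\<^sub>j\<close>. For each \<open>f\<close> the \<open>n - m\<close>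
  points outside the range of \<open>f\<close> stay i.i.d. with law \<open>\<nu>\<close>, and discarding the other points only
  decreases the Gram matrix, so a lower tail bound for i.i.d. sums transfers to \<open>\<gamma>\<close>. That bound is
  a matrix Chernoff bound; matrix exponentials and the Golden--Thompson inequality are avoided by
  using the potential \<open>tr (I - \<theta>A/N)\<^sup>N\<close> with \<open>N \<longrightarrow> \<infinity>\<close>. Along \<open>A + s v v\<^sup>T\<close> its derivative is
  controlled by the inequality \<open>p\<^sub>i p\<^sub>j \<le> p\<^sub>0 p\<^sub>i\<^sub>+\<^sub>j\<close> for the moments \<open>p\<^sub>j = \<langle>v, T\<^sup>j v\<rangle>\<close> of a positive operator.

  If \<open>g\<close> is the residual of \<open>f\<close>, the least squares error is \<open>|g|\<^sup>2 + |b|\<^sup>2\<close>, where \<open>b\<close> solves the normal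
  equations for \<open>g\<close>. On \<open>S\<close>, \<open>|b|\<^sup>2\<close> is at most the empirical norm of \<open>g\<close> over \<open>\<lambda>\<^sub>m\<^sub>i\<^sub>n\<close>, or the squared
  norm of the right-hand side over \<open>\<lambda>\<^sub>m\<^sub>i\<^sub>n\<^sup>2\<close>; both have explicit one- and two-point moments under \<open>\<gamma>\<close>.
\<close>

section \<open>Trace powers under rank-one updates\<close>

text \<open>With \<open>U(s) = T - s e v v^T\<close>, the trace of \<open>U(s)^N\<close> has
  derivative exactly \<open>- e N\<close> times the moment \<open>v . U(s)^(N-1) v\<close>, because
  under the trace all positions of the factor \<open>v v^T\<close> are equivalent. It remains to see
  that this moment does not decay too fast in \<open>s\<close>: its derivative is at least
  \<open>- kap\<close> times itself, and a Gronwall argument turns this into the loss factor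
  \<open>(1 - exp (- kap)) / kap\<close>. In the limit \<open>kap\<close> becomes
  \<open>th * K\<close>, and the exponent becomes
  \<open>th * t - L * (1 - exp (- (th * K))) / K\<close>, the one known for L scalar variables with
  values in [0, K] and mean 1. Its minimum over \<open>th\<close> produces \<open>c_delta\<close>.
  Finite \<open>N\<close> has a price: the moment ratios need a strictly positive operator, hence
  the condition \<open>th * L * K < N\<close>. Using a trace in place of the smallest eigenvalue
  costs the factor m inside the logarithm. Each injection uses up m of the sample points, which is
  why n - m and not n appears in the eigenvalue threshold and in the sample size condition.\<close>

definition psd :: "('v::euclidean_space \<Rightarrow> 'v) \<Rightarrow> bool" where
  "psd T \<longleftrightarrow> linear T \<and> (\<forall>x y. T x \<bullet> y = x \<bullet> T y) \<and> (\<forall>x. 0 \<le> x \<bullet> T x)"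

lemma psdD:
  assumes "psd T"
  shows "linear T" and "T x \<bullet> y = x \<bullet> T y" and "0 \<le> x \<bullet> T x"
  using assms by (auto simp: psd_def)

lemma linear_funpow: "linear T \<Longrightarrow> linear (T ^^ k)" for T :: "'v::real_vector \<Rightarrow> 'v"
  by (induction k) (auto simp: linear_id id_def[symmetric] intro: linear_compose)

lemma funpow_selfadjoint:
  assumes "psd T" shows "(T ^^ k) x \<bullet> y = x \<bullet> (T ^^ k) y"
  by (induction k arbitrary: x y) (auto simp: psdD(2)[OF assms] funpow_swap1)

lemma funpow_inner_funpow:
  assumes "psd T" shows "(T ^^ j) x \<bullet> (T ^^ k) y = x \<bullet> (T ^^ (j + k)) y"
  by (simp add: funpow_selfadjoint[OF assms] funpow_add)

lemma psd_funpow: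
  assumes "psd T" shows "psd (T ^^ k)"
proof -
  have "0 \<le> x \<bullet> (T ^^ k) x" for x
  proof (cases "even k")
    case True
    then obtain l where "k = l + l" by (metis evenE mult_2)
    then show ?thesis using funpow_inner_funpow[OF assms, of l x l x] by (metis inner_ge_zero)
  next
    case False
    then obtain l where "k = l + Suc l" by (metis oddE mult_2 add_Suc_right Suc_eq_plus1)
    then have "x \<bullet> (T ^^ k) x = (T ^^ l) x \<bullet> T ((T ^^ l) x)"
      using funpow_inner_funpow[OF assms, of l x "Suc l" x] by simp
    then show ?thesis using psdD(3)[OF assms] by simp
  qed
  then show ?thesis
    using linear_funpow[OF psdD(1)[OF assms]] funpow_selfadjoint[OF assms] by (auto simp: psd_def)
qed

lemma psd_Cauchy_Schwarz:
  assumes "psd T" shows "(x \<bullet> T y)\<^sup>2 \<le> (x \<bullet> T x) * (y \<bullet> T y)"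
proof -
  have L: "linear T" and S: "\<And>a b. T a \<bullet> b = a \<bullet> T b" and P: "\<And>a. 0 \<le> a \<bullet> T a"
    using psdD[OF assms] by auto
  have sw: "y \<bullet> T x = x \<bullet> T y" by (metis S inner_commute)
  have q: "0 \<le> (x \<bullet> T x) + 2 * t * (x \<bullet> T y) + t\<^sup>2 * (y \<bullet> T y)" for t
  proof -
    have "(x + t *\<^sub>R y) \<bullet> T (x + t *\<^sub>R y) = (x \<bullet> T x) + 2 * t * (x \<bullet> T y) + t\<^sup>2 * (y \<bullet> T y)"
      by (simp add: linear_add[OF L] linear_scale[OF L] inner_add_left inner_add_right sw
          power2_eq_square algebra_simps)
    then show ?thesis using P by metis
  qed
  show ?thesis
  proof (cases "y \<bullet> T y = 0")
    case False
    then have pos: "y \<bullet> T y > 0" using P[of y] by linarith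
    have "0 \<le> (x \<bullet> T x) + 2 * (- (x \<bullet> T y) / (y \<bullet> T y)) * (x \<bullet> T y)
           + (- (x \<bullet> T y) / (y \<bullet> T y))\<^sup>2 * (y \<bullet> T y)" by (rule q)
    also have "\<dots> = (x \<bullet> T x) - (x \<bullet> T y)\<^sup>2 / (y \<bullet> T y)"
      using pos by (simp add: field_simps power2_eq_square)
    finally show ?thesis using pos by (simp add: field_simps)
  next
    case True
    have "x \<bullet> T y = 0"
    proof (rule ccontr)
      assume nz: "x \<bullet> T y \<noteq> 0"
      \<comment> \<open>When \<open>y . T y = 0\<close> the quadratic in \<open>t\<close> is affine;
        this \<open>t\<close> is the point where it would take the value -1.\<close>
      have "0 \<le> (x \<bullet> T x) + 2 * (- ((x \<bullet> T x) + 1) / (2 * (x \<bullet> T y))) * (x \<bullet> T y)"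
        using q[of "- ((x \<bullet> T x) + 1) / (2 * (x \<bullet> T y))"] True by simp
      then show False using nz by (simp add: field_simps)
    qed
    then show ?thesis using True by simp
  qed
qed

text \<open>Spectrum-free form of "the largest eigenvalue is at most the trace". Expanding
  \<open>q = x . T x\<close> in the basis and applying Cauchy-Schwarz, first to the sum and then to
  the form of \<open>T\<close>, gives \<open>q^2 <= (x . x) * trace * q\<close>, and
  \<open>q\<close> cancels.\<close>

lemma inner_le_trace:
  assumes "psd T" shows "x \<bullet> T x \<le> (\<Sum>b\<in>Basis. b \<bullet> T b) * (x \<bullet> x)"
proof (cases "x \<bullet> T x = 0")
  case True
  then show ?thesis by (simp add: psdD(3)[OF assms] sum_nonneg)
next
  case False
  let ?q = "x \<bullet> T x"
  have pos: "?q > 0" using False psdD(3)[OF assms, of x] by linarith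
  have "?q = (\<Sum>b\<in>Basis. (x \<bullet> b) * (b \<bullet> T x))"
    by (subst euclidean_inner) (simp add: inner_commute)
  then have "?q\<^sup>2 = (\<Sum>b\<in>Basis. (x \<bullet> b) * (b \<bullet> T x))\<^sup>2" by simp
  also have "\<dots> \<le> (\<Sum>b\<in>Basis. (x \<bullet> b)\<^sup>2) * (\<Sum>b\<in>Basis. (b \<bullet> T x)\<^sup>2)"
    by (rule Cauchy_Schwarz_ineq_sum)
  also have "\<dots> \<le> (\<Sum>b\<in>Basis. (x \<bullet> b)\<^sup>2) * (\<Sum>b\<in>Basis. (b \<bullet> T b) * ?q)"
    by (intro mult_left_mono sum_mono psd_Cauchy_Schwarz[OF assms] sum_nonneg) auto
  also have "\<dots> = (x \<bullet> x) * (\<Sum>b\<in>Basis. b \<bullet> T b) * ?q"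
    by (simp add: euclidean_inner[of x x] power2_eq_square sum_distrib_right mult.assoc)
  finally have "?q * ?q \<le> ((x \<bullet> x) * (\<Sum>b\<in>Basis. b \<bullet> T b)) * ?q" by (simp add: power2_eq_square)
  then show ?thesis using pos by (simp add: mult.commute)
qed

lemma moment_log_convex:
  assumes "psd T"
  shows "(v \<bullet> (T ^^ Suc j) v)\<^sup>2 \<le> (v \<bullet> (T ^^ j) v) * (v \<bullet> (T ^^ Suc (Suc j)) v)"
proof -
  have "T v \<bullet> (T ^^ j) (T v) = v \<bullet> (T ^^ Suc (Suc j)) v"
    by (simp add: psdD(2)[OF assms] funpow_swap1)
  moreover have "v \<bullet> (T ^^ j) (T v) = v \<bullet> (T ^^ Suc j) v" by (simp add: funpow_swap1)
  ultimately show ?thesis using psd_Cauchy_Schwarz[OF psd_funpow[OF assms, of j], of v "T v"] by metis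
qed

text \<open>The ratios \<open>p (Suc i) / p i\<close> increase, so moving one unit from the smaller
  index to the larger one cannot lower the product. Repeating this exhausts the smaller
  index.\<close>

lemma log_convex_supermult:
  fixes p :: "nat \<Rightarrow> real"
  assumes pos: "\<And>j. p j > 0" and lc: "\<And>j. (p (Suc j))\<^sup>2 \<le> p j * p (Suc (Suc j))"
  shows "p i * p j \<le> p 0 * p (i + j)"
proof -
  have mono: "p (Suc i) / p i \<le> p (Suc j) / p j" if "i \<le> j" for i j
    using lift_Suc_mono_le[of "\<lambda>i. p (Suc i) / p i", OF _ that] lc pos
    by (simp add: field_simps power2_eq_square)
  have "p i * p j \<le> p 0 * p (i + j)" if "i \<le> j" for i j
    using that
  proof (induction i arbitrary: j)
    case (Suc i)
    have "p (Suc i) * p j \<le> p i * p (Suc j)"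
      using mono[of i j] Suc.prems pos[of i] pos[of j] by (simp add: field_simps)
    also have "\<dots> \<le> p 0 * p (i + Suc j)" using Suc.IH[of "Suc j"] Suc.prems by simp
    finally show ?case by simp
  qed simp
  then show ?thesis by (metis add.commute linorder_le_cases mult.commute)
qed

text \<open>Supplies the positivity that the ratios of moments divide by. Coercivity makes
  \<open>T\<close> injective, so even moments are squared norms of nonzero vectors, and odd ones are
  values of the form of \<open>T\<close> at nonzero vectors.\<close>

lemma coercive_moment_pos:
  assumes T: "psd T" and r: "r > 0" "\<And>x. r * (x \<bullet> x) \<le> x \<bullet> T x" and v: "v \<noteq> 0"
  shows "v \<bullet> (T ^^ k) v > 0"
proof -
  have inj: "T x \<noteq> 0" if "x \<noteq> 0" for x
  proof
    assume "T x = 0"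
    then have "r * (x \<bullet> x) \<le> 0" using r(2)[of x] by simp
    then show False using r(1) that by (metis inner_gt_zero_iff mult_pos_pos not_less)
  qed
  have nz: "(T ^^ l) v \<noteq> 0" for l by (induction l) (auto simp: v inj)
  show ?thesis
  proof (cases "even k")
    case True
    then obtain l where "k = l + l" by (metis evenE mult_2)
    then show ?thesis using funpow_inner_funpow[OF T, of l v l v] nz[of l] by (metis inner_gt_zero_iff)
  next
    case False
    then obtain l where "k = l + Suc l" by (metis oddE mult_2 add_Suc_right Suc_eq_plus1)
    then have "v \<bullet> (T ^^ k) v = (T ^^ l) v \<bullet> T ((T ^^ l) v)"
      using funpow_inner_funpow[OF T, of l v "Suc l" v] by simp
    then show ?thesis using r(2)[of "(T ^^ l) v"] nz[of l] r(1)
      by (smt (verit) inner_gt_zero_iff mult_pos_pos)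
  qed
qed

lemma moment_supermult:
  assumes T: "psd T" and r: "r > 0" "\<And>x. r * (x \<bullet> x) \<le> x \<bullet> T x"
  shows "(v \<bullet> (T ^^ i) v) * (v \<bullet> (T ^^ j) v) \<le> (v \<bullet> v) * (v \<bullet> (T ^^ (i + j)) v)"
proof (cases "v = 0")
  case False
  then show ?thesis
    using log_convex_supermult[of "\<lambda>j. v \<bullet> (T ^^ j) v" i j]
      coercive_moment_pos[OF T r False] moment_log_convex[OF T] by simp
qed simp

text \<open>Supermultiplicativity with first index 1: \<open>p 1 * p j <= p 0 * p (j + 1)\<close>,
  while \<open>p 1 >= r * p 0\<close>.\<close>

lemma moment_lower:
  assumes T: "psd T" and r: "r > 0" "\<And>x. r * (x \<bullet> x) \<le> x \<bullet> T x"
  shows "r * (v \<bullet> (T ^^ j) v) \<le> v \<bullet> (T ^^ Suc j) v"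
proof (cases "v = 0")
  case False
  have "(v \<bullet> v) * (r * (v \<bullet> (T ^^ j) v)) \<le> (v \<bullet> T v) * (v \<bullet> (T ^^ j) v)"
    using r(2)[of v] psdD(3)[OF psd_funpow[OF T]]
    by (metis mult.assoc mult.commute mult_right_mono)
  also have "\<dots> \<le> (v \<bullet> v) * (v \<bullet> (T ^^ Suc j) v)"
    using moment_supermult[OF T r, of v 1 j] by simp
  finally show ?thesis using False by simp
qed simp

text \<open>A Jensen inequality for the spectral measure of \<open>v\<close>, obtained from
  supermultiplicativity alone. It later bounds the potential from below by one bad
  direction.\<close>

lemma moment_power_le:
  assumes T: "psd T" and r: "r > 0" "\<And>x. r * (x \<bullet> x) \<le> x \<bullet> T x" and v: "v \<bullet> v = 1"
    and a: "0 \<le> a" "a \<le> v \<bullet> T v"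
  shows "a ^ k \<le> v \<bullet> (T ^^ k) v"
proof (induction k)
  case (Suc k)
  have "a ^ Suc k \<le> (v \<bullet> T v) * (v \<bullet> (T ^^ k) v)"
    using Suc a by (simp add: mult_mono)
  also have "\<dots> \<le> v \<bullet> (T ^^ Suc k) v" using moment_supermult[OF T r, of v 1 k] v by simp
  finally show ?case .
qed (simp add: v)

text \<open>For even \<open>k\<close> this is the hypothesis at \<open>(T ^^ l) v\<close>. For odd
  \<open>k\<close>, log-convexity gives \<open>p (k+1)^2 <= p k * p (k+2)\<close>, and the even case
  applies to the last factor.\<close>

lemma moment_antimono:
  assumes T: "psd T" and le: "\<And>x. x \<bullet> T x \<le> x \<bullet> x"
  shows "v \<bullet> (T ^^ Suc k) v \<le> v \<bullet> (T ^^ k) v"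
proof -
  have ev: "v \<bullet> (T ^^ Suc (l + l)) v \<le> v \<bullet> (T ^^ (l + l)) v" for l
    using le[of "(T ^^ l) v"] funpow_inner_funpow[OF T, of l v "Suc l" v]
      funpow_inner_funpow[OF T, of l v l v] by simp
  show ?thesis
  proof (cases "even k")
    case True
    then show ?thesis using ev by (metis evenE mult_2)
  next
    case False
    then obtain l where k: "k = Suc (l + l)" by (metis oddE mult_2 Suc_eq_plus1)
    let ?p = "\<lambda>j. v \<bullet> (T ^^ j) v"
    have nn: "0 \<le> ?p j" for j using psdD(3)[OF psd_funpow[OF T]] .
    have "(?p (Suc k))\<^sup>2 \<le> ?p k * ?p (Suc (Suc k))" by (rule moment_log_convex[OF T])
    also have "\<dots> \<le> ?p k * ?p (Suc k)"
      using ev[of "Suc l"] k nn[of k] by (intro mult_left_mono) auto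
    finally have "?p (Suc k) * ?p (Suc k) \<le> ?p k * ?p (Suc k)" by (simp add: power2_eq_square)
    then show ?thesis using nn[of "Suc k"] nn[of k]
      by (metis dual_order.order_iff_strict mult_right_le_imp_le)
  qed
qed

section \<open>Derivative of the trace potential along a rank-one update\<close>

definition rank_one_sub :: "('v::euclidean_space \<Rightarrow> 'v) \<Rightarrow> 'v \<Rightarrow> real \<Rightarrow> 'v \<Rightarrow> 'v" where
  "rank_one_sub T v e y = T y - e *\<^sub>R ((v \<bullet> y) *\<^sub>R v)"

lemma linear_rank_one_sub:
  assumes L: "linear T" shows "linear (rank_one_sub T v e)"
  unfolding rank_one_sub_def
  by (rule linearI) (simp_all add: linear_add[OF L] linear_scale[OF L] inner_add_right algebra_simps)

lemma inner_rank_one_sub: "x \<bullet> rank_one_sub T v e x = x \<bullet> T x - e * (v \<bullet> x)\<^sup>2"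
  by (simp add: rank_one_sub_def inner_diff_right inner_commute power2_eq_square)

lemma psd_rank_one_sub:
  assumes "psd T" and "\<And>x. e * (v \<bullet> x)\<^sup>2 \<le> x \<bullet> T x"
  shows "psd (rank_one_sub T v e)"
  unfolding psd_def using assms linear_rank_one_sub[OF psdD(1)[OF assms(1)]]
  by (auto simp: inner_rank_one_sub)
    (simp add: rank_one_sub_def inner_diff_left inner_diff_right psdD(2)[OF assms(1)] inner_commute[of v])

text \<open>Product rule for non-commuting factors: each of the \<open>k\<close> factors is replaced
  in turn by its derivative \<open>- e v v^T\<close>, with \<open>j\<close> factors left in front of
  it.\<close>

lemma funpow_rank_one_sub_derivative:
  fixes T :: "'v::euclidean_space \<Rightarrow> 'v"
  assumes L: "linear T"
  shows "((\<lambda>s. (rank_one_sub T v (s * e) ^^ k) y) has_vector_derivative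
    - (e *\<^sub>R (\<Sum>j<k. (v \<bullet> (rank_one_sub T v (s * e) ^^ (k - Suc j)) y) *\<^sub>R (rank_one_sub T v (s * e) ^^ j) v))) (at s)"
proof (induction k)
  case (Suc k)
  define U where "U = (\<lambda>s. rank_one_sub T v (s * e))"
  let ?y = "\<lambda>s. (U s ^^ k) y"
  let ?y' = "- (e *\<^sub>R (\<Sum>j<k. (v \<bullet> (U s ^^ (k - Suc j)) y) *\<^sub>R (U s ^^ j) v))"
  have bl: "bounded_linear T" using L by (simp add: linear_conv_bounded_linear)
  have lU: "linear (U s)" unfolding U_def by (rule linear_rank_one_sub[OF L])
  have 0: "(?y has_vector_derivative ?y') (at s)" using Suc by (simp add: U_def)
  have 1: "((\<lambda>s. T (?y s)) has_vector_derivative T ?y') (at s)"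
    by (rule bounded_linear.has_vector_derivative[OF bl 0])
  have 2: "((\<lambda>s. v \<bullet> ?y s) has_real_derivative v \<bullet> ?y') (at s)"
    using bounded_linear.has_vector_derivative[OF bounded_linear_inner_right 0]
    by (simp add: has_real_derivative_iff_has_vector_derivative)
  have 3: "((\<lambda>s. ((s * e) * (v \<bullet> ?y s)) *\<^sub>R v) has_vector_derivative
      ((s * e) * (v \<bullet> ?y') + e * (v \<bullet> ?y s)) *\<^sub>R v) (at s)"
    by (rule derivative_eq_intros refl 2 | simp add: algebra_simps)+
  have d: "((\<lambda>s. T (?y s) - ((s * e) * (v \<bullet> ?y s)) *\<^sub>R v) has_vector_derivative
      T ?y' - ((s * e) * (v \<bullet> ?y') + e * (v \<bullet> ?y s)) *\<^sub>R v) (at s)"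
    by (rule has_vector_derivative_diff[OF 1 3])
  have "T ?y' - ((s * e) * (v \<bullet> ?y') + e * (v \<bullet> ?y s)) *\<^sub>R v
      = U s ?y' - e *\<^sub>R ((v \<bullet> ?y s) *\<^sub>R v)"
    by (simp add: U_def rank_one_sub_def scaleR_add_left scaleR_diff_left algebra_simps)
  also have "U s ?y' = - (e *\<^sub>R (\<Sum>j<k. (v \<bullet> (U s ^^ (k - Suc j)) y) *\<^sub>R (U s ^^ Suc j) v))"
    by (simp add: linear_neg[OF lU] linear_scale[OF lU] linear_sum[OF lU])
  \<comment> \<open>Differentiating the new outermost factor gives the summand \<open>j = 0\<close>
    of the longer sum; the old summands move up by one index.\<close>
  also have "\<dots> - e *\<^sub>R ((v \<bullet> ?y s) *\<^sub>R v)
      = - (e *\<^sub>R (\<Sum>j<Suc k. (v \<bullet> (U s ^^ (Suc k - Suc j)) y) *\<^sub>R (U s ^^ j) v))"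
    by (simp add: sum.lessThan_Suc_shift scaleR_add_right del: sum.lessThan_Suc)
  finally have eq: "T ?y' - ((s * e) * (v \<bullet> ?y') + e * (v \<bullet> ?y s)) *\<^sub>R v
      = - (e *\<^sub>R (\<Sum>j<Suc k. (v \<bullet> (U s ^^ (Suc k - Suc j)) y) *\<^sub>R (U s ^^ j) v))" .
  have "(\<lambda>s. (U s ^^ Suc k) y) = (\<lambda>s. T (?y s) - ((s * e) * (v \<bullet> ?y s)) *\<^sub>R v)"
    by (simp add: U_def rank_one_sub_def)
  then show ?case using d unfolding eq by (simp only: U_def)
qed simp

text \<open>The derivative produces the exponent \<open>N - 1\<close>, but the bound is stated with
  \<open>T ^^ N\<close>: averaging \<open>v . (T ^^ N) v\<close> over an isotropic \<open>v\<close>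
  gives back the trace potential, so the estimate can be iterated. The exchange is allowed because
  \<open>T\<close> is at most the identity. The coercivity constant \<open>r\<close> is required
  only at the endpoint of the path, where the operator is smallest.\<close>

lemma trace_pow_rank_one_sub:
  fixes T :: "'v::euclidean_space \<Rightarrow> 'v"
  assumes T: "psd T" and le: "\<And>x. x \<bullet> T x \<le> x \<bullet> x"
    and r: "r > 0" "\<And>x. r * (x \<bullet> x) \<le> x \<bullet> rank_one_sub T v e x"
    and e: "e > 0" and kap: "kap > 0" "e * real N * (v \<bullet> v) / r \<le> kap" and N: "N > 0"
  shows "(\<Sum>b\<in>Basis. b \<bullet> (rank_one_sub T v e ^^ N) b)
    \<le> (\<Sum>b\<in>Basis. b \<bullet> (T ^^ N) b) - e * real N * ((1 - exp (- kap)) / kap) * (v \<bullet> (T ^^ N) v)"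
proof -
  obtain k where k: "N = Suc k" using N gr0_implies_Suc by blast
  define U where "U = (\<lambda>s. rank_one_sub T v (s * e))"
  have L: "linear T" using psdD(1)[OF T] .
  have rU: "r * (x \<bullet> x) \<le> x \<bullet> U s x" if "s \<le> 1" for s x
  proof -
    have "s * e * (v \<bullet> x)\<^sup>2 \<le> 1 * e * (v \<bullet> x)\<^sup>2" using that e by (intro mult_right_mono) auto
    then show ?thesis using r(2)[of x] by (simp add: U_def inner_rank_one_sub)
  qed
  have pU: "psd (U s)" if "s \<le> 1" for s unfolding U_def
  proof (rule psd_rank_one_sub[OF T])
    fix x :: 'v
    have "0 \<le> r * (x \<bullet> x)" using r(1) by simp
    then show "s * e * (v \<bullet> x)\<^sup>2 \<le> x \<bullet> T x"
      using rU[OF that, of x] by (simp add: U_def inner_rank_one_sub)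
  qed
  define h where "h = (\<lambda>s. v \<bullet> (U s ^^ k) v)"
  define f where "f = (\<lambda>s. \<Sum>b\<in>Basis. b \<bullet> (U s ^^ N) b)"
  define h' where "h' = (\<lambda>s. - (e * (\<Sum>j<k. (v \<bullet> (U s ^^ (k - Suc j)) v) * (v \<bullet> (U s ^^ j) v))))"
  have dh: "(h has_real_derivative h' s) (at s)" for s
    unfolding h_def h'_def U_def
    using bounded_linear.has_vector_derivative[OF bounded_linear_inner_right funpow_rank_one_sub_derivative[OF L, where v=v and e=e and k=k and y=v and s=s], of v]
    by (simp add: has_real_derivative_iff_has_vector_derivative inner_sum_right)
  have df: "(f has_real_derivative - (e * real N * h s)) (at s)" if s: "s \<le> 1" for s
  proof -
    have "(f has_real_derivative (\<Sum>b\<in>Basis. b \<bullet> (- (e *\<^sub>R (\<Sum>j<N. (v \<bullet> (U s ^^ (N - Suc j)) b) *\<^sub>R (U s ^^ j) v))))) (at s)"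
      unfolding f_def U_def
      by (intro DERIV_sum)
        (use bounded_linear.has_vector_derivative[OF bounded_linear_inner_right funpow_rank_one_sub_derivative[OF L, where v=v and e=e and k=N and s=s]]
         in \<open>simp add: has_real_derivative_iff_has_vector_derivative\<close>)
    also have "(\<Sum>b\<in>Basis. b \<bullet> (- (e *\<^sub>R (\<Sum>j<N. (v \<bullet> (U s ^^ (N - Suc j)) b) *\<^sub>R (U s ^^ j) v))))
      = - (e * (\<Sum>j<N. \<Sum>b\<in>Basis. ((U s ^^ j) v \<bullet> b) * ((U s ^^ (N - Suc j)) v \<bullet> b)))"
    proof -
      have "v \<bullet> (U s ^^ j) b = (U s ^^ j) v \<bullet> b" for j b
        by (simp add: funpow_selfadjoint[OF pU[OF s]])
      then show ?thesis
        by (subst sum.swap) (simp add: inner_sum_right sum_distrib_left sum_negf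
            inner_commute mult.commute mult.left_commute)
    qed
    \<comment> \<open>Cyclicity of the trace in coordinates: self-adjointness and Parseval fuse the
      two powers into the exponent \<open>j + (N - Suc j) = N - 1\<close>, whatever \<open>j\<close>
      is.\<close>
    also have "(\<Sum>j<N. \<Sum>b\<in>Basis. ((U s ^^ j) v \<bullet> b) * ((U s ^^ (N - Suc j)) v \<bullet> b)) = (\<Sum>j<N. h s)"
    proof (rule sum.cong)
      fix j assume "j \<in> {..<N}"
      then have "j + (N - Suc j) = k" using k by simp
      then show "(\<Sum>b\<in>Basis. ((U s ^^ j) v \<bullet> b) * ((U s ^^ (N - Suc j)) v \<bullet> b)) = h s"
        unfolding euclidean_inner[symmetric] funpow_inner_funpow[OF pU[OF s]] h_def by simp
    qed simp
    finally show ?thesis by (simp add: mult.assoc)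
  qed
  have hnn: "0 \<le> h s" if "s \<le> 1" for s unfolding h_def by (rule psdD(3)[OF psd_funpow[OF pU[OF that]]])
  \<comment> \<open>Every product of two moments in \<open>h'\<close> is at most
    \<open>(v . v) * p (k - 1)\<close>, and \<open>p (k - 1) <= h s / r\<close> since
    \<open>h s = p k\<close>. There are \<open>k <= N\<close> of them, which explains the lower
    bound imposed on \<open>kap\<close>.\<close>
  have h'ge: "- kap * h s \<le> h' s" if s: "s \<le> 1" for s
  proof -
    let ?p = "\<lambda>j. v \<bullet> (U s ^^ j) v"
    have "(\<Sum>j<k. ?p (k - Suc j) * ?p j) \<le> (\<Sum>j<k. (v \<bullet> v) * h s / r)"
    proof (rule sum_mono)
      fix j assume "j \<in> {..<k}"
      then have jk: "k - Suc j + j = k - 1" "Suc (k - 1) = k" by auto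
      have "?p (k - Suc j) * ?p j \<le> (v \<bullet> v) * ?p (k - 1)"
        using moment_supermult[OF pU[OF s] r(1) rU[OF s], of v "k - Suc j" j] jk by simp
      also have "\<dots> \<le> (v \<bullet> v) * (h s / r)"
        using moment_lower[OF pU[OF s] r(1) rU[OF s], of v "k - 1"] jk r(1)
        by (intro mult_left_mono) (auto simp: h_def field_simps)
      finally show "?p (k - Suc j) * ?p j \<le> (v \<bullet> v) * h s / r" by simp
    qed
    also have "\<dots> = real k * ((v \<bullet> v) * h s / r)" by simp
    also have "\<dots> \<le> real N * ((v \<bullet> v) * h s / r)"
      using k r(1) hnn[OF s] by (intro mult_right_mono) auto
    finally have "e * (\<Sum>j<k. ?p (k - Suc j) * ?p j) \<le> e * (real N * ((v \<bullet> v) * h s / r))"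
      using e by (intro mult_left_mono) auto
    also have "\<dots> = (e * real N * (v \<bullet> v) / r) * h s" by simp
    also have "\<dots> \<le> kap * h s" by (intro mult_right_mono kap hnn s)
    finally show ?thesis by (simp add: h'_def)
  qed
  have hge: "exp (- kap * s) * h 0 \<le> h s" if s: "0 \<le> s" "s \<le> 1" for s
  proof -
    define F where "F = (\<lambda>s. exp (kap * s) * h s)"
    have "F 0 \<le> F s"
    proof (rule DERIV_nonneg_imp_nondecreasing[where f=F, OF s(1)])
      fix x assume x: "0 \<le> x" "x \<le> s"
      have "(F has_real_derivative exp (kap * x) * (h' x + kap * h x)) (at x)"
        unfolding F_def by (auto intro!: derivative_eq_intros dh simp: algebra_simps)
      moreover have "0 \<le> exp (kap * x) * (h' x + kap * h x)" using h'ge[of x] x s by simp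
      ultimately show "\<exists>y. (F has_real_derivative y) (at x) \<and> 0 \<le> y" by blast
    qed
    then show ?thesis by (simp add: F_def exp_minus field_simps)
  qed
  \<comment> \<open>\<open>F\<close> compares \<open>f\<close> with a primitive of its bound: the
    derivative is \<open>e * N * (h x - exp (- kap * x) * h 0)\<close>, nonnegative by
    \<open>hge\<close>.\<close>
  define F where "F = (\<lambda>s. e * real N * h 0 * exp (- kap * s) / kap - f s)"
  have "F 0 \<le> F 1"
  proof (rule DERIV_nonneg_imp_nondecreasing[where f=F])
    fix x :: real assume x: "0 \<le> x" "x \<le> 1"
    have "(F has_real_derivative e * real N * (h x - exp (- kap * x) * h 0)) (at x)"
      unfolding F_def using kap(1) by (auto intro!: derivative_eq_intros df x simp: algebra_simps)
    moreover have "0 \<le> e * real N * (h x - exp (- kap * x) * h 0)" using hge[OF x] e by simp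
    ultimately show "\<exists>y. (F has_real_derivative y) (at x) \<and> 0 \<le> y" by blast
  qed simp
  then have "f 1 \<le> f 0 - e * real N * ((1 - exp (- kap)) / kap) * h 0"
    by (simp add: F_def diff_divide_distrib algebra_simps)
  also have "\<dots> \<le> f 0 - e * real N * ((1 - exp (- kap)) / kap) * (v \<bullet> (T ^^ N) v)"
  proof -
    have U0: "U 0 = T" by (rule ext) (simp add: U_def rank_one_sub_def)
    have "v \<bullet> (T ^^ N) v \<le> h 0" unfolding h_def U0 k by (rule moment_antimono[OF T le])
    then show ?thesis using e kap(1) by (intro diff_left_mono mult_left_mono) auto
  qed
  finally show ?thesis by (simp add: f_def U_def rank_one_sub_def[abs_def])
qed

section \<open>Determinants of Gram matrices\<close>

text \<open>Cauchy-Binet before symmetrisation: in the Leibniz formula the product over rows of sums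
  over \<open>i\<close> becomes a sum over all choices \<open>f\<close> of one sample index per
  row.\<close>

lemma det_gram_expansion:
  fixes V :: "'n::finite \<Rightarrow> real^'m::finite"
  shows "det (\<chi> j k. \<Sum>i\<in>UNIV. V i $ j * V i $ k)
    = (\<Sum>f\<in>UNIV. (\<Prod>j\<in>UNIV. V (f j) $ j) * det (\<chi> j. V (f j)))"
proof -
  let ?S = "{p. p permutes (UNIV :: 'm set)}"
  have swap: "(\<Prod>j\<in>UNIV. \<Sum>i\<in>UNIV. F j i) = (\<Sum>f\<in>UNIV. \<Prod>j\<in>UNIV. F j (f j))" for F :: "'m \<Rightarrow> 'n \<Rightarrow> real"
    using prod_sum_PiE[of "UNIV :: 'm set" "\<lambda>_. UNIV" F] by simp
  have "det (\<chi> j k. \<Sum>i\<in>UNIV. V i $ j * V i $ k)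
      = (\<Sum>p\<in>?S. \<Sum>f\<in>UNIV. of_int (sign p) * ((\<Prod>j\<in>UNIV. V (f j) $ j) * (\<Prod>j\<in>UNIV. V (f j) $ p j)))"
    unfolding det_def by (simp add: swap sum_distrib_left prod.distrib)
  also have "\<dots> = (\<Sum>f\<in>UNIV. (\<Prod>j\<in>UNIV. V (f j) $ j) * det (\<chi> j. V (f j)))"
    unfolding det_def by (subst sum.swap) (simp add: sum_distrib_left mult.left_commute)
  finally show ?thesis .
qed

lemma det_rows_not_inj:
  fixes V :: "'n \<Rightarrow> real^'m::finite"
  assumes "\<not> inj f" shows "det (\<chi> j. V (f j)) = 0"
proof -
  obtain i j where "i \<noteq> j" "f i = f j" using assms by (auto simp: inj_def)
  then show ?thesis by (intro det_identical_rows[of i j]) (auto simp: row_def vec_eq_iff)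
qed

lemma det_gram_expansion_inj:
  fixes V :: "'n::finite \<Rightarrow> real^'m::finite"
  shows "det (\<chi> j k. \<Sum>i\<in>UNIV. V i $ j * V i $ k)
    = (\<Sum>f | inj f. (\<Prod>j\<in>UNIV. V (f j) $ j) * det (\<chi> j. V (f j)))"
  unfolding det_gram_expansion
  by (rule sum.mono_neutral_right) (auto simp: det_rows_not_inj)

text \<open>Replacing \<open>f\<close> by \<open>f o p\<close> permutes the rows and multiplies the
  determinant by the sign of \<open>p\<close>. Summing the resulting expressions of the same Gram
  determinant over all \<open>p\<close> turns the diagonal product into a second determinant.
  Injections count every set of m sample indices m! times, hence the factorial.\<close>

lemma det_gram_sum_squares:
  fixes V :: "'n::finite \<Rightarrow> real^'m::finite"
  shows "fact CARD('m) * det (\<chi> j k. \<Sum>i\<in>UNIV. V i $ j * V i $ k)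
    = (\<Sum>f | inj f. (det (\<chi> j. V (f j)))\<^sup>2)"
proof -
  let ?D = "\<lambda>f. det (\<chi> j. V (f j))"
  let ?P = "{p. p permutes (UNIV :: 'm set)}"
  have perm: "det (\<chi> j k. \<Sum>i\<in>UNIV. V i $ j * V i $ k)
      = (\<Sum>f | inj f. of_int (sign p) * (\<Prod>j\<in>UNIV. V (f (p j)) $ j) * ?D f)" if p: "p permutes UNIV" for p
  proof -
    have bij: "bij_betw (\<lambda>f. f \<circ> p) {f :: 'm \<Rightarrow> 'n. inj f} {f. inj f}"
      by (rule bij_betwI[where g = "\<lambda>f. f \<circ> inv p"])
        (use p in \<open>auto simp: fun_eq_iff permutes_inverses intro!: inj_compose permutes_inj permutes_inv\<close>)
    have "?D (f \<circ> p) = of_int (sign p) * ?D f" for f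
      using det_permute_rows[OF p, of "\<chi> j. V (f j)"] by simp
    then show ?thesis
      unfolding det_gram_expansion_inj
      by (subst sum.reindex_bij_betw[OF bij, symmetric]) (simp add: mult.assoc mult.left_commute)
  qed
  have "fact CARD('m) * det (\<chi> j k. \<Sum>i\<in>UNIV. V i $ j * V i $ k)
      = (\<Sum>p\<in>?P. det (\<chi> j k. \<Sum>i\<in>UNIV. V i $ j * V i $ k))"
    by (simp add: card_permutations)
  also have "\<dots> = (\<Sum>p\<in>?P. \<Sum>f | inj f. of_int (sign p) * (\<Prod>j\<in>UNIV. V (f (p j)) $ j) * ?D f)"
    by (intro sum.cong refl perm) simp
  also have "\<dots> = (\<Sum>f | inj f. (\<Sum>p\<in>?P. of_int (sign p) * (\<Prod>j\<in>UNIV. V (f (p j)) $ j)) * ?D f)"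
    by (subst sum.swap) (simp add: sum_distrib_right)
  also have "\<dots> = (\<Sum>f | inj f. (?D f)\<^sup>2)"
  proof (intro sum.cong refl)
    fix f :: "'m \<Rightarrow> 'n"
    have "(\<Sum>p\<in>?P. of_int (sign p) * (\<Prod>j\<in>UNIV. V (f (p j)) $ j)) = det (transpose (\<chi> j. V (f j)))"
      by (simp add: det_def transpose_def)
    then show "(\<Sum>p\<in>?P. of_int (sign p) * (\<Prod>j\<in>UNIV. V (f (p j)) $ j)) * ?D f = (?D f)\<^sup>2"
      by (simp add: det_transpose power2_eq_square)
  qed
  finally show ?thesis .
qed

text \<open>This count is the total mass of the Gram determinant under the product measure, so it
  cancels the factorial ratio in \<open>gamma_meas\<close>.\<close>

lemma card_inj_funs:
  assumes "CARD('m) \<le> CARD('n)"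
  shows "card {f :: 'm::finite \<Rightarrow> 'n::finite. inj f} * fact (CARD('n) - CARD('m)) = (fact CARD('n) :: nat)"
proof -
  have "{f :: 'm \<Rightarrow> 'n. inj f} = {f \<in> UNIV \<rightarrow>\<^sub>E UNIV. inj_on f UNIV}" by auto
  then have "card {f :: 'm \<Rightarrow> 'n. inj f} = prod ((-) CARD('n)) {0..<CARD('m)}"
    using card_inj_on_subset_funcset[where B = "UNIV :: 'm set" and A = "UNIV :: 'm set" and C = "UNIV :: 'n set"]
    by simp
  moreover have "prod ((-) n) {0..<m} * fact (n - m) = (fact n :: nat)" if "m \<le> n" for m n :: nat
    using that
  proof (induction m)
    case (Suc m)
    have "fact (n - m) = (n - m) * (fact (n - Suc m) :: nat)"
      using Suc.prems fact_reduce[of "n - m", where ?'a = nat] by simp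
    then show ?case using Suc by (simp add: mult.assoc)
  qed simp
  ultimately show ?thesis using assms by simp
qed

text \<open>A permutation moving an index outside \<open>{a, b}\<close> meets a zero of an identity
  row, so only the identity and the transposition survive. Such matrices arise as mean matrices when
  two sample points carry a nontrivial factor; the next lemma treats a single point.\<close>

lemma det_identity_off_doubleton:
  fixes A :: "real^'m::finite^'m"
  assumes ab: "a \<noteq> b" and id: "\<And>j. j \<noteq> a \<Longrightarrow> j \<noteq> b \<Longrightarrow> A $ j = axis j 1"
  shows "det A = A $ a $ a * A $ b $ b - A $ a $ b * A $ b $ a"
proof -
  let ?t = "\<lambda>p. of_int (sign p) * (\<Prod>j\<in>UNIV. A $ j $ p j)"
  have "det A = (\<Sum>p | p permutes {a, b}. ?t p)"
    unfolding det_def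
  proof (rule sum.mono_neutral_right)
    show "{p. p permutes {a, b}} \<subseteq> {p. p permutes UNIV}" using permutes_subset by fastforce
    show "\<forall>p\<in>{p. p permutes UNIV} - {p. p permutes {a, b}}. ?t p = 0"
    proof
      fix p assume p: "p \<in> {p. p permutes UNIV} - {p. p permutes {a, b}}"
      then obtain j where "j \<notin> {a, b}" "p j \<noteq> j" unfolding permutes_def by blast
      then have "A $ j $ p j = 0" using id[of j] by (auto simp: axis_def)
      then show "?t p = 0" by (auto simp: prod_zero_iff)
    qed
  qed simp
  also have "{p. p permutes {a, b}} = {id, Transposition.transpose a b}"
    by (auto simp: permutes_doubleton_iff)
  also have "(\<Sum>p\<in>{id, Transposition.transpose a b}. ?t p) = (\<Prod>j\<in>UNIV. A $ j $ j)
      - (\<Prod>j\<in>UNIV. A $ j $ Transposition.transpose a b j)"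
  proof -
    have "id \<noteq> Transposition.transpose a b" using ab by (metis id_apply transpose_apply_first)
    then show ?thesis using ab by (simp add: sign_id sign_swap_id)
  qed
  also have "(\<Prod>j\<in>UNIV. A $ j $ j) = (\<Prod>j\<in>{a, b}. A $ j $ j)"
    by (rule prod.mono_neutral_right) (auto simp: id axis_def)
  also have "(\<Prod>j\<in>UNIV. A $ j $ Transposition.transpose a b j)
      = (\<Prod>j\<in>{a, b}. A $ j $ Transposition.transpose a b j)"
    by (rule prod.mono_neutral_right) (auto simp: id axis_def)
  finally show ?thesis using ab by simp
qed

lemma det_identity_off_singleton:
  fixes A :: "real^'m::finite^'m"
  assumes id: "\<And>j. j \<noteq> a \<Longrightarrow> A $ j = axis j 1"
  shows "det A = A $ a $ a"
proof -
  let ?t = "\<lambda>p. of_int (sign p) * (\<Prod>j\<in>UNIV. A $ j $ p j)"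
  have "det A = (\<Sum>p\<in>{id}. ?t p)"
    unfolding det_def
  proof (rule sum.mono_neutral_right)
    show "\<forall>p\<in>{p. p permutes UNIV} - {id}. ?t p = 0"
    proof
      fix p :: "'m \<Rightarrow> 'm" assume p: "p \<in> {p. p permutes UNIV} - {id}"
      then have "\<not> p permutes {a}" by auto
      then obtain j where "j \<noteq> a" "p j \<noteq> j" using p unfolding permutes_def by blast
      then have "A $ j $ p j = 0" using id[of j] by (auto simp: axis_def)
      then show "?t p = 0" by (auto simp: prod_zero_iff)
    qed
  qed (auto simp: permutes_id)
  also have "\<dots> = (\<Prod>j\<in>UNIV. A $ j $ j)" by (simp add: sign_id)
  also have "\<dots> = (\<Prod>j\<in>{a}. A $ j $ j)"
    by (rule prod.mono_neutral_right) (auto simp: id axis_def)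
  finally show ?thesis by simp
qed

section \<open>Isotropic bounded random vectors\<close>

text \<open>The bound on \<open>v\<close> is required at every point, not almost everywhere, because
  the operator inequalities below are applied to each individual sample.\<close>

locale bounded_frame = prob_space M for M :: "'a measure" +
  fixes v :: "'a \<Rightarrow> real^'m::finite" and K :: real
  assumes v_measurable [measurable]: "v \<in> borel_measurable M"
    and v_bounded: "v x \<bullet> v x \<le> K"
    and isotropic: "(\<integral>x. v x $ j * v x $ k \<partial>M) = (if j = k then 1 else 0)"
begin

lemma v_component_measurable [measurable]: "(\<lambda>x. v x $ j) \<in> borel_measurable M"
proof -
  have "(\<lambda>x. v x \<bullet> axis j 1) \<in> borel_measurable M" by measurable
  then show ?thesis by (simp add: inner_axis)
qed

lemma v_prod_bounded: "\<bar>v x $ j * v x $ k\<bar> \<le> K"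
proof -
  have sq: "\<bar>v x $ j\<bar> \<le> norm (v x)" for j by (rule component_le_norm_cart)
  have "\<bar>v x $ j * v x $ k\<bar> \<le> norm (v x) * norm (v x)"
    by (simp add: abs_mult mult_mono sq)
  also have "\<dots> \<le> K" using v_bounded[of x] by (simp add: dot_square_norm power2_eq_square)
  finally show ?thesis .
qed

lemma v_prod_integrable: "integrable M (\<lambda>x. v x $ j * v x $ k)"
  by (rule integrable_const_bound[of _ K]) (auto intro: v_prod_bounded)

lemma K_pos: "K > 0"
proof -
  have "0 < (\<integral>x. v x $ j * v x $ j \<partial>M)" for j by (simp add: isotropic)
  also have "(\<integral>x. v x $ j * v x $ j \<partial>M) \<le> (\<integral>x. K \<partial>M)" for j
    using v_prod_bounded by (intro integral_mono v_prod_integrable) (auto intro: order_trans[OF abs_ge_self])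
  finally show ?thesis by (simp add: prob_space)
qed

lemma
  assumes P: "linear P"
  shows integrable_quadratic: "integrable M (\<lambda>x. v x \<bullet> P (v x))"
    and integral_quadratic: "(\<integral>x. v x \<bullet> P (v x) \<partial>M) = (\<Sum>b\<in>Basis. b \<bullet> P b)"
proof -
  have *: "v x \<bullet> P (v x) = (\<Sum>b\<in>Basis. \<Sum>c\<in>Basis. (v x \<bullet> b) * (v x \<bullet> c) * (b \<bullet> P c))" for x
  proof -
    have "P (v x) = (\<Sum>c\<in>Basis. (v x \<bullet> c) *\<^sub>R P c)"
      by (subst euclidean_representation[symmetric]) (simp add: linear_sum[OF P] linear_scale[OF P])
    then show ?thesis
      by (subst euclidean_inner)
        (simp add: inner_sum_right sum_distrib_left mult.assoc mult.left_commute inner_commute)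
  qed
  have b: "integrable M (\<lambda>x. (v x \<bullet> b) * (v x \<bullet> c)) \<and>
     (\<integral>x. (v x \<bullet> b) * (v x \<bullet> c) \<partial>M) = (if b = c then 1 else 0)" if bc: "b \<in> Basis" "c \<in> Basis" for b c
  proof -
    obtain j k where "b = axis j 1" "c = axis k 1" using bc by (auto simp: Basis_vec_def)
    then show ?thesis by (simp add: inner_axis v_prod_integrable isotropic axis_eq_axis)
  qed
  have i: "integrable M (\<lambda>x. (v x \<bullet> b) * (v x \<bullet> c) * (b \<bullet> P c))" if "b \<in> Basis" "c \<in> Basis" for b c
    using b[OF that] by simp
  show "integrable M (\<lambda>x. v x \<bullet> P (v x))" unfolding * using i by (intro Bochner_Integration.integrable_sum) auto
  have "(\<integral>x. v x \<bullet> P (v x) \<partial>M) = (\<Sum>b\<in>Basis. \<Sum>c\<in>Basis. (\<integral>x. (v x \<bullet> b) * (v x \<bullet> c) * (b \<bullet> P c) \<partial>M))"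
    unfolding * using i by (simp add: Bochner_Integration.integral_sum Bochner_Integration.integrable_sum)
  also have "\<dots> = (\<Sum>b\<in>Basis. b \<bullet> P b)" using b by (simp add: sum.delta' if_distrib[of "\<lambda>x. x * _"] cong: if_cong)
  finally show "(\<integral>x. v x \<bullet> P (v x) \<partial>M) = (\<Sum>b\<in>Basis. b \<bullet> P b)" .
qed

section \<open>The operators \<open>I - e A\<close> and the mean of their trace potential\<close>

definition shrink :: "real \<Rightarrow> 'i set \<Rightarrow> ('i \<Rightarrow> 'a) \<Rightarrow> real^'m \<Rightarrow> real^'m" where
  "shrink e J x y = y - e *\<^sub>R (\<Sum>i\<in>J. (v (x i) \<bullet> y) *\<^sub>R v (x i))"

lemma shrink_insert:
  assumes "finite J" "i \<notin> J"
  shows "shrink e (insert i J) (x(i := a)) = rank_one_sub (shrink e J x) (v a) e"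
proof
  fix y
  have "(\<Sum>l\<in>J. (v ((x(i := a)) l) \<bullet> y) *\<^sub>R v ((x(i := a)) l)) = (\<Sum>l\<in>J. (v (x l) \<bullet> y) *\<^sub>R v (x l))"
    using assms(2) by (intro sum.cong) auto
  then show "shrink e (insert i J) (x(i := a)) y = rank_one_sub (shrink e J x) (v a) e y"
    using assms by (simp add: shrink_def rank_one_sub_def algebra_simps)
qed

lemma inner_shrink: "y \<bullet> shrink e J x y = y \<bullet> y - e * (\<Sum>i\<in>J. (v (x i) \<bullet> y)\<^sup>2)"
  by (simp add: shrink_def inner_diff_right inner_sum_right power2_eq_square inner_commute)

lemma inner_shrink_le: "e \<ge> 0 \<Longrightarrow> y \<bullet> shrink e J x y \<le> y \<bullet> y"
  by (simp add: inner_shrink sum_nonneg)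

text \<open>Here and in \<open>psd_shrink\<close>, \<open>N\<close> bounds the number of points; it
  is not the exponent of the potential. Each rank-one term is at most \<open>K\<close> by
  Cauchy-Schwarz.\<close>

lemma inner_shrink_ge:
  assumes "e \<ge> 0" and "card J \<le> N"
  shows "(1 - e * real N * K) * (y \<bullet> y) \<le> y \<bullet> shrink e J x y"
proof -
  have "(\<Sum>i\<in>J. (v (x i) \<bullet> y)\<^sup>2) \<le> (\<Sum>i\<in>J. K * (y \<bullet> y))"
  proof (rule sum_mono)
    fix i
    have "(v (x i) \<bullet> y)\<^sup>2 \<le> (v (x i) \<bullet> v (x i)) * (y \<bullet> y)" by (rule Cauchy_Schwarz_ineq)
    also have "\<dots> \<le> K * (y \<bullet> y)" by (intro mult_right_mono v_bounded) simp
    finally show "(v (x i) \<bullet> y)\<^sup>2 \<le> K * (y \<bullet> y)" .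
  qed
  also have "\<dots> \<le> real N * (K * (y \<bullet> y))"
    using assms(2) K_pos by (simp add: mult_right_mono)
  finally have "e * (\<Sum>i\<in>J. (v (x i) \<bullet> y)\<^sup>2) \<le> e * (real N * (K * (y \<bullet> y)))"
    using assms(1) by (simp add: mult_left_mono)
  then show ?thesis by (simp add: inner_shrink algebra_simps)
qed

lemma psd_shrink:
  assumes "e \<ge> 0" and "card J \<le> N" and "e * real N * K \<le> 1"
  shows "psd (shrink e J x)"
  unfolding psd_def
proof (intro conjI allI)
  show "linear (shrink e J x)"
    by (rule linearI) (simp_all add: shrink_def inner_add_right sum.distrib scaleR_add_left
        scaleR_sum_right algebra_simps)
  show "shrink e J x y \<bullet> z = y \<bullet> shrink e J x z" for y z
    by (simp add: shrink_def inner_diff_left inner_diff_right inner_sum_left inner_sum_right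
        inner_commute mult.commute)
  show "0 \<le> y \<bullet> shrink e J x y" for y
    using inner_shrink_ge[OF assms(1,2), of y x] assms(3)
    by (smt (verit) inner_ge_zero mult_nonneg_nonneg)
qed

lemma measurable_shrink_funpow:
  assumes J: "finite J" "J \<subseteq> I"
  shows "(\<lambda>x. (shrink e J x ^^ k) y) \<in> borel_measurable (PiM I (\<lambda>_. M))"
proof (induction k)
  case (Suc k)
  note [measurable] = Suc
  have [measurable]: "(\<lambda>x. v (x i)) \<in> borel_measurable (PiM I (\<lambda>_. M))" if "i \<in> J" for i
    by (rule measurable_compose[OF _ v_measurable]) (use that J in auto)
  have "(\<lambda>x. \<Sum>i\<in>J. (v (x i) \<bullet> (shrink e J x ^^ k) y) *\<^sub>R v (x i)) \<in> borel_measurable (PiM I (\<lambda>_. M))"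
    by (intro borel_measurable_sum) measurable
  then have "(\<lambda>x. (shrink e J x ^^ k) y - e *\<^sub>R (\<Sum>i\<in>J. (v (x i) \<bullet> (shrink e J x ^^ k) y) *\<^sub>R v (x i)))
      \<in> borel_measurable (PiM I (\<lambda>_. M))"
    by measurable
  then show ?case by (simp add: shrink_def[abs_def])
qed simp

lemma measurable_trace_shrink:
  assumes J: "finite J" "J \<subseteq> I"
  shows "(\<lambda>x. \<Sum>b\<in>Basis. b \<bullet> (shrink e J x ^^ k) b) \<in> borel_measurable (PiM I (\<lambda>_. M))"
  using measurable_shrink_funpow[OF assms] by measurable

text \<open>Points are integrated out one at a time. Since \<open>v a . P (v a)\<close> has mean
  equal to the trace of \<open>P\<close>, a new point multiplies the mean potential by at most
  \<open>1 - q <= exp (- q)\<close>. The bound \<open>L\<close> on the number of points is fixed in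
  advance so that \<open>kap\<close> and \<open>q\<close> stay the same during the
  induction.\<close>

lemma mean_trace_shrink:
  fixes J :: "'i set"
  assumes J: "finite J" "card J \<le> L" and e: "e > 0" and r: "1 - e * real L * K > 0" and N: "N > 0"
  defines "kap \<equiv> e * real N * K / (1 - e * real L * K)"
  defines "q \<equiv> e * real N * ((1 - exp (- kap)) / kap)"
  shows "(\<integral>\<^sup>+x. ennreal (\<Sum>b\<in>Basis. b \<bullet> (shrink e J x ^^ N) b) \<partial>PiM J (\<lambda>_. M))
    \<le> ennreal (real CARD('m) * exp (- q * real (card J)))"
  using J
proof (induction J)
  case empty
  have "(shrink e {} x ^^ N) b = b" for x :: "'i \<Rightarrow> 'a" and b by (induction N) (auto simp: shrink_def)
  then have "(\<Sum>b\<in>(Basis :: (real^'m) set). b \<bullet> (shrink e {} x ^^ N) b) = real CARD('m)" for x :: "'i \<Rightarrow> 'a"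
    by simp
  then show ?case by (simp add: PiM_empty)
next
  case (insert i J)
  interpret P: product_sigma_finite "\<lambda>_. M" by standard
  let ?tr = "\<lambda>J x. (\<Sum>b\<in>Basis. b \<bullet> (shrink e J x ^^ N) b)"
  have cJ: "card J \<le> L" and cJ': "card (insert i J) \<le> L" using insert by auto
  have kap: "kap > 0" unfolding kap_def using e N K_pos r by simp
  have psd: "psd (shrink e J x)" for x using psd_shrink[OF _ cJ] e r by simp
  have step: "(\<integral>\<^sup>+a. ennreal (?tr (insert i J) (x(i := a))) \<partial>M) \<le> ennreal (exp (- q)) * ennreal (?tr J x)" for x
  proof -
    let ?P = "shrink e J x ^^ N"
    have lin: "linear ?P" by (rule linear_funpow[OF psdD(1)[OF psd]])
    have T0: "0 \<le> ?tr J x" by (intro sum_nonneg psdD(3)[OF psd_funpow[OF psd]])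
    have le: "?tr (insert i J) (x(i := a)) \<le> ?tr J x - q * (v a \<bullet> ?P (v a))" for a
      unfolding shrink_insert[OF insert(1,2)] q_def
    proof (rule trace_pow_rank_one_sub[OF psd])
      show "y \<bullet> shrink e J x y \<le> y \<bullet> y" for y using e by (intro inner_shrink_le) simp
      show "(1 - e * real L * K) * (y \<bullet> y) \<le> y \<bullet> rank_one_sub (shrink e J x) (v a) e y" for y
        unfolding shrink_insert[OF insert(1,2), symmetric]
        by (rule inner_shrink_ge[OF _ cJ']) (use e in simp)
      show "e * real N * (v a \<bullet> v a) / (1 - e * real L * K) \<le> kap"
        unfolding kap_def using e r by (intro divide_right_mono mult_left_mono v_bounded) auto
    qed (use e r kap N in auto)
    have nn: "0 \<le> ?tr (insert i J) (x(i := a))" for a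
      using psd_funpow[OF psd_shrink[OF _ cJ']] e r by (intro sum_nonneg psdD(3)) auto
    have int: "integrable M (\<lambda>a. ?tr J x - q * (v a \<bullet> ?P (v a)))"
      using integrable_quadratic[OF lin] by auto
    have "(\<integral>\<^sup>+a. ennreal (?tr (insert i J) (x(i := a))) \<partial>M)
        \<le> (\<integral>\<^sup>+a. ennreal (?tr J x - q * (v a \<bullet> ?P (v a))) \<partial>M)"
      by (intro nn_integral_mono ennreal_leI le)
    also have "\<dots> = ennreal (\<integral>a. ?tr J x - q * (v a \<bullet> ?P (v a)) \<partial>M)"
      by (intro nn_integral_eq_integral int AE_I2 order_trans[OF nn le])
    also have "(\<integral>a. ?tr J x - q * (v a \<bullet> ?P (v a)) \<partial>M) = (1 - q) * ?tr J x"
      using integrable_quadratic[OF lin] by (simp add: integral_quadratic[OF lin] prob_space algebra_simps)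
    also have "ennreal \<dots> \<le> ennreal (exp (- q) * ?tr J x)"
      using exp_ge_add_one_self[of "- q"] T0 by (intro ennreal_leI mult_right_mono) auto
    finally show ?thesis by (simp only: ennreal_mult''[OF T0])
  qed
  have "(\<integral>\<^sup>+x. ennreal (?tr (insert i J) x) \<partial>PiM (insert i J) (\<lambda>_. M))
      = (\<integral>\<^sup>+x. \<integral>\<^sup>+a. ennreal (?tr (insert i J) (x(i := a))) \<partial>M \<partial>PiM J (\<lambda>_. M))"
    using measurable_trace_shrink[of "insert i J" "insert i J"] insert(1,2)
    by (intro P.product_nn_integral_insert) auto
  also have "\<dots> \<le> (\<integral>\<^sup>+x. ennreal (exp (- q)) * ennreal (?tr J x) \<partial>PiM J (\<lambda>_. M))"
    by (intro nn_integral_mono step)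
  also have "\<dots> = ennreal (exp (- q)) * (\<integral>\<^sup>+x. ennreal (?tr J x) \<partial>PiM J (\<lambda>_. M))"
    using measurable_trace_shrink[of J J] insert(1) by (intro nn_integral_cmult) auto
  also have "\<dots> \<le> ennreal (exp (- q)) * ennreal (real CARD('m) * exp (- q * real (card J)))"
    by (intro mult_left_mono insert.IH cJ) auto
  also have "\<dots> = ennreal (real CARD('m) * exp (- q * real (card (insert i J))))"
    using insert(1,2) by (simp add: ennreal_mult''[symmetric] exp_add[symmetric] algebra_simps)
  finally show ?case .
qed

section \<open>The Gram determinant as a density, and its one- and two-point moments\<close>

definition vol :: "('n::finite \<Rightarrow> 'a) \<Rightarrow> real" where
  "vol x = det (\<chi> j k. \<Sum>i\<in>UNIV. v (x i) $ j * v (x i) $ k)"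

lemma vol_sum_squares:
  "fact CARD('m) * vol x = (\<Sum>f | inj f. (det (\<chi> j. v (x (f j))))\<^sup>2)"
  for x :: "'n::finite \<Rightarrow> 'a"
  unfolding vol_def by (rule det_gram_sum_squares[of "\<lambda>i. v (x i)"])

lemma vol_nonneg: "0 \<le> vol x"
proof -
  have "0 \<le> (\<Sum>f | inj f. (det (\<chi> j. v (x (f j))))\<^sup>2)" by (intro sum_nonneg) simp
  then show ?thesis unfolding vol_sum_squares[symmetric] 
    using fact_gt_zero[of "CARD('m)", where ?'a = real] by (auto simp: zero_le_mult_iff not_le)
qed

lemma measurable_v_coordinate:
  assumes "i \<in> I"
  shows "(\<lambda>x. v (x i) $ j) \<in> borel_measurable (PiM I (\<lambda>_. M))"
  by (rule measurable_compose[OF _ v_component_measurable]) (use assms in auto)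

lemma measurable_det_frame:
  assumes "range f \<subseteq> I"
  shows "(\<lambda>x. det (\<chi> j. v (x (f j)))) \<in> borel_measurable (PiM I (\<lambda>_. M))"
  unfolding det_def using assms
  by (intro borel_measurable_sum borel_measurable_times borel_measurable_const borel_measurable_prod)
    (auto intro!: measurable_v_coordinate)

lemma measurable_vol: "(vol :: ('n::finite \<Rightarrow> 'a) \<Rightarrow> real) \<in> borel_measurable (PiM UNIV (\<lambda>_. M))"
  unfolding vol_def[abs_def] det_def
  by (intro borel_measurable_sum borel_measurable_times borel_measurable_const borel_measurable_prod)
    (auto intro!: borel_measurable_sum borel_measurable_times measurable_v_coordinate)

lemma integrable_v_prod_mult:
  assumes "integrable M h" shows "integrable M (\<lambda>x. v x $ j * v x $ k * h x)"
proof (rule Bochner_Integration.integrable_bound)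
  show "integrable M (\<lambda>x. K * h x)" using assms by simp
  show "(\<lambda>x. v x $ j * v x $ k * h x) \<in> borel_measurable M" using assms by measurable
  show "AE x in M. norm (v x $ j * v x $ k * h x) \<le> norm (K * h x)"
    using v_prod_bounded K_pos by (intro AE_I2) (auto simp: abs_mult intro!: mult_right_mono)
qed

lemma
  fixes f :: "'l::finite \<Rightarrow> 'n::finite" and q :: "'l \<Rightarrow> 'a \<Rightarrow> real" and h :: "'n \<Rightarrow> 'a \<Rightarrow> real"
  assumes f: "inj f" and q: "\<And>j. integrable M (q j)" and h: "\<And>i. integrable M (h i)"
  shows integrable_prod_split:
      "integrable (PiM UNIV (\<lambda>_. M)) (\<lambda>x. (\<Prod>j\<in>UNIV. q j (x (f j))) * (\<Prod>i\<in>- range f. h i (x i)))"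
    and integral_prod_split:
      "(\<integral>x. (\<Prod>j\<in>UNIV. q j (x (f j))) * (\<Prod>i\<in>- range f. h i (x i)) \<partial>PiM UNIV (\<lambda>_. M))
        = (\<Prod>j\<in>UNIV. \<integral>a. q j a \<partial>M) * (\<Prod>i\<in>- range f. \<integral>a. h i a \<partial>M)"
proof -
  interpret P: product_sigma_finite "\<lambda>_. M" by standard
  \<comment> \<open>Glues both families into one family over all sample indices, so that a single
    product formula applies.\<close>
  define g where "g i = (if i \<in> range f then q (inv f i) else h i)" for i
  have split: "(\<Prod>i\<in>UNIV. F i) = (\<Prod>j\<in>UNIV. F (f j)) * (\<Prod>i\<in>- range f. F i)" for F :: "'n \<Rightarrow> real"
    using prod.subset_diff[of "range f" UNIV F] prod.reindex[OF f, of F]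
    by (simp add: Compl_eq_Diff_UNIV mult.commute)
  have g1: "g (f j) = q j" for j using f by (simp add: g_def)
  have g2: "(\<Prod>i\<in>- range f. F i (g i)) = (\<Prod>i\<in>- range f. F i (h i))" for F :: "'n \<Rightarrow> ('a \<Rightarrow> real) \<Rightarrow> real"
    by (intro prod.cong) (auto simp: g_def)
  have gi: "integrable M (g i)" for i using q h by (simp add: g_def)
  have eq: "(\<Prod>j\<in>UNIV. q j (x (f j))) * (\<Prod>i\<in>- range f. h i (x i)) = (\<Prod>i\<in>UNIV. g i (x i))" for x
    unfolding split[of "\<lambda>i. g i (x i)"] g1 g2[of "\<lambda>i h. h (x i)"] ..
  show "integrable (PiM UNIV (\<lambda>_. M)) (\<lambda>x. (\<Prod>j\<in>UNIV. q j (x (f j))) * (\<Prod>i\<in>- range f. h i (x i)))"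
    unfolding eq by (rule P.product_integrable_prod) (auto intro: gi)
  have "(\<integral>x. (\<Prod>i\<in>UNIV. g i (x i)) \<partial>PiM UNIV (\<lambda>_. M)) = (\<Prod>i\<in>UNIV. \<integral>a. g i a \<partial>M)"
    by (rule P.product_integral_prod) (auto intro: gi)
  also have "\<dots> = (\<Prod>j\<in>UNIV. \<integral>a. q j a \<partial>M) * (\<Prod>i\<in>- range f. \<integral>a. h i a \<partial>M)"
    unfolding split[of "\<lambda>i. \<integral>a. g i a \<partial>M"] g1 g2[of "\<lambda>i h. \<integral>a. h a \<partial>M"] ..
  finally show "(\<integral>x. (\<Prod>j\<in>UNIV. q j (x (f j))) * (\<Prod>i\<in>- range f. h i (x i)) \<partial>PiM UNIV (\<lambda>_. M))
        = (\<Prod>j\<in>UNIV. \<integral>a. q j a \<partial>M) * (\<Prod>i\<in>- range f. \<integral>a. h i a \<partial>M)" unfolding eq .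
qed

text \<open>The generating formula for all moments below. After expansion over injections and
  permutations each term is a product of functions of single points. Integrating the factors and
  resumming over permutations rebuilds a determinant whose row \<open>j\<close> is weighted by
  \<open>h (f j)\<close>; points off the range of \<open>f\<close> contribute plain means.\<close>

lemma
  fixes h :: "'n::finite \<Rightarrow> 'a \<Rightarrow> real"
  assumes h: "\<And>i. integrable M (h i)"
  shows integrable_vol_prod: "integrable (PiM UNIV (\<lambda>_. M)) (\<lambda>x. vol x * (\<Prod>i\<in>UNIV. h i (x i)))"
    and integral_vol_prod: "(\<integral>x. vol x * (\<Prod>i\<in>UNIV. h i (x i)) \<partial>PiM UNIV (\<lambda>_. M))
      = (\<Sum>f | inj f. det (\<chi> j k. \<integral>a. v a $ j * v a $ k * h (f j) a \<partial>M) * (\<Prod>i\<in>- range f. \<integral>a. h i a \<partial>M))"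
proof -
  let ?I = "{f :: 'm \<Rightarrow> 'n. inj f}" and ?S = "{p. p permutes (UNIV :: 'm set)}"
  let ?t = "\<lambda>f p x. of_int (sign p) * ((\<Prod>j\<in>UNIV. v (x (f j)) $ j * v (x (f j)) $ p j * h (f j) (x (f j)))
        * (\<Prod>i\<in>- range f. h i (x i)))"
  have eq: "vol x * (\<Prod>i\<in>UNIV. h i (x i)) = (\<Sum>f\<in>?I. \<Sum>p\<in>?S. ?t f p x)" for x
  proof -
    have "(\<Prod>i\<in>UNIV. h i (x i)) = (\<Prod>j\<in>UNIV. h (f j) (x (f j))) * (\<Prod>i\<in>- range f. h i (x i))"
      if "inj f" for f :: "'m \<Rightarrow> 'n"
      using prod.subset_diff[of "range f" UNIV "\<lambda>i. h i (x i)"] prod.reindex[OF that, of "\<lambda>i. h i (x i)"]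
      by (simp add: Compl_eq_Diff_UNIV mult.commute)
    then show ?thesis
      unfolding vol_def det_gram_expansion_inj[of "\<lambda>i. v (x i)"]
      unfolding det_def sum_distrib_left sum_distrib_right
      by (intro sum.cong refl) (simp add: prod.distrib mult.assoc mult.left_commute mult.commute)
  qed
  have int: "integrable (PiM UNIV (\<lambda>_. M)) (?t f p)" if "f \<in> ?I" for f p
    by (intro integrable_mult_right integrable_prod_split) (use that h integrable_v_prod_mult in auto)
  show "integrable (PiM UNIV (\<lambda>_. M)) (\<lambda>x. vol x * (\<Prod>i\<in>UNIV. h i (x i)))"
    unfolding eq by (intro Bochner_Integration.integrable_sum int)
  have "(\<integral>x. vol x * (\<Prod>i\<in>UNIV. h i (x i)) \<partial>PiM UNIV (\<lambda>_. M))
      = (\<Sum>f\<in>?I. \<Sum>p\<in>?S. \<integral>x. ?t f p x \<partial>PiM UNIV (\<lambda>_. M))"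
    unfolding eq using int by (simp add: Bochner_Integration.integral_sum Bochner_Integration.integrable_sum)
  also have "\<dots> = (\<Sum>f\<in>?I. \<Sum>p\<in>?S. of_int (sign p) * ((\<Prod>j\<in>UNIV. \<integral>a. v a $ j * v a $ p j * h (f j) a \<partial>M)
        * (\<Prod>i\<in>- range f. \<integral>a. h i a \<partial>M)))"
  proof (intro sum.cong refl)
    fix f p assume "f \<in> ?I"
    then show "(\<integral>x. ?t f p x \<partial>PiM UNIV (\<lambda>_. M)) = of_int (sign p) *
       ((\<Prod>j\<in>UNIV. \<integral>a. v a $ j * v a $ p j * h (f j) a \<partial>M) * (\<Prod>i\<in>- range f. \<integral>a. h i a \<partial>M))"
      using integral_prod_split[where f = f and h = h and q = "\<lambda>j a. v a $ j * v a $ p j * h (f j) a"] h integrable_v_prod_mult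
      by simp
  qed
  also have "\<dots> = (\<Sum>f\<in>?I. det (\<chi> j k. \<integral>a. v a $ j * v a $ k * h (f j) a \<partial>M) * (\<Prod>i\<in>- range f. \<integral>a. h i a \<partial>M))"
    unfolding det_def by (simp add: sum_distrib_right mult.assoc)
  finally show "(\<integral>x. vol x * (\<Prod>i\<in>UNIV. h i (x i)) \<partial>PiM UNIV (\<lambda>_. M))
      = (\<Sum>f | inj f. det (\<chi> j k. \<integral>a. v a $ j * v a $ k * h (f j) a \<partial>M) * (\<Prod>i\<in>- range f. \<integral>a. h i a \<partial>M))" .
qed

lemma card_Compl_range_inj:
  "inj f \<Longrightarrow> real (card (- range f)) = real CARD('n) - real CARD('l)"
  for f :: "'l::finite \<Rightarrow> 'n::finite"
  using card_image[of f UNIV] card_mono[of UNIV "range f"]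
  by (simp add: Compl_eq_Diff_UNIV card_Diff_subset of_nat_diff)

lemma integral_v_prod_eq_axis: "(\<chi> k. \<integral>a. v a $ j * v a $ k \<partial>M) = axis j 1"
  by (auto simp: vec_eq_iff isotropic axis_def)

lemma integral_inner_v_mult:
  assumes "integrable M h"
  shows "(\<integral>a. (v a \<bullet> v a) * h a \<partial>M) = (\<Sum>j\<in>UNIV. \<integral>a. v a $ j * v a $ j * h a \<partial>M)"
    and "integrable M (\<lambda>a. (v a \<bullet> v a) * h a)"
  using integrable_v_prod_mult[OF assms]
  by (auto simp: inner_vec_def sum_distrib_right Bochner_Integration.integral_sum)

text \<open>Fix an injection \<open>f\<close> and let \<open>h\<close> sit at one sample index
  \<open>l\<close>. If \<open>l = f b\<close>, the mean matrix differs from the identity only in row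
  \<open>b\<close> and yields the integral of \<open>v_b^2 h\<close>; over all \<open>b\<close>
  these add up to the integral of \<open>(v . v) h\<close>. Each of the n - m indices off the range
  yields the integral of \<open>h\<close>.\<close>

lemma
  assumes h: "integrable M h"
  shows integrable_vol_sum: "integrable (PiM UNIV (\<lambda>_. M)) (\<lambda>x. vol x * (\<Sum>i\<in>(UNIV :: 'n::finite set). h (x i)))"
    and integral_vol_sum: "(\<integral>x. vol x * (\<Sum>i\<in>(UNIV :: 'n::finite set). h (x i)) \<partial>PiM UNIV (\<lambda>_. M))
      = real (card {f :: 'm \<Rightarrow> 'n. inj f})
        * ((\<integral>a. (v a \<bullet> v a) * h a \<partial>M) + (real CARD('n) - real CARD('m)) * (\<integral>a. h a \<partial>M))"
proof -
  let ?N = "PiM (UNIV :: 'n set) (\<lambda>_. M)"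
  \<comment> \<open>The family with \<open>h\<close> at index \<open>l\<close> and the constant 1
    elsewhere reduces the sum to the product formula.\<close>
  define H where "H = (\<lambda>l i :: 'n. if i = l then h else (\<lambda>_. 1))"
  have Hi: "integrable M (H l i)" for l i using h by (simp add: H_def)
  have prodH: "(\<Prod>i\<in>UNIV. H l i (x i)) = h (x l)" for l x
    using prod.remove[of UNIV l "\<lambda>i. H l i (x i)"] by (simp add: H_def)
  have int: "integrable ?N (\<lambda>x. vol x * h (x l))" for l
    using integrable_vol_prod[of "H l", OF Hi] by (simp add: prodH)
  then show "integrable ?N (\<lambda>x. vol x * (\<Sum>i\<in>UNIV. h (x i)))"
    by (simp add: sum_distrib_left)
  have one: "(\<Sum>l\<in>UNIV. det (\<chi> j k. \<integral>a. v a $ j * v a $ k * H l (f j) a \<partial>M) * (\<Prod>i\<in>- range f. \<integral>a. H l i a \<partial>M))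
     = (\<integral>a. (v a \<bullet> v a) * h a \<partial>M) + (real CARD('n) - real CARD('m)) * (\<integral>a. h a \<partial>M)"
    (is "(\<Sum>l\<in>UNIV. ?d l * ?c l) = _") if f: "inj f" for f :: "'m \<Rightarrow> 'n"
  proof -
    have in_range: "?d (f b) * ?c (f b) = (\<integral>a. v a $ b * v a $ b * h a \<partial>M)" for b
    proof -
      have "?c (f b) = (\<Prod>i\<in>- range f. 1)" by (intro prod.cong) (auto simp: H_def prob_space)
      moreover have "?d (f b) = (\<integral>a. v a $ b * v a $ b * h a \<partial>M)"
        using f by (subst det_identity_off_singleton[of b])
          (auto simp: H_def inj_eq integral_v_prod_eq_axis)
      ultimately show ?thesis by simp
    qed
    have out: "?d l * ?c l = (\<integral>a. h a \<partial>M)" if l: "l \<in> - range f" for l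
    proof -
      have "(\<chi> j k. \<integral>a. v a $ j * v a $ k * H l (f j) a \<partial>M) = mat 1"
        using l by (auto simp: H_def vec_eq_iff mat_def isotropic)
      moreover have "?c l = (\<integral>a. h a \<partial>M)"
        using prod.remove[of "- range f" l "\<lambda>i. \<integral>a. H l i a \<partial>M"] l by (simp add: H_def prob_space)
      ultimately show ?thesis by simp
    qed
    have "(\<Sum>l\<in>UNIV. ?d l * ?c l) = (\<Sum>l\<in>range f. ?d l * ?c l) + (\<Sum>l\<in>- range f. ?d l * ?c l)"
      by (simp add: sum.subset_diff[of "range f" UNIV] Compl_eq_Diff_UNIV add.commute)
    also have "\<dots> = (\<Sum>b\<in>UNIV. \<integral>a. v a $ b * v a $ b * h a \<partial>M) + (\<Sum>l\<in>- range f. \<integral>a. h a \<partial>M)"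
      by (simp add: sum.reindex[OF f] in_range out)
    finally show ?thesis by (simp add: integral_inner_v_mult(1)[OF h] card_Compl_range_inj[OF f])
  qed
  have "(\<integral>x. vol x * (\<Sum>i\<in>UNIV. h (x i)) \<partial>?N) = (\<Sum>l\<in>UNIV. \<integral>x. vol x * (\<Prod>i\<in>UNIV. H l i (x i)) \<partial>?N)"
    using int by (simp add: sum_distrib_left Bochner_Integration.integral_sum prodH)
  also have "\<dots> = (\<Sum>f\<in>{f :: 'm \<Rightarrow> 'n. inj f}. \<Sum>l\<in>UNIV.
      det (\<chi> j k. \<integral>a. v a $ j * v a $ k * H l (f j) a \<partial>M) * (\<Prod>i\<in>- range f. \<integral>a. H l i a \<partial>M))"
    by (subst sum.swap) (simp add: integral_vol_prod[OF Hi])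
  also have "\<dots> = (\<Sum>f\<in>{f :: 'm \<Rightarrow> 'n. inj f}.
      (\<integral>a. (v a \<bullet> v a) * h a \<partial>M) + (real CARD('n) - real CARD('m)) * (\<integral>a. h a \<partial>M))"
    by (intro sum.cong refl one) simp
  finally show "(\<integral>x. vol x * (\<Sum>i\<in>UNIV. h (x i)) \<partial>?N) = real (card {f :: 'm \<Rightarrow> 'n. inj f})
        * ((\<integral>a. (v a \<bullet> v a) * h a \<partial>M) + (real CARD('n) - real CARD('m)) * (\<integral>a. h a \<partial>M))"
    by simp
qed

lemma
  shows integrable_vol: "integrable (PiM (UNIV :: 'n::finite set) (\<lambda>_. M)) vol"
    and integral_vol: "(\<integral>x. vol x \<partial>PiM (UNIV :: 'n::finite set) (\<lambda>_. M)) = real (card {f :: 'm \<Rightarrow> 'n. inj f})"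
proof -
  have 1: "(\<chi> j k. \<integral>a. v a $ j * v a $ k \<partial>M) = mat 1" by (auto simp: vec_eq_iff mat_def isotropic)
  show "integrable (PiM (UNIV :: 'n set) (\<lambda>_. M)) vol"
    using integrable_vol_prod[of "\<lambda>_ _. 1"] by simp
  show "(\<integral>x. vol x \<partial>PiM (UNIV :: 'n::finite set) (\<lambda>_. M)) = real (card {f :: 'm \<Rightarrow> 'n. inj f})"
    using integral_vol_prod[where h = "\<lambda>(_ :: 'n) _. 1"] by (simp add: 1 prob_space)
qed

text \<open>A pair with an index off the range of \<open>f\<close> contributes zero, because
  \<open>u\<close> has mean zero. A pair \<open>(f a, f b)\<close> gives the 2 by 2 minor
  \<open>U a a * U b b - (U a b)^2\<close>. Dropping the subtracted squares and adding the diagonal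
  ones completes the sum to the squared trace of \<open>U\<close>, which is the integral of
  \<open>(v . v) u\<close>, squared.\<close>

lemma
  assumes u: "integrable M u" and u0: "(\<integral>a. u a \<partial>M) = 0"
  shows integrable_vol_offdiag: "integrable (PiM UNIV (\<lambda>_. M))
      (\<lambda>x. vol x * (\<Sum>l\<in>(UNIV :: 'n::finite set). \<Sum>l'\<in>UNIV - {l}. u (x l) * u (x l')))"
    and integral_vol_offdiag: "(\<integral>x. vol x * (\<Sum>l\<in>(UNIV :: 'n::finite set). \<Sum>l'\<in>UNIV - {l}. u (x l) * u (x l')) \<partial>PiM UNIV (\<lambda>_. M))
      \<le> real (card {f :: 'm \<Rightarrow> 'n. inj f}) * (\<integral>a. (v a \<bullet> v a) * u a \<partial>M)\<^sup>2"
proof -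
  let ?N = "PiM (UNIV :: 'n set) (\<lambda>_. M)"
  define H where "H = (\<lambda>l l' i :: 'n. if i = l \<or> i = l' then u else (\<lambda>_. 1))"
  have Hi: "integrable M (H l l' i)" for l l' i using u by (simp add: H_def)
  have prodH: "(\<Prod>i\<in>UNIV. H l l' i (x i)) = u (x l) * u (x l')" if "l' \<in> UNIV - {l}" for l l' x
  proof -
    have "(\<Prod>i\<in>UNIV. H l l' i (x i)) = (\<Prod>i\<in>{l, l'}. H l l' i (x i))"
      by (rule prod.mono_neutral_right) (auto simp: H_def)
    then show ?thesis using that by (simp add: H_def)
  qed
  have int: "integrable ?N (\<lambda>x. vol x * (u (x l) * u (x l')))" if "l' \<in> UNIV - {l}" for l l'
    using integrable_vol_prod[of "H l l'", OF Hi] by (simp only: prodH[OF that])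
  then show "integrable ?N (\<lambda>x. vol x * (\<Sum>l\<in>UNIV. \<Sum>l'\<in>UNIV - {l}. u (x l) * u (x l')))"
    unfolding sum_distrib_left by (intro Bochner_Integration.integrable_sum) auto
  define U where "U = (\<lambda>a b. \<integral>y. v y $ a * v y $ b * u y \<partial>M)"
  have Usym: "U a b = U b a" for a b by (simp add: U_def mult.commute)
  have trU: "(\<Sum>a\<in>UNIV. U a a) = (\<integral>a. (v a \<bullet> v a) * u a \<partial>M)"
    by (simp add: U_def integral_inner_v_mult(1)[OF u])
  have one: "(\<Sum>l\<in>UNIV. \<Sum>l'\<in>UNIV - {l}. det (\<chi> j k. \<integral>a. v a $ j * v a $ k * H l l' (f j) a \<partial>M) * (\<Prod>i\<in>- range f. \<integral>a. H l l' i a \<partial>M))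
     \<le> (\<integral>a. (v a \<bullet> v a) * u a \<partial>M)\<^sup>2"
    (is "(\<Sum>l\<in>UNIV. \<Sum>l'\<in>UNIV - {l}. ?d l l' * ?c l l') \<le> _") if f: "inj f" for f :: "'m \<Rightarrow> 'n"
  proof -
    have in_range: "?d (f a) (f b) * ?c (f a) (f b) = U a a * U b b - (U a b)\<^sup>2" if ab: "a \<noteq> b" for a b
    proof -
      have "?c (f a) (f b) = (\<Prod>i\<in>- range f. 1)" by (intro prod.cong) (auto simp: H_def prob_space)
      moreover have "?d (f a) (f b) = U a a * U b b - U a b * U b a"
        using f ab by (subst det_identity_off_doubleton[of a b])
          (auto simp: H_def inj_eq integral_v_prod_eq_axis U_def)
      ultimately show ?thesis by (simp add: Usym[of b a] power2_eq_square)
    qed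
    have out: "?d l l' * ?c l l' = 0" if l: "l \<notin> range f \<or> l' \<notin> range f" for l l'
    proof -
      have "?c l l' = 0" unfolding prod_zero_iff[OF finite] using l u0 by (auto simp: H_def intro: bexI[of _ l] bexI[of _ l'])
      then show ?thesis by simp
    qed
    have "(\<Sum>l\<in>UNIV. \<Sum>l'\<in>UNIV - {l}. ?d l l' * ?c l l') = (\<Sum>l\<in>range f. \<Sum>l'\<in>range f - {l}. ?d l l' * ?c l l')"
      using out by (intro sum.mono_neutral_cong_right sum.mono_neutral_right) (auto intro!: sum.neutral)
    also have "\<dots> = (\<Sum>a\<in>UNIV. \<Sum>b\<in>UNIV - {a}. ?d (f a) (f b) * ?c (f a) (f b))"
    proof -
      have "range f - {f a} = f ` (UNIV - {a})" for a using f by (auto simp: inj_eq)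
      then show ?thesis using f by (simp add: sum.reindex inj_on_def)
    qed
    also have "\<dots> = (\<Sum>a\<in>UNIV. \<Sum>b\<in>UNIV - {a}. U a a * U b b - (U a b)\<^sup>2)"
      by (intro sum.cong refl in_range) auto
    also have "\<dots> \<le> (\<Sum>a\<in>UNIV. \<Sum>b\<in>UNIV. U a a * U b b)"
    proof (rule sum_mono)
      fix a
      have "(\<Sum>b\<in>UNIV. U a a * U b b) = U a a * U a a + (\<Sum>b\<in>UNIV - {a}. U a a * U b b)"
        by (simp add: sum.remove[of UNIV a])
      moreover have "(\<Sum>b\<in>UNIV - {a}. U a a * U b b - (U a b)\<^sup>2) \<le> (\<Sum>b\<in>UNIV - {a}. U a a * U b b)"
        by (rule sum_mono) simp
      ultimately show "(\<Sum>b\<in>UNIV - {a}. U a a * U b b - (U a b)\<^sup>2) \<le> (\<Sum>b\<in>UNIV. U a a * U b b)"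
        by (simp add: add_increasing)
    qed
    also have "\<dots> = (\<Sum>a\<in>UNIV. U a a)\<^sup>2" by (simp add: power2_eq_square sum_product)
    finally show ?thesis unfolding trU .
  qed
  have "(\<integral>x. vol x * (\<Sum>l\<in>UNIV. \<Sum>l'\<in>UNIV - {l}. u (x l) * u (x l')) \<partial>?N)
      = (\<Sum>l\<in>UNIV. \<Sum>l'\<in>UNIV - {l}. \<integral>x. vol x * (u (x l) * u (x l')) \<partial>?N)"
    unfolding sum_distrib_left using int
    by (subst Bochner_Integration.integral_sum, intro Bochner_Integration.integrable_sum, blast)
      (intro sum.cong refl Bochner_Integration.integral_sum, blast)
  also have "\<dots> = (\<Sum>l\<in>UNIV. \<Sum>l'\<in>UNIV - {l}. \<integral>x. vol x * (\<Prod>i\<in>UNIV. H l l' i (x i)) \<partial>?N)"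
    by (intro sum.cong refl) (simp add: prodH)
  also have "\<dots> = (\<Sum>f\<in>{f :: 'm \<Rightarrow> 'n. inj f}. \<Sum>l\<in>UNIV. \<Sum>l'\<in>UNIV - {l}.
      det (\<chi> j k. \<integral>a. v a $ j * v a $ k * H l l' (f j) a \<partial>M) * (\<Prod>i\<in>- range f. \<integral>a. H l l' i a \<partial>M))"
    unfolding integral_vol_prod[OF Hi]
    by (subst sum.swap[of _ "{f. inj f}"])
      (intro sum.cong refl sum.swap)
  also have "\<dots> \<le> (\<Sum>f\<in>{f :: 'm \<Rightarrow> 'n. inj f}. (\<integral>a. (v a \<bullet> v a) * u a \<partial>M)\<^sup>2)"
    by (intro sum_mono one) simp
  finally show "(\<integral>x. vol x * (\<Sum>l\<in>UNIV. \<Sum>l'\<in>UNIV - {l}. u (x l) * u (x l')) \<partial>?N)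
      \<le> real (card {f :: 'm \<Rightarrow> 'n. inj f}) * (\<integral>a. (v a \<bullet> v a) * u a \<partial>M)\<^sup>2" by simp
qed

lemma integrable_mult_v:
  assumes [measurable]: "g \<in> borel_measurable M" and g2: "integrable M (\<lambda>a. (g a)\<^sup>2)"
  shows "integrable M (\<lambda>a. g a * v a $ k)"
proof (rule Bochner_Integration.integrable_bound)
  show "integrable M (\<lambda>a. (g a)\<^sup>2 + v a $ k * v a $ k)" using g2 v_prod_integrable by auto
  show "AE a in M. norm (g a * v a $ k) \<le> norm ((g a)\<^sup>2 + v a $ k * v a $ k)"
  proof (rule AE_I2)
    fix a
    have "2 * (\<bar>g a\<bar> * \<bar>v a $ k\<bar>) \<le> (g a)\<^sup>2 + (v a $ k)\<^sup>2"
      using sum_squares_bound[of "\<bar>g a\<bar>" "\<bar>v a $ k\<bar>"] by simp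
    moreover have "0 \<le> \<bar>g a\<bar> * \<bar>v a $ k\<bar>" by simp
    ultimately have "\<bar>g a * v a $ k\<bar> \<le> (g a)\<^sup>2 + v a $ k * v a $ k"
      unfolding abs_mult power2_eq_square by linarith
    then show "norm (g a * v a $ k) \<le> norm ((g a)\<^sup>2 + v a $ k * v a $ k)" by simp
  qed
qed simp

text \<open>Isotropy says that the coordinates of \<open>v\<close> are orthonormal in
  \<open>L2\<close>, so this is Bessel's inequality: the squared distance of \<open>p\<close> to
  their span is nonnegative.\<close>

lemma Bessel_v:
  assumes p[measurable]: "p \<in> borel_measurable M" and p2: "integrable M (\<lambda>a. (p a)\<^sup>2)"
  shows "(\<Sum>k\<in>UNIV. (\<integral>a. p a * v a $ k \<partial>M)\<^sup>2) \<le> (\<integral>a. (p a)\<^sup>2 \<partial>M)"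
proof -
  define c where "c = (\<lambda>k. \<integral>a. p a * v a $ k \<partial>M)"
  have c: "(\<integral>a. p a * v a $ k \<partial>M) = c k" for k by (simp add: c_def)
  note i1 = integrable_mult_v[OF p p2]
  have eq: "(p a - (\<Sum>k\<in>UNIV. c k * v a $ k))\<^sup>2 = (p a)\<^sup>2 - 2 * (\<Sum>k\<in>UNIV. c k * (p a * v a $ k))
      + (\<Sum>k\<in>UNIV. \<Sum>l\<in>UNIV. c k * c l * (v a $ k * v a $ l))" for a
  proof -
    have "(\<Sum>k\<in>UNIV. c k * v a $ k)\<^sup>2 = (\<Sum>k\<in>UNIV. \<Sum>l\<in>UNIV. c k * c l * (v a $ k * v a $ l))"
      by (simp only: power2_eq_square sum_product) (simp add: mult_ac)
    then show ?thesis by (simp add: power2_diff sum_distrib_left mult_ac)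
  qed
  have "0 \<le> (\<integral>a. (p a - (\<Sum>k\<in>UNIV. c k * v a $ k))\<^sup>2 \<partial>M)" by simp
  also have "\<dots> = (\<integral>a. (p a)\<^sup>2 \<partial>M) - 2 * (\<Sum>k\<in>UNIV. c k * c k)
      + (\<Sum>k\<in>UNIV. \<Sum>l\<in>UNIV. c k * c l * (if k = l then 1 else 0))"
    unfolding eq using p2 i1 v_prod_integrable
    by (simp add: Bochner_Integration.integral_sum Bochner_Integration.integrable_sum isotropic c)
  also have "\<dots> = (\<integral>a. (p a)\<^sup>2 \<partial>M) - (\<Sum>k\<in>UNIV. (c k)\<^sup>2)"
    by (simp add: if_distrib[of "\<lambda>x. _ * x"] power2_eq_square cong: if_cong)
  finally show ?thesis by (simp add: c_def)
qed

text \<open>Bounding the leverage \<open>v . v\<close> by \<open>K\<close> makes the two parts of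
  \<open>integral_vol_sum\<close> proportional; the factor \<open>K + n - m\<close> equals n times
  the constant \<open>beta\<close> of the theorem.\<close>

lemma mean_vol_sum_le:
  assumes h: "integrable M h" "\<And>a. 0 \<le> h a" and nm: "CARD('m) \<le> CARD('n)"
  shows "(\<integral>\<^sup>+x. ennreal (vol x * (\<Sum>i\<in>(UNIV :: 'n::finite set). h (x i))) \<partial>PiM UNIV (\<lambda>_. M))
    \<le> ennreal (real (card {f :: 'm \<Rightarrow> 'n. inj f}) * ((K + real CARD('n) - real CARD('m)) * (\<integral>a. h a \<partial>M)))"
proof -
  have "(\<integral>\<^sup>+x. ennreal (vol x * (\<Sum>i\<in>(UNIV :: 'n::finite set). h (x i))) \<partial>PiM UNIV (\<lambda>_. M))
    = ennreal (\<integral>x. vol x * (\<Sum>i\<in>(UNIV :: 'n::finite set). h (x i)) \<partial>PiM UNIV (\<lambda>_. M))"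
    by (intro nn_integral_eq_integral integrable_vol_sum h AE_I2 mult_nonneg_nonneg vol_nonneg sum_nonneg)
  also have "\<dots> \<le> ennreal (real (card {f :: 'm \<Rightarrow> 'n. inj f}) * ((K + real CARD('n) - real CARD('m)) * (\<integral>a. h a \<partial>M)))"
  proof (rule ennreal_leI)
    have "(\<integral>a. (v a \<bullet> v a) * h a \<partial>M) \<le> (\<integral>a. K * h a \<partial>M)"
      using h by (intro integral_mono integral_inner_v_mult(2) mult_right_mono v_bounded) auto
    then show "(\<integral>x. vol x * (\<Sum>i\<in>(UNIV :: 'n::finite set). h (x i)) \<partial>PiM UNIV (\<lambda>_. M))
      \<le> real (card {f :: 'm \<Rightarrow> 'n. inj f}) * ((K + real CARD('n) - real CARD('m)) * (\<integral>a. h a \<partial>M))"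
      unfolding integral_vol_sum[OF h(1)] by (intro mult_left_mono) (auto simp: algebra_simps)
  qed
  finally show ?thesis .
qed

text \<open>The squared norm splits into diagonal terms, which are one-point moments, and for each
  coordinate \<open>k\<close> off-diagonal terms in \<open>u k = g * v_k\<close>. The latter have
  mean zero by orthogonality, so only the leverage-weighted correlations collected in
  \<open>C\<close> remain of them.\<close>

lemma mean_vol_noise_le:
  fixes g :: "'a \<Rightarrow> real"
  assumes g[measurable]: "g \<in> borel_measurable M" and g2: "integrable M (\<lambda>a. (g a)\<^sup>2)"
    and g0: "\<And>k. (\<integral>a. g a * v a $ k \<partial>M) = 0" and nm: "CARD('m) \<le> CARD('n)"
  defines "C \<equiv> (\<Sum>k\<in>UNIV. (\<integral>a. (v a \<bullet> v a) * g a * v a $ k \<partial>M)\<^sup>2)"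
  shows "(\<integral>\<^sup>+x. ennreal (vol x * (norm (\<Sum>i\<in>(UNIV :: 'n::finite set). g (x i) *\<^sub>R v (x i)))\<^sup>2) \<partial>PiM UNIV (\<lambda>_. M))
    \<le> ennreal (real (card {f :: 'm \<Rightarrow> 'n. inj f})
        * (K * (K + real CARD('n) - real CARD('m)) * (\<integral>a. (g a)\<^sup>2 \<partial>M) + C))"
proof -
  let ?N = "PiM (UNIV :: 'n set) (\<lambda>_. M)" and ?c = "real (card {f :: 'm \<Rightarrow> 'n. inj f})"
  define u where "u = (\<lambda>k a. g a * v a $ k)"
  have ui: "integrable M (u k)" for k unfolding u_def by (rule integrable_mult_v[OF g g2])
  have u0: "(\<integral>a. u k a \<partial>M) = 0" for k unfolding u_def by (rule g0)
  let ?d = "\<lambda>x. vol x * (\<Sum>i\<in>(UNIV :: 'n set). (v (x i) \<bullet> v (x i)) * (g (x i))\<^sup>2)"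
  let ?o = "\<lambda>k x. vol x * (\<Sum>l\<in>(UNIV :: 'n set). \<Sum>l'\<in>UNIV - {l}. u k (x l) * u k (x l'))"
  have split: "vol x * (norm (\<Sum>i\<in>UNIV. g (x i) *\<^sub>R v (x i)))\<^sup>2 = ?d x + (\<Sum>k\<in>UNIV. ?o k x)" for x :: "'n \<Rightarrow> 'a"
  proof -
    have "(norm (\<Sum>i\<in>UNIV. g (x i) *\<^sub>R v (x i)))\<^sup>2 = (\<Sum>k\<in>UNIV. (\<Sum>i\<in>UNIV. u k (x i))\<^sup>2)"
      unfolding power2_norm_eq_inner by (simp add: inner_vec_def u_def power2_eq_square)
    also have "\<dots> = (\<Sum>k\<in>UNIV. (\<Sum>i\<in>UNIV. (u k (x i))\<^sup>2) + (\<Sum>l\<in>UNIV. \<Sum>l'\<in>UNIV - {l}. u k (x l) * u k (x l')))"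
    proof (intro sum.cong refl)
      fix k
      have "(\<Sum>i\<in>UNIV. u k (x i))\<^sup>2 = (\<Sum>l\<in>UNIV. \<Sum>l'\<in>UNIV. u k (x l) * u k (x l'))"
        by (simp add: power2_eq_square sum_product)
      also have "\<dots> = (\<Sum>l\<in>UNIV. u k (x l) * u k (x l) + (\<Sum>l'\<in>UNIV - {l}. u k (x l) * u k (x l')))"
        by (intro sum.cong refl sum.remove) auto
      finally show "(\<Sum>i\<in>UNIV. u k (x i))\<^sup>2 = (\<Sum>i\<in>UNIV. (u k (x i))\<^sup>2) + (\<Sum>l\<in>UNIV. \<Sum>l'\<in>UNIV - {l}. u k (x l) * u k (x l'))"
        by (simp add: sum.distrib power2_eq_square)
    qed
    also have "\<dots> = (\<Sum>i\<in>UNIV. (v (x i) \<bullet> v (x i)) * (g (x i))\<^sup>2) + (\<Sum>k\<in>UNIV. \<Sum>l\<in>UNIV. \<Sum>l'\<in>UNIV - {l}. u k (x l) * u k (x l'))"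
      unfolding sum.distrib
      by (subst sum.swap) (simp add: inner_vec_def sum_distrib_left u_def power_mult_distrib power2_eq_square mult_ac)
    finally show ?thesis by (simp add: distrib_left sum_distrib_left)
  qed
  have h: "integrable M (\<lambda>a. (v a \<bullet> v a) * (g a)\<^sup>2)" by (rule integral_inner_v_mult(2)[OF g2])
  have id: "integrable ?N ?d" by (rule integrable_vol_sum[OF h])
  have io: "integrable ?N (?o k)" for k by (rule integrable_vol_offdiag[OF ui u0])
  have "(\<integral>\<^sup>+x. ennreal (vol x * (norm (\<Sum>i\<in>UNIV. g (x i) *\<^sub>R v (x i)))\<^sup>2) \<partial>?N)
      = ennreal (\<integral>x. vol x * (norm (\<Sum>i\<in>UNIV. g (x i) *\<^sub>R v (x i)))\<^sup>2 \<partial>?N)"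
    using id io by (intro nn_integral_eq_integral AE_I2 mult_nonneg_nonneg vol_nonneg) (auto simp: split)
  also have "\<dots> \<le> ennreal (?c * (K * (K + real CARD('n) - real CARD('m)) * (\<integral>a. (g a)\<^sup>2 \<partial>M) + C))"
  proof (rule ennreal_leI)
    have le: "(\<integral>a. (v a \<bullet> v a) * (g a)\<^sup>2 \<partial>M) \<le> K * (\<integral>a. (g a)\<^sup>2 \<partial>M)"
      unfolding integral_mult_right_zero[symmetric] using g2
      by (intro integral_mono h mult_right_mono v_bounded) auto
    \<comment> \<open>\<open>integral_vol_sum\<close> multiplies its argument by the leverage, and
      the diagonal term already contains it once; hence two factors \<open>K\<close>.\<close>
    have "(\<integral>a. (v a \<bullet> v a) * ((v a \<bullet> v a) * (g a)\<^sup>2) \<partial>M) \<le> (\<integral>a. K * ((v a \<bullet> v a) * (g a)\<^sup>2) \<partial>M)"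
      using h by (intro integral_mono integral_inner_v_mult(2)[OF h] mult_right_mono v_bounded) auto
    also have "\<dots> \<le> K * (K * (\<integral>a. (g a)\<^sup>2 \<partial>M))" using le K_pos by (simp add: mult_left_mono)
    finally have le2: "(\<integral>a. (v a \<bullet> v a) * ((v a \<bullet> v a) * (g a)\<^sup>2) \<partial>M) \<le> K * (K * (\<integral>a. (g a)\<^sup>2 \<partial>M))" .
    have "(\<integral>x. ?d x \<partial>?N) \<le> ?c * (K * (K * (\<integral>a. (g a)\<^sup>2 \<partial>M)) + (real CARD('n) - real CARD('m)) * (K * (\<integral>a. (g a)\<^sup>2 \<partial>M)))"
      unfolding integral_vol_sum[OF h] using nm by (intro mult_left_mono add_mono le le2) auto
    moreover have "(\<integral>x. (\<Sum>k\<in>UNIV. ?o k x) \<partial>?N) \<le> ?c * C"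
    proof -
      have "(\<integral>x. (\<Sum>k\<in>UNIV. ?o k x) \<partial>?N) = (\<Sum>k\<in>UNIV. \<integral>x. ?o k x \<partial>?N)"
        using io by (simp add: Bochner_Integration.integral_sum)
      also have "\<dots> \<le> (\<Sum>k\<in>UNIV. ?c * (\<integral>a. (v a \<bullet> v a) * u k a \<partial>M)\<^sup>2)"
        by (intro sum_mono integral_vol_offdiag[OF ui u0])
      finally show ?thesis by (simp add: C_def u_def sum_distrib_left mult.assoc)
    qed
    ultimately show "(\<integral>x. vol x * (norm (\<Sum>i\<in>UNIV. g (x i) *\<^sub>R v (x i)))\<^sup>2 \<partial>?N)
       \<le> ?c * (K * (K + real CARD('n) - real CARD('m)) * (\<integral>a. (g a)\<^sup>2 \<partial>M) + C)"
      unfolding split using id io by (simp add: algebra_simps)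
  qed
  finally show ?thesis .
qed

text \<open>Bounds \<open>C\<close> when the leverage \<open>v . v\<close> is not constant. This is
  the source of the term with \<open>xi\<close> in the second error bound.\<close>

lemma leverage_Bessel:
  assumes g[measurable]: "g \<in> borel_measurable M" and g2: "integrable M (\<lambda>a. (g a)\<^sup>2)"
  shows "(\<Sum>k\<in>UNIV. (\<integral>a. (v a \<bullet> v a) * g a * v a $ k \<partial>M)\<^sup>2) \<le> K\<^sup>2 * (\<integral>a. (g a)\<^sup>2 \<partial>M)"
proof -
  let ?p = "\<lambda>a. (v a \<bullet> v a) * g a"
  have le: "(?p a)\<^sup>2 \<le> K\<^sup>2 * (g a)\<^sup>2" for a
    unfolding power_mult_distrib using v_bounded[of a] by (intro mult_right_mono power_mono) auto
  have i: "integrable M (\<lambda>a. (?p a)\<^sup>2)"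
    by (rule Bochner_Integration.integrable_bound[of _ "\<lambda>a. K\<^sup>2 * (g a)\<^sup>2"]) (use g2 le in auto)
  have "(\<Sum>k\<in>UNIV. (\<integral>a. (v a \<bullet> v a) * g a * v a $ k \<partial>M)\<^sup>2) \<le> (\<integral>a. (?p a)\<^sup>2 \<partial>M)"
    by (rule Bessel_v[OF _ i]) simp
  also have "\<dots> \<le> (\<integral>a. K\<^sup>2 * (g a)\<^sup>2 \<partial>M)" using g2 by (intro integral_mono i le) auto
  finally show ?thesis by simp
qed

section \<open>Lower tail of the smallest eigenvalue under volume weighting\<close>

lemma trace_shrink_ge:
  assumes e: "e \<ge> 0" "e * real (card J) * K < 1" and bad: "(\<Sum>i\<in>J. (v (x i) \<bullet> c)\<^sup>2) < t * (c \<bullet> c)"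
    and t: "e * t \<le> 1"
  shows "(1 - e * t) ^ N \<le> (\<Sum>b\<in>Basis. b \<bullet> (shrink e J x ^^ N) b)"
proof -
  have psd: "psd (shrink e J x)" using e by (intro psd_shrink) auto
  have c: "c \<noteq> 0" using bad by auto
  \<comment> \<open>At the normalised bad direction the form of \<open>shrink\<close> is at least
    \<open>1 - e * t\<close>; its N-th moment is then at least the N-th power, and the trace
    dominates every such moment.\<close>
  define d where "d = (1 / norm c) *\<^sub>R c"
  have d: "d \<bullet> d = 1" using c by (simp add: d_def dot_square_norm power2_eq_square)
  have "(\<Sum>i\<in>J. (v (x i) \<bullet> d)\<^sup>2) = (\<Sum>i\<in>J. (v (x i) \<bullet> c)\<^sup>2) / (c \<bullet> c)"
    by (simp add: d_def sum_divide_distrib power_divide dot_square_norm)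
  also have "\<dots> \<le> t" using bad c by (simp add: field_simps)
  finally have "e * (\<Sum>i\<in>J. (v (x i) \<bullet> d)\<^sup>2) \<le> e * t" using e(1) by (rule mult_left_mono)
  then have le: "1 - e * t \<le> d \<bullet> shrink e J x d" by (simp add: inner_shrink d)
  have "(1 - e * t) ^ N \<le> d \<bullet> (shrink e J x ^^ N) d"
    using e t by (intro moment_power_le[OF psd _ inner_shrink_ge[OF e(1) order_refl] d _ le]) auto
  also have "\<dots> \<le> (\<Sum>b\<in>Basis. b \<bullet> (shrink e J x ^^ N) b) * (d \<bullet> d)"
    by (rule inner_le_trace[OF psd_funpow[OF psd]])
  finally show ?thesis by (simp add: d)
qed

text \<open>The rows are independent and isotropic. In the square of the Leibniz sum only equal
  pairs of permutations have nonzero mean, and each of the m! such pairs contributes 1.\<close>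

lemma nn_integral_det_sq:
  fixes f :: "'m \<Rightarrow> 'n::finite"
  assumes f: "inj f"
  shows "(\<integral>\<^sup>+x. ennreal ((det (\<chi> j. v (x (f j))))\<^sup>2) \<partial>PiM UNIV (\<lambda>_. M)) = ennreal (fact CARD('m))"
proof -
  let ?S = "{p. p permutes (UNIV :: 'm set)}" and ?N = "PiM (UNIV :: 'n set) (\<lambda>_. M)"
  let ?t = "\<lambda>p p' x. of_int (sign p * sign p') * (\<Prod>j\<in>UNIV. v (x (f j)) $ p j * v (x (f j)) $ p' j)"
  have eq: "(det (\<chi> j. v (x (f j))))\<^sup>2 = (\<Sum>p\<in>?S. \<Sum>p'\<in>?S. ?t p p' x)" for x
    unfolding det_def power2_eq_square sum_product
    by (intro sum.cong refl) (simp add: prod.distrib mult.assoc mult.left_commute)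
  have int: "integrable ?N (?t p p')" for p p'
    using integrable_prod_split[where f = f and h = "\<lambda>_ _. 1" and q = "\<lambda>j a. v a $ p j * v a $ p' j"] f v_prod_integrable
    by (intro integrable_mult_right) auto
  have val: "(\<integral>x. ?t p p' x \<partial>?N) = (if p = p' then 1 else 0)" for p p'
  proof -
    have "(\<integral>x. ?t p p' x \<partial>?N) = of_int (sign p * sign p') * (\<Prod>j\<in>UNIV. if p j = p' j then 1 else 0)"
      using integral_prod_split[where f = f and h = "\<lambda>_ _. 1" and q = "\<lambda>j a. v a $ p j * v a $ p' j"] f v_prod_integrable
      by (simp add: isotropic prob_space)
    moreover have "(\<Prod>j\<in>UNIV. if p j = p' j then 1 else 0) = (if p = p' then 1 else 0 :: real)"
      by (auto simp: fun_eq_iff intro!: prod_zero)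
    moreover have "sign p * sign p = 1" by (simp add: sign_def)
    ultimately show ?thesis by (cases "p = p'") (simp_all del: of_int_mult)
  qed
  have "(\<integral>\<^sup>+x. ennreal ((det (\<chi> j. v (x (f j))))\<^sup>2) \<partial>?N) = ennreal (\<integral>x. (det (\<chi> j. v (x (f j))))\<^sup>2 \<partial>?N)"
  proof (rule nn_integral_eq_integral)
    show "integrable ?N (\<lambda>x. (det (\<chi> j. v (x (f j))))\<^sup>2)"
      unfolding eq by (intro Bochner_Integration.integrable_sum int)
  qed simp
  also have "(\<integral>x. (det (\<chi> j. v (x (f j))))\<^sup>2 \<partial>?N) = (\<Sum>p\<in>?S. \<Sum>p'\<in>?S. if p = p' then 1 else 0)"
    unfolding eq using int
    by (simp only: Bochner_Integration.integral_sum Bochner_Integration.integrable_sum val)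
  also have "\<dots> = fact CARD('m)" by (simp add: sum.delta' card_permutations)
  finally show ?thesis .
qed

text \<open>Given that the squared volume selects the points in the range of \<open>f\<close>, the remaining
  points are independent with law \<open>M\<close>.\<close>

lemma nn_integral_det_sq_mult:
  fixes f :: "'m \<Rightarrow> 'n::finite" and F :: "('n \<Rightarrow> 'a) \<Rightarrow> ennreal"
  assumes f: "inj f" and F: "F \<in> borel_measurable (PiM UNIV (\<lambda>_. M))"
    and F': "F \<in> borel_measurable (PiM (- range f) (\<lambda>_. M))"
    and dep: "\<And>x y. (\<And>i. i \<notin> range f \<Longrightarrow> x i = y i) \<Longrightarrow> F x = F y"
  shows "(\<integral>\<^sup>+x. ennreal ((det (\<chi> j. v (x (f j))))\<^sup>2) * F x \<partial>PiM UNIV (\<lambda>_. M))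
    = ennreal (fact CARD('m)) * (\<integral>\<^sup>+y. F y \<partial>PiM (- range f) (\<lambda>_. M))"
proof -
  interpret P: product_sigma_finite "\<lambda>_. M" by standard
  let ?I = "range f" and ?J = "- range f"
  let ?D = "\<lambda>x. ennreal ((det (\<chi> j. v (x (f j))))\<^sup>2)"
  have [measurable]: "?D \<in> borel_measurable (PiM I (\<lambda>_. M))" if "range f \<subseteq> I" for I
    using measurable_det_frame[OF that] by measurable
  have fold: "(\<integral>\<^sup>+x. ?D x * G x \<partial>PiM UNIV (\<lambda>_. M)) = (\<integral>\<^sup>+x. ?D x \<partial>PiM ?I (\<lambda>_. M)) * (\<integral>\<^sup>+y. G y \<partial>PiM ?J (\<lambda>_. M))"
    if G[measurable]: "G \<in> borel_measurable (PiM UNIV (\<lambda>_. M))" and G': "G \<in> borel_measurable (PiM ?J (\<lambda>_. M))"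
      and dep: "\<And>x y. (\<And>i. i \<notin> range f \<Longrightarrow> x i = y i) \<Longrightarrow> G x = G y" for G
  proof -
    have "(\<integral>\<^sup>+x. ?D x * G x \<partial>PiM (?I \<union> ?J) (\<lambda>_. M))
      = (\<integral>\<^sup>+x. (\<integral>\<^sup>+y. ?D (merge ?I ?J (x, y)) * G (merge ?I ?J (x, y)) \<partial>PiM ?J (\<lambda>_. M)) \<partial>PiM ?I (\<lambda>_. M))"
      by (rule P.product_nn_integral_fold) (auto simp: Compl_partition)
    also have "\<dots> = (\<integral>\<^sup>+x. (\<integral>\<^sup>+y. ?D x * G y \<partial>PiM ?J (\<lambda>_. M)) \<partial>PiM ?I (\<lambda>_. M))"
    proof (intro nn_integral_cong)
      fix x y
      have "G (merge ?I ?J (x, y)) = G y" by (rule dep) (auto simp: merge_def)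
      moreover have "?D (merge ?I ?J (x, y)) = ?D x" by (simp add: merge_def)
      ultimately show "?D (merge ?I ?J (x, y)) * G (merge ?I ?J (x, y)) = ?D x * G y" by simp
    qed
    also have "\<dots> = (\<integral>\<^sup>+x. ?D x * (\<integral>\<^sup>+y. G y \<partial>PiM ?J (\<lambda>_. M)) \<partial>PiM ?I (\<lambda>_. M))"
      using G' by (intro nn_integral_cong nn_integral_cmult)
    also have "\<dots> = (\<integral>\<^sup>+x. ?D x \<partial>PiM ?I (\<lambda>_. M)) * (\<integral>\<^sup>+y. G y \<partial>PiM ?J (\<lambda>_. M))"
      by (intro nn_integral_multc) measurable
    finally show ?thesis by (simp add: Compl_partition)
  qed
  interpret J: prob_space "PiM ?J (\<lambda>_. M)" by (rule prob_space_PiM) (rule prob_space_axioms)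
  \<comment> \<open>With the constant 1 as second factor, \<open>fold\<close> identifies the
    integral over the range coordinates with the one over all coordinates, which is m!.\<close>
  have "(\<integral>\<^sup>+x. ?D x \<partial>PiM ?I (\<lambda>_. M)) = ennreal (fact CARD('m))"
  proof -
    have "(\<integral>\<^sup>+x. ?D x * 1 \<partial>PiM UNIV (\<lambda>_. M)) = (\<integral>\<^sup>+x. ?D x \<partial>PiM ?I (\<lambda>_. M)) * (\<integral>\<^sup>+y. 1 \<partial>PiM ?J (\<lambda>_. M))"
      by (rule fold) auto
    then show ?thesis by (simp add: nn_integral_det_sq[OF f] J.emeasure_space_1)
  qed
  moreover have "(\<integral>\<^sup>+x. ?D x * F x \<partial>PiM UNIV (\<lambda>_. M)) = (\<integral>\<^sup>+x. ?D x \<partial>PiM ?I (\<lambda>_. M)) * (\<integral>\<^sup>+y. F y \<partial>PiM ?J (\<lambda>_. M))"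
    by (rule fold[OF F F']) (rule dep)
  ultimately show ?thesis by (simp only:)
qed

text \<open>The smallest eigenvalue of the Gram sum over \<open>J\<close> lies below
  \<open>t\<close>. With a witness vector in place of an eigenvalue, passing to a subset of points
  is immediate.\<close>

definition bad :: "'i set \<Rightarrow> real \<Rightarrow> ('i \<Rightarrow> 'a) \<Rightarrow> bool" where
  "bad J t x \<longleftrightarrow> (\<exists>c. (\<Sum>i\<in>J. (v (x i) \<bullet> c)\<^sup>2) < t * (c \<bullet> c))"

lemma bad_mono: "finite I \<Longrightarrow> J \<subseteq> I \<Longrightarrow> bad I t x \<Longrightarrow> bad J t x"
  unfolding bad_def by (metis (no_types, lifting) order.strict_trans1 sum_mono2 zero_le_power2)

lemma shrink_cong: "(\<And>i. i \<in> J \<Longrightarrow> x i = y i) \<Longrightarrow> shrink e J x = shrink e J y"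
  by (simp add: shrink_def fun_eq_iff)

text \<open>Markov's inequality inside each term of the mixture. For a bad sample and every
  injection \<open>f\<close>, the potential of the points off the range is at least
  \<open>(1 - e * t) ^ N\<close>, while its mean under the law attached to \<open>f\<close> is
  controlled by \<open>mean_trace_shrink\<close>. The step \<open>e = th / N\<close> keeps
  \<open>e * N\<close> equal to \<open>th\<close>, and the two conditions on \<open>N\<close> say
  \<open>e * L * K < 1\<close> and \<open>e * t < 1\<close>.\<close>

lemma mean_vol_bad_le_power:
  fixes th t :: real and N :: nat
  assumes nm: "CARD('m) < CARD('n::finite)" and th: "th > 0" and t: "0 \<le> t"
  defines "L \<equiv> real CARD('n) - real CARD('m)"
  assumes N: "th * L * K < real N" "th * t < real N"
  defines "kap \<equiv> th * K / (1 - th * L * K / real N)"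
  shows "(\<integral>\<^sup>+x. ennreal (vol x) * indicator {x. bad (UNIV :: 'n set) t x} x \<partial>PiM UNIV (\<lambda>_. M))
    \<le> ennreal (real (card {f :: 'm \<Rightarrow> 'n. inj f}) * (real CARD('m) * exp (- (th * ((1 - exp (- kap)) / kap)) * L)
        / (1 + (- (th * t)) / real N) ^ N))"
proof -
  let ?P = "PiM (UNIV :: 'n set) (\<lambda>_. M)" and ?I = "{f :: 'm \<Rightarrow> 'n. inj f}"
  define e where "e = th / real N"
  have L: "L = real (CARD('n) - CARD('m))" "L > 0" using nm by (auto simp: L_def of_nat_diff)
  have N0: "N > 0" using N(2) th t by (metis gr0I mult_nonneg_nonneg not_less of_nat_0 less_imp_le)
  have e: "e > 0" "e * L * K < 1" "e * t < 1" "e * real N = th"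
    using N N0 th by (auto simp: e_def field_simps)
  define tr where "tr = (\<lambda>f :: 'm \<Rightarrow> 'n. \<lambda>x :: 'n \<Rightarrow> 'a. \<Sum>b\<in>Basis. b \<bullet> (shrink e (- range f) x ^^ N) b)"
  let ?D = "\<lambda>f :: 'm \<Rightarrow> 'n. \<lambda>x :: 'n \<Rightarrow> 'a. ennreal ((det (\<chi> j. v (x (f j))))\<^sup>2)"
  let ?a = "(1 + (- (th * t)) / real N) ^ N"
  have a: "?a = (1 - e * t) ^ N" by (simp add: e_def)
  have a0: "?a > 0" unfolding a using e by simp
  define E where "E = real CARD('m) * exp (- (th * ((1 - exp (- kap)) / kap)) * L)"
  have cardJ: "card (- range f) = CARD('n) - CARD('m)" if "inj f" for f :: "'m \<Rightarrow> 'n"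
    using card_Compl_range_inj[OF that] L by (simp add: L_def)
  have meas: "(\<lambda>x. ennreal (tr f x)) \<in> borel_measurable (PiM I (\<lambda>_. M))" if "- range f \<subseteq> I" for f I
    unfolding tr_def using measurable_trace_shrink[of "- range f" I] that by (intro measurable_compose[OF _ measurable_ennreal]) auto
  have term_le: "(\<integral>\<^sup>+x. ?D f x * ennreal (tr f x) \<partial>?P) \<le> ennreal (fact CARD('m)) * ennreal E" if f: "f \<in> ?I" for f
  proof -
    have f': "inj f" using f by simp
    have kap': "kap = e * real N * K / (1 - e * real (CARD('n) - CARD('m)) * K)"
      using e(4) L N0 by (simp add: kap_def e_def)
    have "(\<integral>\<^sup>+x. ?D f x * ennreal (tr f x) \<partial>?P) = ennreal (fact CARD('m)) * (\<integral>\<^sup>+y. ennreal (tr f y) \<partial>PiM (- range f) (\<lambda>_. M))"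
    proof (rule nn_integral_det_sq_mult[OF f' meas meas])
      fix x y :: "'n \<Rightarrow> 'a" assume "\<And>i. i \<notin> range f \<Longrightarrow> x i = y i"
      then have "shrink e (- range f) x = shrink e (- range f) y" by (intro shrink_cong) auto
      then show "ennreal (tr f x) = ennreal (tr f y)" by (simp add: tr_def)
    qed auto
    also have "(\<integral>\<^sup>+y. ennreal (tr f y) \<partial>PiM (- range f) (\<lambda>_. M)) \<le> ennreal E"
    proof -
      have "(\<integral>\<^sup>+y. ennreal (tr f y) \<partial>PiM (- range f) (\<lambda>_. M))
        \<le> ennreal (real CARD('m) * exp (- (e * real N * ((1 - exp (- kap)) / kap)) * real (card (- range f))))"
        unfolding tr_def kap'
        by (rule mean_trace_shrink) (use e L N0 cardJ[OF f'] in auto)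
      then show ?thesis by (simp add: E_def e(4) cardJ[OF f'] L(1))
    qed
    finally show ?thesis by (simp add: mult_left_mono)
  qed
  have pt: "ennreal (vol x) * indicator {x. bad UNIV t x} x
      \<le> ennreal (1 / (fact CARD('m) * ?a)) * (\<Sum>f\<in>?I. ?D f x * ennreal (tr f x))" for x :: "'n \<Rightarrow> 'a"
  proof (cases "bad UNIV t x")
    case True
    have tr_ge: "?a \<le> tr f x" if f: "f \<in> ?I" for f
    proof -
      have "bad (- range f) t x" by (rule bad_mono[OF _ _ True]) auto
      then obtain c where "(\<Sum>i\<in>- range f. (v (x i) \<bullet> c)\<^sup>2) < t * (c \<bullet> c)" by (auto simp: bad_def)
      then show ?thesis unfolding tr_def a
        by (rule trace_shrink_ge[rotated 2]) (use e L cardJ[of f] f in auto)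
    qed
    have "fact CARD('m) * ?a * vol x = (\<Sum>f\<in>?I. (det (\<chi> j. v (x (f j))))\<^sup>2 * ?a)"
      unfolding sum_distrib_right[symmetric] vol_sum_squares[symmetric] by (simp only: mult_ac)
    also have "\<dots> \<le> (\<Sum>f\<in>?I. (det (\<chi> j. v (x (f j))))\<^sup>2 * tr f x)"
      by (intro sum_mono mult_left_mono tr_ge) auto
    finally have "vol x \<le> 1 / (fact CARD('m) * ?a) * (\<Sum>f\<in>?I. (det (\<chi> j. v (x (f j))))\<^sup>2 * tr f x)"
      using a0 by (simp add: field_simps)
    then have "ennreal (vol x) \<le> ennreal (1 / (fact CARD('m) * ?a) * (\<Sum>f\<in>?I. (det (\<chi> j. v (x (f j))))\<^sup>2 * tr f x))"
      by (rule ennreal_leI)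
    also have "\<dots> = ennreal (1 / (fact CARD('m) * ?a)) * ennreal (\<Sum>f\<in>?I. (det (\<chi> j. v (x (f j))))\<^sup>2 * tr f x)"
      using a0 by (intro ennreal_mult') simp
    also have "ennreal (\<Sum>f\<in>?I. (det (\<chi> j. v (x (f j))))\<^sup>2 * tr f x) = (\<Sum>f\<in>?I. ?D f x * ennreal (tr f x))"
    proof -
      have "0 \<le> tr f x" if "f \<in> ?I" for f using tr_ge[OF that] a0 by linarith
      then show ?thesis by (subst sum_ennreal[symmetric]) (auto simp: ennreal_mult')
    qed
    finally show ?thesis using True by simp
  qed simp
  have "(\<integral>\<^sup>+x. ennreal (vol x) * indicator {x. bad UNIV t x} x \<partial>?P)
     \<le> (\<integral>\<^sup>+x. ennreal (1 / (fact CARD('m) * ?a)) * (\<Sum>f\<in>?I. ?D f x * ennreal (tr f x)) \<partial>?P)"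
    by (intro nn_integral_mono pt)
  also have "\<dots> = ennreal (1 / (fact CARD('m) * ?a)) * (\<Sum>f\<in>?I. \<integral>\<^sup>+x. ?D f x * ennreal (tr f x) \<partial>?P)"
  proof -
    have m: "(\<lambda>x. ?D f x * ennreal (tr f x)) \<in> borel_measurable ?P" for f
      using measurable_det_frame[of f UNIV] meas[of f UNIV] by measurable
    then show ?thesis by (subst nn_integral_cmult) (auto intro!: borel_measurable_sum simp: nn_integral_sum)
  qed
  also have "\<dots> \<le> ennreal (1 / (fact CARD('m) * ?a)) * (\<Sum>f\<in>?I. ennreal (fact CARD('m)) * ennreal E)"
    by (intro mult_left_mono sum_mono term_le) auto
  also have "\<dots> = ennreal (1 / (fact CARD('m) * ?a) * (real (card ?I) * (fact CARD('m) * E)))"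
  proof -
    have "0 \<le> E" by (simp add: E_def)
    then have "(\<Sum>f\<in>?I. ennreal (fact CARD('m)) * ennreal E) = ennreal (real (card ?I) * (fact CARD('m) * E))"
      by (simp add: ennreal_mult ennreal_of_nat_eq_real_of_nat)
    then show ?thesis using a0 \<open>0 \<le> E\<close> by (simp only: ennreal_mult[symmetric] zero_le_divide_1_iff
        less_imp_le mult_nonneg_nonneg fact_ge_zero of_nat_0_le_iff)
  qed
  also have "1 / (fact CARD('m) * ?a) * (real (card ?I) * (fact CARD('m) * E)) = real (card ?I) * (E / ?a)" by simp
  finally show ?thesis by (simp add: E_def)
qed

text \<open>The left-hand side does not involve \<open>N\<close>, so the bound passes to the limit:
  \<open>kap\<close> tends to \<open>th * K\<close> and the denominator to
  \<open>exp (- (th * t))\<close>.\<close>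

lemma mean_vol_bad_le_exp:
  fixes th t :: real
  assumes nm: "CARD('m) < CARD('n::finite)" and th: "th > 0" and t: "0 \<le> t"
  defines "L \<equiv> real CARD('n) - real CARD('m)"
  shows "(\<integral>\<^sup>+x. ennreal (vol x) * indicator {x. bad (UNIV :: 'n set) t x} x \<partial>PiM UNIV (\<lambda>_. M))
    \<le> ennreal (real (card {f :: 'm \<Rightarrow> 'n. inj f}) * (real CARD('m) * exp (th * t - L * (1 - exp (- (th * K))) / K)))"
    (is "?lhs \<le> ennreal ?B")
proof -
  define kap where "kap = (\<lambda>N. th * K / (1 - th * L * K / real N))"
  define B where "B = (\<lambda>N. real (card {f :: 'm \<Rightarrow> 'n. inj f}) * (real CARD('m) * exp (- (th * ((1 - exp (- kap N)) / kap N)) * L)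
        / (1 + (- (th * t)) / real N) ^ N))"
  have kap: "kap \<longlonglongrightarrow> th * K"
  proof -
    have "(\<lambda>N. th * L * K / real N) \<longlonglongrightarrow> 0" by (rule lim_const_over_n)
    then have "(\<lambda>N. th * K / (1 - th * L * K / real N)) \<longlonglongrightarrow> th * K / (1 - 0)"
      by (intro tendsto_intros) auto
    then show ?thesis by (simp add: kap_def)
  qed
  have "B \<longlonglongrightarrow> real (card {f :: 'm \<Rightarrow> 'n. inj f}) * (real CARD('m) * exp (- (th * ((1 - exp (- (th * K))) / (th * K))) * L)
        / exp (- (th * t)))"
    unfolding B_def using th K_pos
    by (intro tendsto_intros kap tendsto_exp_limit_sequentially) auto
  also have "real (card {f :: 'm \<Rightarrow> 'n. inj f}) * (real CARD('m) * exp (- (th * ((1 - exp (- (th * K))) / (th * K))) * L)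
        / exp (- (th * t))) = ?B"
  proof -
    have "th * ((1 - exp (- (th * K))) / (th * K)) * L = L * (1 - exp (- (th * K))) / K"
      using th by simp
    then show ?thesis by (simp add: exp_diff exp_minus field_simps)
  qed
  finally have lim: "(\<lambda>N. ennreal (B N)) \<longlonglongrightarrow> ennreal ?B" by (rule tendsto_ennrealI)
  have "eventually (\<lambda>N. th * L * K < real N \<and> th * t < real N) sequentially"
    using filterlim_real_sequentially unfolding filterlim_at_top_dense by (auto intro: eventually_conj)
  then have "eventually (\<lambda>N. ?lhs \<le> ennreal (B N)) sequentially"
  proof eventually_elim
    case (elim N)
    then show ?case
      using mean_vol_bad_le_power[OF nm th t, of N] unfolding B_def kap_def L_def by simp
  qed
  then show ?thesis by (rule tendsto_lowerbound[OF lim]) simp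
qed

end

section \<open>Weighted least squares\<close>

text \<open>\<open>lambda_min\<close> is a \<open>Min\<close>, so the eigenvalue set must be shown
  finite and nonempty. It is finite because eigenvectors of distinct eigenvalues are orthogonal,
  hence independent. It is nonempty because the minimum of the Rayleigh quotient over the unit
  sphere is an eigenvalue.\<close>

lemma lambda_min_ge_iff:
  fixes A :: "real^'m::finite^'m"
  assumes A: "transpose A = A"
  shows "t \<le> lambda_min A \<longleftrightarrow> (\<forall>c. t * (c \<bullet> c) \<le> c \<bullet> (A *v c))"
proof -
  let ?E = "{l. \<exists>v. v \<noteq> 0 \<and> A *v v = l *\<^sub>R v}"
  have sym: "(A *v x) \<bullet> y = x \<bullet> (A *v y)" for x y
    by (metis A dot_lmul_matrix transpose_matrix_vector)
  have fin: "finite ?E"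
  proof -
    define ev where "ev = (\<lambda>l. SOME v. v \<noteq> 0 \<and> A *v v = l *\<^sub>R v)"
    have ev: "ev l \<noteq> 0 \<and> A *v ev l = l *\<^sub>R ev l" if "l \<in> ?E" for l
      unfolding ev_def by (rule someI_ex) (use that in simp)
    have orth: "ev l \<bullet> ev l' = 0" if "l \<in> ?E" "l' \<in> ?E" "l \<noteq> l'" for l l'
    proof -
      have "l * (ev l \<bullet> ev l') = l' * (ev l \<bullet> ev l')"
        using sym[of "ev l" "ev l'"] ev[OF that(1)] ev[OF that(2)] by simp
      then show ?thesis using that(3) by simp
    qed
    have inj: "inj_on ev ?E"
    proof (rule inj_onI, rule ccontr)
      fix l l' assume l: "l \<in> ?E" "l' \<in> ?E" "ev l = ev l'" "l \<noteq> l'"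
      then have "ev l \<bullet> ev l = 0" using orth[OF l(1,2,4)] by simp
      then show False using ev[OF l(1)] by simp
    qed
    have "pairwise orthogonal (ev ` ?E)"
      unfolding pairwise_def orthogonal_def
    proof (intro ballI impI)
      fix x y assume "x \<in> ev ` ?E" "y \<in> ev ` ?E" "x \<noteq> y"
      then obtain l l' where "l \<in> ?E" "l' \<in> ?E" "x = ev l" "y = ev l'" "l \<noteq> l'" by blast
      then show "x \<bullet> y = 0" using orth by simp
    qed
    moreover have "0 \<notin> ev ` ?E" using ev by force
    ultimately have "independent (ev ` ?E)" by (intro pairwise_orthogonal_independent)
    then have "finite (ev ` ?E)" using independent_imp_finite by blast
    then show ?thesis using inj by (rule finite_imageD)
  qed
  obtain u where u: "norm u = 1" and umin: "\<And>c. norm c = 1 \<Longrightarrow> u \<bullet> (A *v u) \<le> c \<bullet> (A *v c)"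
  proof -
    have "continuous_on (sphere 0 1) (\<lambda>c :: real^'m. c \<bullet> (A *v c))"
      by (intro continuous_intros linear_continuous_on matrix_vector_mul_bounded_linear)
    moreover have "sphere 0 1 \<noteq> ({} :: (real^'m) set)" by simp
    ultimately have "\<exists>u\<in>sphere 0 1. \<forall>c\<in>sphere 0 1. u \<bullet> (A *v u) \<le> c \<bullet> (A *v c)"
      by (intro continuous_attains_inf compact_sphere)
    then show ?thesis using that by auto
  qed
  define l0 where "l0 = u \<bullet> (A *v u)"
  have min: "l0 * (c \<bullet> c) \<le> c \<bullet> (A *v c)" for c
  proof (cases "c = 0")
    case False
    let ?d = "(1 / norm c) *\<^sub>R c"
    have "l0 \<le> ?d \<bullet> (A *v ?d)" unfolding l0_def by (rule umin) (use False in simp)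
    also have "\<dots> = c \<bullet> (A *v c) / (c \<bullet> c)"
      by (simp add: matrix_vector_mult_scaleR dot_square_norm power2_eq_square)
    finally show ?thesis using False by (simp add: field_simps)
  qed simp
  have l0: "l0 \<in> ?E"
  proof -
    \<comment> \<open>Optimality without calculus: \<open>?T\<close> is positive and its form
      vanishes at \<open>u\<close>, so Cauchy-Schwarz for that form at \<open>?T u\<close> and
      \<open>u\<close> forces \<open>?T u = 0\<close>.\<close>
    let ?T = "\<lambda>x. A *v x - l0 *\<^sub>R x"
    have "psd ?T"
      unfolding psd_def using min
      by (auto intro!: linearI simp: matrix_vector_right_distrib matrix_vector_mult_scaleR
          inner_diff_left inner_diff_right sym algebra_simps)
    then have "(?T u \<bullet> ?T u)\<^sup>2 \<le> (?T u \<bullet> ?T (?T u)) * (u \<bullet> ?T u)" by (rule psd_Cauchy_Schwarz)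
    also have "u \<bullet> ?T u = 0" using u by (simp add: l0_def inner_diff_right dot_square_norm)
    finally have "?T u = 0" by simp
    moreover have "u \<noteq> 0" using u by auto
    ultimately show ?thesis by auto
  qed
  show ?thesis
  proof
    assume "t \<le> lambda_min A"
    then have "t \<le> l0" using Min_le[OF fin l0] by (simp add: lambda_min_def)
    then show "\<forall>c. t * (c \<bullet> c) \<le> c \<bullet> (A *v c)"
      using min by (meson inner_ge_zero mult_right_mono order_trans)
  next
    assume *: "\<forall>c. t * (c \<bullet> c) \<le> c \<bullet> (A *v c)"
    define l where "l = Min ?E"
    have "l \<in> ?E" unfolding l_def using fin l0 by (intro Min_in) auto
    then obtain c where c: "c \<noteq> 0" "A *v c = l *\<^sub>R c" by blast
    have "t * (c \<bullet> c) \<le> c \<bullet> (A *v c)" using * by blast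
    also have "\<dots> = l * (c \<bullet> c)" by (simp add: c(2))
    finally have "t \<le> l" using c(1) by simp
    then show "t \<le> lambda_min A" by (simp add: lambda_min_def l_def)
  qed
qed

section \<open>Whitened basis and normal equations\<close>

definition whiten :: "('m::finite \<Rightarrow> 'a \<Rightarrow> real) \<Rightarrow> ('a \<Rightarrow> real) \<Rightarrow> 'a \<Rightarrow> real^'m" where
  "whiten phi w a = (\<chi> j. inverse (sqrt (w a)) * phi j a)"

lemma whiten_nth: "whiten phi w a $ j = inverse (sqrt (w a)) * phi j a"
  by (simp add: whiten_def)

lemma det_Phi_w:
  "det (transpose (Phi_w phi w x) ** Phi_w phi w x)
    = det (\<chi> j k. \<Sum>i\<in>UNIV. whiten phi w (x i) $ j * whiten phi w (x i) $ k)"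
proof -
  have "transpose (Phi_w phi w x) ** Phi_w phi w x
      = (\<chi> j k. \<Sum>i\<in>UNIV. whiten phi w (x i) $ j * whiten phi w (x i) $ k)"
    by (simp add: vec_eq_iff matrix_matrix_mult_def transpose_def Phi_w_def whiten_def)
  then show ?thesis by (simp only:)
qed

lemma inner_G_w:
  fixes x :: "'n::finite \<Rightarrow> 'a"
  shows "c \<bullet> (G_w phi w x *v c) = (\<Sum>i\<in>UNIV. (whiten phi w (x i) \<bullet> c)\<^sup>2) / real CARD('n)"
proof -
  let ?P = "Phi_w phi w x"
  have "G_w phi w x *v c = (1 / real CARD('n)) *\<^sub>R (transpose ?P *v (?P *v c))"
    by (simp add: G_w_def scaleR_matrix_vector_assoc[symmetric] matrix_vector_mul_assoc)
  then have "c \<bullet> (G_w phi w x *v c) = (1 / real CARD('n)) * ((?P *v c) \<bullet> (?P *v c))"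
    by (simp add: dot_lmul_matrix[symmetric] transpose_matrix_vector inner_commute)
  also have "(?P *v c) \<bullet> (?P *v c) = (\<Sum>i\<in>UNIV. (whiten phi w (x i) \<bullet> c)\<^sup>2)"
    by (simp add: inner_vec_def matrix_vector_mult_def Phi_w_def whiten_def power2_eq_square)
  finally show ?thesis by simp
qed

lemma transpose_G_w: "transpose (G_w phi w x) = G_w phi w x"
  by (simp add: G_w_def transpose_scalar matrix_transpose_mul)

lemma lambda_min_G_w_ge_iff:
  fixes x :: "'n::finite \<Rightarrow> 'a"
  shows "t / real CARD('n) \<le> lambda_min (G_w phi w x)
    \<longleftrightarrow> (\<forall>c. t * (c \<bullet> c) \<le> (\<Sum>i\<in>UNIV. (whiten phi w (x i) \<bullet> c)\<^sup>2))"
proof -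
  have "t / real CARD('n) * r \<le> s / real CARD('n) \<longleftrightarrow> t * r \<le> s" for r s
    by (simp add: divide_le_cancel)
  then show ?thesis unfolding lambda_min_ge_iff[OF transpose_G_w] inner_G_w by (simp only:)
qed

text \<open>By the normal equations for \<open>b\<close> the cross terms vanish, so the empirical
  error of a candidate \<open>d\<close> is a constant plus a form in \<open>d - a - b\<close>. Its
  coercivity gives the uniqueness demanded by \<open>THE\<close>. The first estimate follows from
  nonnegativity of the remaining error, the second from pairing the normal equations with
  \<open>b\<close>.\<close>

lemma wls_proj_eq:
  fixes x :: "'n::finite \<Rightarrow> 'a" and phi :: "'m::finite \<Rightarrow> 'a \<Rightarrow> real"
  assumes w: "\<And>y. 0 \<le> w y" and t: "t > 0"
    and pd: "\<And>c. t * (c \<bullet> c) \<le> (\<Sum>i\<in>UNIV. (whiten phi w (x i) \<bullet> c)\<^sup>2)"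
    and f: "f = (\<lambda>y. (\<Sum>j\<in>UNIV. a $ j * phi j y) + g y)"
  defines "h \<equiv> \<lambda>y. inverse (sqrt (w y)) * g y"
  obtains b where "wls_proj phi w x f = (\<lambda>y. \<Sum>j\<in>UNIV. (a $ j + b $ j) * phi j y)"
    and "t * (norm b)\<^sup>2 \<le> (\<Sum>i\<in>UNIV. (h (x i))\<^sup>2)"
    and "t\<^sup>2 * (norm b)\<^sup>2 \<le> (norm (\<Sum>i\<in>UNIV. h (x i) *\<^sub>R whiten phi w (x i)))\<^sup>2"
proof -
  let ?u = "\<lambda>i. whiten phi w (x i)"
  define T where "T = (\<lambda>y. \<Sum>i\<in>UNIV. (?u i \<bullet> y) *\<^sub>R ?u i)"
  define z where "z = (\<Sum>i\<in>UNIV. h (x i) *\<^sub>R ?u i)"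
  have lin: "linear T"
    unfolding T_def by (rule linearI) (simp_all add: inner_add_right scaleR_add_left sum.distrib scaleR_sum_right)
  have yT: "y \<bullet> T y' = (\<Sum>i\<in>UNIV. (?u i \<bullet> y') * (?u i \<bullet> y))" for y y'
    by (simp add: T_def inner_sum_right inner_commute)
  have "inj T"
  proof (rule linear_injective_0[OF lin, THEN iffD2], intro allI impI)
    fix y assume "T y = 0"
    then have "t * (y \<bullet> y) \<le> 0" using pd[of y] yT[of y y] by (simp add: power2_eq_square)
    then show "y = 0" using t by (metis inner_gt_zero_iff mult_pos_pos not_less)
  qed
  then have "surj T" by (rule linear_inj_imp_surj[OF lin])
  then obtain b where b: "T b = z" by (metis surjD)
  have normal: "(\<Sum>i\<in>UNIV. (?u i \<bullet> b) * (?u i \<bullet> y)) = (\<Sum>i\<in>UNIV. h (x i) * (?u i \<bullet> y))" for y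
  proof -
    have "(\<Sum>i\<in>UNIV. (?u i \<bullet> b) * (?u i \<bullet> y)) = y \<bullet> z" unfolding b[symmetric] yT ..
    then show ?thesis by (simp add: z_def inner_sum_right inner_commute)
  qed
  let ?r = "\<Sum>i\<in>UNIV. (h (x i) - ?u i \<bullet> b)\<^sup>2"
  let ?V = "\<lambda>d :: real^'m. \<lambda>y. \<Sum>j\<in>UNIV. d $ j * phi j y"
  have emp: "emp_norm_sq w x (\<lambda>y. f y - ?V d y)
      = (?r + (\<Sum>i\<in>UNIV. (?u i \<bullet> (d - a - b))\<^sup>2)) / real CARD('n)" for d
  proof -
    have "inverse (w (x i)) * (f (x i) - ?V d (x i))\<^sup>2 = ((h (x i) - ?u i \<bullet> b) - ?u i \<bullet> (d - a - b))\<^sup>2" for i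
    proof -
      \<comment> \<open>This also covers \<open>w (x i) = 0\<close>, where both sides are 0.\<close>
      have "inverse (w (x i)) = (inverse (sqrt (w (x i))))\<^sup>2" using w[of "x i"] by (simp add: power_inverse)
      moreover have "inverse (sqrt (w (x i))) * (f (x i) - ?V d (x i)) = h (x i) - ?u i \<bullet> (d - a)"
        by (simp add: f h_def inner_vec_def whiten_nth algebra_simps sum_distrib_left sum_subtractf)
      ultimately show ?thesis
        by (simp only: power_mult_distrib[symmetric]) (simp add: inner_diff_right algebra_simps)
    qed
    then have "real CARD('n) * emp_norm_sq w x (\<lambda>y. f y - ?V d y)
        = (\<Sum>i\<in>UNIV. ((h (x i) - ?u i \<bullet> b) - ?u i \<bullet> (d - a - b))\<^sup>2)"
      by (simp add: emp_norm_sq_def)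
    also have "\<dots> = ?r - 2 * (\<Sum>i\<in>UNIV. (h (x i) - ?u i \<bullet> b) * (?u i \<bullet> (d - a - b))) + (\<Sum>i\<in>UNIV. (?u i \<bullet> (d - a - b))\<^sup>2)"
    proof -
      have "(r - s)\<^sup>2 = r\<^sup>2 - 2 * (r * s) + s\<^sup>2" for r s :: real by (simp add: power2_diff)
      then show ?thesis by (simp only: sum.distrib sum_subtractf sum_distrib_left)
    qed
    also have "(\<Sum>i\<in>UNIV. (h (x i) - ?u i \<bullet> b) * (?u i \<bullet> (d - a - b))) = 0"
      using normal[of "d - a - b"] by (simp add: left_diff_distrib sum_subtractf)
    finally show ?thesis by (simp add: field_simps)
  qed
  have pos: "(\<Sum>i\<in>UNIV. (?u i \<bullet> c)\<^sup>2) \<le> 0 \<Longrightarrow> c = 0" for c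
    using pd[of c] t by (metis inner_gt_zero_iff mult_pos_pos not_less order_trans)
  have V: "g' \<in> Vspace phi \<longleftrightarrow> (\<exists>d. g' = ?V d)" for g'
    unfolding Vspace_def by (auto intro: exI[of _ "vec_lambda _"] exI[of _ "vec_nth _"])
  have "wls_proj phi w x f = ?V (a + b)"
    unfolding wls_proj_def
  proof (rule the_equality)
    show "?V (a + b) \<in> Vspace phi \<and> (\<forall>h\<in>Vspace phi. emp_norm_sq w x (\<lambda>y. f y - ?V (a + b) y) \<le> emp_norm_sq w x (\<lambda>y. f y - h y))"
    proof (intro conjI ballI)
      show "?V (a + b) \<in> Vspace phi" unfolding V by blast
      fix k assume "k \<in> Vspace phi"
      then obtain d where d: "k = ?V d" unfolding V by blast
      show "emp_norm_sq w x (\<lambda>y. f y - ?V (a + b) y) \<le> emp_norm_sq w x (\<lambda>y. f y - k y)"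
        unfolding d emp by (intro divide_right_mono) (simp_all add: sum_nonneg)
    qed
    fix k assume k: "k \<in> Vspace phi \<and> (\<forall>h\<in>Vspace phi. emp_norm_sq w x (\<lambda>y. f y - k y) \<le> emp_norm_sq w x (\<lambda>y. f y - h y))"
    then obtain d where d: "k = ?V d" unfolding V by blast
    have ab: "?V (a + b) \<in> Vspace phi" unfolding V by blast
    have "emp_norm_sq w x (\<lambda>y. f y - ?V d y) \<le> emp_norm_sq w x (\<lambda>y. f y - ?V (a + b) y)"
      using bspec[OF conjunct2[OF k] ab] unfolding d .
    then have "(\<Sum>i\<in>UNIV. (?u i \<bullet> (d - a - b))\<^sup>2) \<le> 0"
      unfolding emp by (simp add: divide_le_cancel)
    then have "d - a - b = 0" by (rule pos)
    then show "k = ?V (a + b)" using d by (simp add: algebra_simps)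
  qed
  moreover have "t * (norm b)\<^sup>2 \<le> (\<Sum>i\<in>UNIV. (h (x i))\<^sup>2)"
  proof -
    let ?s = "\<Sum>i\<in>UNIV. (?u i \<bullet> b)\<^sup>2"
    have "?s = (\<Sum>i\<in>UNIV. h (x i) * (?u i \<bullet> b))" using normal[of b] by (simp add: power2_eq_square)
    then have "0 \<le> (\<Sum>i\<in>UNIV. (h (x i))\<^sup>2) - ?s"
    proof -
      have "0 \<le> ?r" by (simp add: sum_nonneg)
      also have "?r = (\<Sum>i\<in>UNIV. (h (x i))\<^sup>2) - 2 * (\<Sum>i\<in>UNIV. h (x i) * (?u i \<bullet> b)) + ?s"
        by (simp add: power2_diff sum.distrib sum_subtractf sum_distrib_left mult.assoc)
      finally show ?thesis using \<open>?s = _\<close> by simp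
    qed
    then show ?thesis using pd[of b] by (simp add: dot_square_norm)
  qed
  moreover have "t\<^sup>2 * (norm b)\<^sup>2 \<le> (norm z)\<^sup>2"
  proof -
    have "t * (norm b)\<^sup>2 \<le> b \<bullet> z" using pd[of b] yT[of b b] b by (simp add: dot_square_norm power2_eq_square)
    also have "\<dots> \<le> norm b * norm z" by (rule norm_cauchy_schwarz)
    finally have "norm b * (t * norm b) \<le> norm b * norm z" by (simp add: power2_eq_square mult_ac)
    then have "t * norm b \<le> norm z" by (cases "b = 0") auto
    then show ?thesis using t by (metis mult_nonneg_nonneg norm_ge_zero less_imp_le power_mono power_mult_distrib)
  qed
  ultimately show ?thesis using that[of b] by (simp add: z_def)
qed

text \<open>The vectors violating the inequality form an open set, so testing a countable dense set
  of \<open>c\<close> suffices and the event is a countable intersection.\<close>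

lemma pd_sets_measurable:
  fixes u :: "'a \<Rightarrow> real^'m::finite"
  assumes u: "u \<in> borel_measurable M" and sp: "space M = UNIV"
  shows "{x :: 'n::finite \<Rightarrow> 'a. \<forall>c. t * (c \<bullet> c) \<le> (\<Sum>i\<in>UNIV. (u (x i) \<bullet> c)\<^sup>2)} \<in> sets (PiM UNIV (\<lambda>_. M))"
proof -
  obtain D :: "(real^'m) set" where D: "countable D" "\<And>X. open X \<Longrightarrow> X \<noteq> {} \<Longrightarrow> \<exists>d\<in>D. d \<in> X"
    using countable_dense_setE by blast
  have eq: "(\<forall>c. t * (c \<bullet> c) \<le> (\<Sum>i\<in>UNIV. (u (x i) \<bullet> c)\<^sup>2)) \<longleftrightarrow> (\<forall>c\<in>D. t * (c \<bullet> c) \<le> (\<Sum>i\<in>UNIV. (u (x i) \<bullet> c)\<^sup>2))"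
    for x :: "'n \<Rightarrow> 'a"
  proof
    assume *: "\<forall>c\<in>D. t * (c \<bullet> c) \<le> (\<Sum>i\<in>UNIV. (u (x i) \<bullet> c)\<^sup>2)"
    have "open {c. (\<Sum>i\<in>UNIV. (u (x i) \<bullet> c)\<^sup>2) < t * (c \<bullet> c)}"
      by (intro open_Collect_less continuous_intros)
    then have "{c. (\<Sum>i\<in>UNIV. (u (x i) \<bullet> c)\<^sup>2) < t * (c \<bullet> c)} = {}"
      using D(2) * by (metis (no_types, lifting) mem_Collect_eq not_less)
    then show "\<forall>c. t * (c \<bullet> c) \<le> (\<Sum>i\<in>UNIV. (u (x i) \<bullet> c)\<^sup>2)" by (auto simp: not_less)
  qed simp
  have [measurable]: "(\<lambda>x :: 'n \<Rightarrow> 'a. u (x i)) \<in> borel_measurable (PiM UNIV (\<lambda>_. M))" for i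
    by (rule measurable_compose[OF _ u]) simp
  have "{x \<in> space (PiM (UNIV :: 'n set) (\<lambda>_. M)). t * (c \<bullet> c) \<le> (\<Sum>i\<in>UNIV. (u (x i) \<bullet> c)\<^sup>2)}
      \<in> sets (PiM UNIV (\<lambda>_. M))" for c
    by measurable
  moreover have "D \<noteq> {}" using D(2)[of UNIV] by auto
  ultimately have "(\<Inter>c\<in>D. {x \<in> space (PiM (UNIV :: 'n set) (\<lambda>_. M)). t * (c \<bullet> c) \<le> (\<Sum>i\<in>UNIV. (u (x i) \<bullet> c)\<^sup>2)})
      \<in> sets (PiM UNIV (\<lambda>_. M))"
    using D(1) by (intro sets.countable_INT') auto
  moreover have "{x :: 'n \<Rightarrow> 'a. \<forall>c. t * (c \<bullet> c) \<le> (\<Sum>i\<in>UNIV. (u (x i) \<bullet> c)\<^sup>2)}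
      = (\<Inter>c\<in>D. {x \<in> space (PiM (UNIV :: 'n set) (\<lambda>_. M)). t * (c \<bullet> c) \<le> (\<Sum>i\<in>UNIV. (u (x i) \<bullet> c)\<^sup>2)})"
    by (auto simp: eq space_PiM sp)
  ultimately show ?thesis by simp
qed

text \<open>The constant \<open>G\<close> is integrated over \<open>S\<close> only and cancels
  against the probability of \<open>S\<close>. Only \<open>Y\<close>, integrated over the whole
  space, pays the factor \<open>inverse p\<close>; this keeps the leading 1 in the error
  bounds.\<close>

lemma cond_exp_event_bound:
  assumes P: "prob_space P" and S: "S \<in> sets P" and eta: "measure P S \<ge> p" "p > 0"
    and Y: "Y \<in> borel_measurable P" "\<And>x. 0 \<le> Y x" and Z: "\<And>x. x \<in> S \<Longrightarrow> Z x \<le> G + Y x"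
    and B: "(\<integral>\<^sup>+x. ennreal (Y x) \<partial>P) \<le> ennreal B" "0 \<le> B" and G: "0 \<le> G"
  shows "cond_exp_event P S Z \<le> ennreal (G + inverse p * B)"
proof -
  interpret prob_space P by fact
  have "(\<integral>\<^sup>+x. indicator S x * ennreal (Z x) \<partial>P) \<le> (\<integral>\<^sup>+x. ennreal G * indicator S x + ennreal (Y x) \<partial>P)"
  proof (rule nn_integral_mono)
    fix x
    show "indicator S x * ennreal (Z x) \<le> ennreal G * indicator S x + ennreal (Y x)"
      using Z[of x] G Y(2)[of x] by (auto simp: indicator_def ennreal_plus[symmetric] simp del: ennreal_plus intro: ennreal_leI)
  qed
  also have "\<dots> = ennreal G * emeasure P S + (\<integral>\<^sup>+x. ennreal (Y x) \<partial>P)"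
    using S Y by (subst nn_integral_add) (auto simp: nn_integral_cmult_indicator)
  also have "\<dots> \<le> ennreal G * ennreal (prob S) + ennreal B"
    using B by (simp add: emeasure_eq_measure add_left_mono)
  also have "\<dots> = ennreal (G * prob S + B)"
    using G B by (simp add: ennreal_mult ennreal_plus)
  finally have "cond_exp_event P S Z \<le> ennreal (G * prob S + B) / ennreal (prob S)"
    unfolding cond_exp_event_def by (simp add: emeasure_eq_measure divide_right_mono_ennreal)
  also have "\<dots> = ennreal ((G * prob S + B) / prob S)"
    using eta G B by (intro divide_ennreal) auto
  also have "(G * prob S + B) / prob S = G + B / prob S" using eta by (simp add: field_simps)
  also have "ennreal (G + B / prob S) \<le> ennreal (G + inverse p * B)"
    using eta B by (intro ennreal_leI add_left_mono) (auto simp: divide_inverse mult.commute intro!: mult_left_mono le_imp_inverse_le)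
  finally show ?thesis .
qed

section \<open>Square-integrable functions and the orthogonal residual\<close>

lemma in_L2_integrable_mult:
  assumes "in_L2 M f" "in_L2 M g" shows "integrable M (\<lambda>y. f y * g y)"
proof (rule Bochner_Integration.integrable_bound)
  have [measurable]: "f \<in> borel_measurable M" "g \<in> borel_measurable M" using assms by (auto simp: in_L2_def)
  show "integrable M (\<lambda>y. (f y)\<^sup>2 + (g y)\<^sup>2)" using assms by (simp add: in_L2_def)
  show "(\<lambda>y. f y * g y) \<in> borel_measurable M" by measurable
  show "AE y in M. norm (f y * g y) \<le> norm ((f y)\<^sup>2 + (g y)\<^sup>2)"
  proof (rule AE_I2)
    fix y
    have "2 * (\<bar>f y\<bar> * \<bar>g y\<bar>) \<le> (f y)\<^sup>2 + (g y)\<^sup>2"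
      using sum_squares_bound[of "\<bar>f y\<bar>" "\<bar>g y\<bar>"] by simp
    moreover have "0 \<le> \<bar>f y\<bar> * \<bar>g y\<bar>" by simp
    ultimately have "\<bar>f y * g y\<bar> \<le> (f y)\<^sup>2 + (g y)\<^sup>2" unfolding abs_mult by linarith
    then show "norm (f y * g y) \<le> norm ((f y)\<^sup>2 + (g y)\<^sup>2)" by simp
  qed
qed

lemma in_L2_add:
  assumes "in_L2 M f" "in_L2 M g" shows "in_L2 M (\<lambda>y. f y + g y)"
proof -
  have "integrable M (\<lambda>y. (f y)\<^sup>2 + (g y)\<^sup>2 + 2 * (f y * g y))"
    using assms in_L2_integrable_mult[OF assms] by (simp add: in_L2_def)
  then show ?thesis using assms by (auto simp: in_L2_def power2_sum mult.assoc)
qed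

lemma in_L2_cmult: "in_L2 M f \<Longrightarrow> in_L2 M (\<lambda>y. c * f y)"
  by (auto simp: in_L2_def power_mult_distrib)

lemma in_L2_sum: "(\<And>j. in_L2 M (f j)) \<Longrightarrow> in_L2 M (\<lambda>y. \<Sum>j\<in>A. f j y)" if "finite A"
  using that by (induction A) (auto simp: in_L2_add, simp add: in_L2_def)

locale weighted_basis =
  fixes mu :: "'a::topological_space measure" and phi :: "'m::finite \<Rightarrow> 'a \<Rightarrow> real"
    and w :: "'a \<Rightarrow> real" and alpha :: real
  assumes mu_borel: "sets mu = sets borel"
    and mu_prob: "prob_space mu"
    and phi_L2: "\<And>j. in_L2 mu (phi j)"
    and phi_orth: "\<And>j k. (\<integral>y. phi j y * phi k y \<partial>mu) = (if j = k then 1 else 0)"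
    and w_meas: "w \<in> borel_measurable mu"
    and w_nonneg: "\<And>y. w y \<ge> 0"
    and w_int: "integrable mu w"
    and w_dens: "(\<integral>y. w y \<partial>mu) = 1"
    and alpha_pos: "0 < alpha"
    and w_lower: "AE y in mu. w y \<ge> alpha * wm phi y"
begin

lemma Pythagoras:
  assumes g: "in_L2 mu g" and g0: "\<And>k. (\<integral>y. g y * phi k y \<partial>mu) = 0"
  shows "L2_norm_sq mu (\<lambda>y. g y - (\<Sum>j\<in>UNIV. c j * phi j y)) = L2_norm_sq mu g + (\<Sum>j\<in>UNIV. (c j)\<^sup>2)"
proof -
  have eq: "(g y - (\<Sum>j\<in>UNIV. c j * phi j y))\<^sup>2 = (g y)\<^sup>2 - 2 * (\<Sum>j\<in>UNIV. c j * (g y * phi j y))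
      + (\<Sum>j\<in>UNIV. \<Sum>k\<in>UNIV. c j * c k * (phi j y * phi k y))" for y
  proof -
    have "(\<Sum>j\<in>UNIV. c j * phi j y)\<^sup>2 = (\<Sum>j\<in>UNIV. \<Sum>k\<in>UNIV. c j * c k * (phi j y * phi k y))"
      by (simp only: power2_eq_square sum_product) (simp add: mult_ac)
    then show ?thesis by (simp add: power2_diff sum_distrib_left mult_ac)
  qed
  have "integrable mu (\<lambda>y. (g y)\<^sup>2)" using g by (simp add: in_L2_def)
  then have "L2_norm_sq mu (\<lambda>y. g y - (\<Sum>j\<in>UNIV. c j * phi j y))
      = L2_norm_sq mu g + (\<Sum>j\<in>UNIV. \<Sum>k\<in>UNIV. c j * c k * (if j = k then 1 else 0))"
    unfolding L2_norm_sq_def eq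
    using in_L2_integrable_mult[OF g phi_L2] in_L2_integrable_mult[OF phi_L2 phi_L2]
    by (simp add: Bochner_Integration.integral_sum Bochner_Integration.integrable_sum g0 phi_orth)
  then show ?thesis by (simp add: if_distrib[of "\<lambda>x. _ * x"] power2_eq_square cong: if_cong)
qed

definition coef :: "('a \<Rightarrow> real) \<Rightarrow> real^'m" where
  "coef f = (\<chi> j. \<integral>y. f y * phi j y \<partial>mu)"

definition resid :: "('a \<Rightarrow> real) \<Rightarrow> 'a \<Rightarrow> real" where
  "resid f y = f y - (\<Sum>j\<in>UNIV. coef f $ j * phi j y)"

lemma resid_L2: "in_L2 mu f \<Longrightarrow> in_L2 mu (resid f)"
proof -
  assume f: "in_L2 mu f"
  have "in_L2 mu (\<lambda>y. f y + (\<Sum>j\<in>UNIV. (- coef f $ j) * phi j y))"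
    by (intro in_L2_add f in_L2_sum in_L2_cmult phi_L2) simp
  then show ?thesis by (simp add: resid_def[abs_def] sum_negf)
qed

lemma resid_orth:
  assumes f: "in_L2 mu f" shows "(\<integral>y. resid f y * phi k y \<partial>mu) = 0"
proof -
  have "(\<integral>y. resid f y * phi k y \<partial>mu) = (\<integral>y. f y * phi k y - (\<Sum>j\<in>UNIV. coef f $ j * (phi j y * phi k y)) \<partial>mu)"
    by (simp add: resid_def left_diff_distrib sum_distrib_right mult.assoc)
  also have "\<dots> = coef f $ k - (\<Sum>j\<in>UNIV. coef f $ j * (if j = k then 1 else 0))"
    using in_L2_integrable_mult[OF f phi_L2] in_L2_integrable_mult[OF phi_L2 phi_L2]
    by (simp add: Bochner_Integration.integral_sum Bochner_Integration.integrable_sum phi_orth coef_def)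
  finally show ?thesis by (simp add: if_distrib[of "\<lambda>x. _ * x"] cong: if_cong)
qed

lemma resid_le_best:
  assumes f: "in_L2 mu f"
  shows "L2_norm_sq mu (resid f) \<le> (INF g\<in>Vspace phi. L2_norm_sq mu (\<lambda>y. f y - g y))"
proof (rule cINF_greatest)
  show "Vspace phi \<noteq> {}" by (auto simp: Vspace_def)
  fix g assume "g \<in> Vspace phi"
  then obtain c where c: "g = (\<lambda>y. \<Sum>j\<in>UNIV. c j * phi j y)" by (auto simp: Vspace_def)
  have "(\<lambda>y. f y - g y) = (\<lambda>y. resid f y - (\<Sum>j\<in>UNIV. (c j - coef f $ j) * phi j y))"
    by (simp add: resid_def c fun_eq_iff left_diff_distrib sum_subtractf)
  then show "L2_norm_sq mu (resid f) \<le> L2_norm_sq mu (\<lambda>y. f y - g y)"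
    by (simp add: Pythagoras[OF resid_L2[OF f] resid_orth[OF f]] sum_nonneg)
qed

section \<open>Sampling measure, truncated whitened basis and noise\<close>

definition nu :: "'a measure" where "nu = density mu (\<lambda>y. ennreal (w y))"

definition K :: real where "K = real CARD('m) / alpha"

text \<open>Off a \<open>nu\<close>-null set \<open>frame\<close> agrees with \<open>whiten phi w\<close>; the truncation makes the bound
  hold everywhere.\<close>

definition frame :: "'a \<Rightarrow> real^'m" where
  "frame a = (if whiten phi w a \<bullet> whiten phi w a \<le> K then whiten phi w a else 0)"

lemma inverse_sqrt_mult: "inverse (sqrt (w a)) * inverse (sqrt (w a)) = inverse (w a)"
  using w_nonneg[of a] by (simp flip: inverse_mult_distrib)

lemma whiten_inner: "whiten phi w a \<bullet> whiten phi w a = inverse (w a) * (real CARD('m) * wm phi a)"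
proof -
  have "whiten phi w a \<bullet> whiten phi w a = (\<Sum>j\<in>UNIV. (inverse (sqrt (w a)) * inverse (sqrt (w a))) * (phi j a)\<^sup>2)"
    by (simp add: inner_vec_def whiten_nth power2_eq_square mult_ac)
  then show ?thesis by (simp add: inverse_sqrt_mult wm_def sum_distrib_left)
qed

text \<open>Nothing of the basis is lost on the set where \<open>w\<close> vanishes and
  \<open>inverse\<close> returns 0: there \<open>alpha * wm phi <= w\<close> forces all basis
  functions to be 0.\<close>

lemma AE_basis_zero: "AE a in mu. w a = 0 \<longrightarrow> (\<forall>j. phi j a = 0)"
  using w_lower
proof eventually_elim
  case (elim a)
  show ?case
  proof (intro impI allI)
    fix j assume "w a = 0"
    then have "wm phi a \<le> 0" using elim alpha_pos by (simp add: mult_le_0_iff)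
    then have "(\<Sum>j\<in>UNIV. (phi j a)\<^sup>2) \<le> 0" by (simp add: wm_def divide_le_0_iff)
    then have "(\<Sum>j\<in>UNIV. (phi j a)\<^sup>2) = 0" by (intro antisym sum_nonneg) auto
    then show "phi j a = 0" by (simp add: sum_nonneg_eq_0_iff)
  qed
qed

lemma AE_frame: "AE a in mu. frame a = whiten phi w a"
  using w_lower
proof eventually_elim
  case (elim a)
  have "whiten phi w a \<bullet> whiten phi w a \<le> K"
  proof (cases "w a = 0")
    case True
    then show ?thesis using alpha_pos by (simp add: whiten_inner K_def)
  next
    case False
    then have "w a > 0" using w_nonneg[of a] by linarith
    moreover have "real CARD('m) * (alpha * wm phi a) \<le> real CARD('m) * w a"
      using elim by (intro mult_left_mono) auto
    ultimately show ?thesis using alpha_pos by (simp add: whiten_inner K_def field_simps)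
  qed
  then show ?case by (simp add: frame_def)
qed

lemma AE_nu_frame: "AE a in nu. frame a = whiten phi w a"
  unfolding nu_def using AE_frame w_meas by (subst AE_density) auto

text \<open>Converts integrals under \<open>nu\<close> into integrals under \<open>mu\<close>, for
  isotropy as well as for orthogonality of the noise. Since \<open>h\<close> is quantified inside,
  one null set serves all integrands.\<close>

lemma AE_mu_weight:
  "AE a in mu. \<forall>h j. w a * (inverse (sqrt (w a)) * h * frame a $ j) = h * phi j a"
  using AE_frame AE_basis_zero
proof eventually_elim
  case (elim a)
  show ?case
  proof (intro allI)
    fix h j
    show "w a * (inverse (sqrt (w a)) * h * frame a $ j) = h * phi j a"
    proof (cases "w a = 0")
      case False
      have "w a * (inverse (sqrt (w a)) * h * frame a $ j) = w a * (inverse (sqrt (w a)) * inverse (sqrt (w a))) * (h * phi j a)"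
        using elim(1) by (simp add: whiten_nth)
      also have "\<dots> = h * phi j a" unfolding inverse_sqrt_mult using False by simp
      finally show ?thesis .
    qed (use elim(2) in simp)
  qed
qed

lemma phi_meas [measurable]: "phi j \<in> borel_measurable mu"
  using phi_L2[of j] by (simp add: in_L2_def)

lemma whiten_meas: "whiten phi w \<in> borel_measurable mu"
proof (subst borel_measurable_euclidean_space, intro ballI)
  fix b :: "real^'m" assume "b \<in> Basis"
  then obtain j where "b = axis j 1" by (auto simp: Basis_vec_def)
  then show "(\<lambda>x. whiten phi w x \<bullet> b) \<in> borel_measurable mu"
    using w_meas phi_meas[of j] by (simp add: inner_axis whiten_nth)
qed

lemma frame_meas: "frame \<in> borel_measurable mu"
proof -
  note [measurable] = whiten_meas
  show ?thesis unfolding frame_def[abs_def] by measurable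
qed

lemma frame_nth_meas: "(\<lambda>a. frame a $ j) \<in> borel_measurable mu"
proof -
  have "(\<lambda>a. frame a \<bullet> axis j 1) \<in> borel_measurable mu" using frame_meas by measurable
  then show ?thesis by (simp add: inner_axis)
qed

lemma space_nu: "space nu = UNIV"
  using sets_eq_imp_space_eq[OF mu_borel] by (simp add: nu_def)

lemma prob_nu: "prob_space nu"
proof
  have "emeasure nu (space nu) = (\<integral>\<^sup>+y. ennreal (w y) \<partial>mu)"
    using w_meas by (simp add: nu_def emeasure_density cong: nn_integral_cong)
  also have "\<dots> = 1" using nn_integral_eq_integral[OF w_int] w_nonneg w_dens by simp
  finally show "emeasure nu (space nu) = 1" .
qed

lemma
  fixes F :: "'a \<Rightarrow> real"
  assumes "F \<in> borel_measurable mu"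
  shows integral_nu: "(\<integral>a. F a \<partial>nu) = (\<integral>a. w a * F a \<partial>mu)"
    and integrable_nu: "integrable nu F \<longleftrightarrow> integrable mu (\<lambda>a. w a * F a)"
  unfolding nu_def using assms w_meas w_nonneg by (auto simp: integral_density integrable_density)

sublocale bounded_frame nu frame K
proof -
  interpret prob_space nu by (rule prob_nu)
  show "bounded_frame nu frame K"
  proof
    show "frame \<in> borel_measurable nu" using frame_meas by (simp add: nu_def)
    show "frame x \<bullet> frame x \<le> K" for x using alpha_pos by (simp add: frame_def K_def)
    fix j k
    have m: "(\<lambda>x. frame x $ j * frame x $ k) \<in> borel_measurable mu"
      by (intro borel_measurable_times frame_nth_meas)
    have "(\<integral>x. frame x $ j * frame x $ k \<partial>nu) = (\<integral>x. w x * (frame x $ j * frame x $ k) \<partial>mu)"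
      by (rule integral_nu[OF m])
    also have "\<dots> = (\<integral>x. phi j x * phi k x \<partial>mu)"
    proof (rule integral_cong_AE)
      show "AE x in mu. w x * (frame x $ j * frame x $ k) = phi j x * phi k x"
        using AE_mu_weight AE_frame
      proof eventually_elim
        case (elim a)
        show ?case using elim(1)[rule_format, of "phi j a" k] elim(2) by (simp add: whiten_nth)
      qed
    qed (use m w_meas in measurable)
    finally show "(\<integral>x. frame x $ j * frame x $ k \<partial>nu) = (if j = k then 1 else 0)"
      by (simp add: phi_orth)
  qed
qed

definition noise :: "('a \<Rightarrow> real) \<Rightarrow> 'a \<Rightarrow> real" where
  "noise f a = inverse (sqrt (w a)) * resid f a"

context
  fixes f assumes f: "in_L2 mu f"
begin

lemma resid_meas: "resid f \<in> borel_measurable mu"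
  using resid_L2[OF f] by (simp add: in_L2_def)

lemma noise_meas: "noise f \<in> borel_measurable mu"
  unfolding noise_def[abs_def] using resid_meas w_meas by measurable

lemma noise_meas_nu: "noise f \<in> borel_measurable nu"
  using noise_meas by (simp add: nu_def)

text \<open>Equality can fail only where \<open>w\<close> vanishes: there the left side is 0,
  although the residual need not be.\<close>

lemma weight_noise_sq: "w a * (noise f a)\<^sup>2 \<le> (resid f a)\<^sup>2" "0 \<le> w a * (noise f a)\<^sup>2"
proof -
  have "w a * (noise f a)\<^sup>2 = w a * inverse (w a) * (resid f a)\<^sup>2"
    by (simp add: noise_def power2_eq_square inverse_sqrt_mult[symmetric] mult_ac)
  then show "w a * (noise f a)\<^sup>2 \<le> (resid f a)\<^sup>2" by (cases "w a = 0") auto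
  show "0 \<le> w a * (noise f a)\<^sup>2" using w_nonneg by simp
qed

lemma noise_sq_integrable: "integrable nu (\<lambda>a. (noise f a)\<^sup>2)"
proof (subst integrable_nu)
  show m: "(\<lambda>a. (noise f a)\<^sup>2) \<in> borel_measurable mu" using noise_meas by measurable
  show "integrable mu (\<lambda>a. w a * (noise f a)\<^sup>2)"
  proof (rule Bochner_Integration.integrable_bound)
    show "integrable mu (\<lambda>a. (resid f a)\<^sup>2)" using resid_L2[OF f] by (simp add: in_L2_def)
    show "(\<lambda>a. w a * (noise f a)\<^sup>2) \<in> borel_measurable mu" using m w_meas by measurable
  qed (use weight_noise_sq in simp)
qed

lemma integral_noise_sq_le: "(\<integral>a. (noise f a)\<^sup>2 \<partial>nu) \<le> L2_norm_sq mu (resid f)"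
proof -
  have m: "(\<lambda>a. (noise f a)\<^sup>2) \<in> borel_measurable mu" using noise_meas by measurable
  have "integrable mu (\<lambda>a. w a * (noise f a)\<^sup>2)" using noise_sq_integrable integrable_nu[OF m] by simp
  then show ?thesis
    unfolding integral_nu[OF m] L2_norm_sq_def using resid_L2[OF f]
    by (intro integral_mono weight_noise_sq) (auto simp: in_L2_def)
qed

lemma integral_noise_frame: "(\<integral>a. noise f a * frame a $ k \<partial>nu) = 0"
proof -
  have m: "(\<lambda>a. noise f a * frame a $ k) \<in> borel_measurable mu"
    by (intro borel_measurable_times noise_meas frame_nth_meas)
  have "(\<integral>a. noise f a * frame a $ k \<partial>nu) = (\<integral>a. w a * (noise f a * frame a $ k) \<partial>mu)"
    by (rule integral_nu[OF m])
  also have "\<dots> = (\<integral>a. resid f a * phi k a \<partial>mu)"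
  proof (rule integral_cong_AE)
    show "AE a in mu. w a * (noise f a * frame a $ k) = resid f a * phi k a"
      using AE_mu_weight
    proof eventually_elim
      case (elim a)
      then show ?case using elim[rule_format, of "resid f a" k] by (simp add: noise_def)
    qed
  qed (use m w_meas resid_meas phi_meas in measurable)
  finally show ?thesis by (simp add: resid_orth[OF f])
qed

end
end

section \<open>Optimising the Chernoff exponent\<close>

lemma c_delta_pos:
  assumes "0 < d" "d < 1" shows "c_delta d > 0"
proof -
  let ?y = "inverse (1 - d)"
  \<comment> \<open>Strictness of \<open>ln y <= y - 1\<close> away from 1; multiplied by
    \<open>1 - d\<close>, the strict inequality at \<open>1 / (1 - d)\<close> is the claim.\<close>
  have "ln ?y \<noteq> ?y - 1" using ln_eq_minus_one[of ?y] assms by auto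
  moreover have "ln ?y \<le> ?y - 1" using assms by (intro ln_le_minus_one) simp
  ultimately have "ln ?y < ?y - 1" by simp
  then have "(1 - d) * (- ln (1 - d)) < (1 - d) * (?y - 1)"
    using assms by (intro mult_strict_left_mono) (auto simp: ln_inverse)
  then show ?thesis using assms by (simp add: c_delta_def right_diff_distrib)
qed

text \<open>The value \<open>- ln (1 - d) / K\<close> is the stationary point in \<open>th\<close>
  of \<open>th * (1 - d) * L - L * (1 - exp (- (th * K))) / K\<close>, where
  \<open>exp (- (th * K)) = 1 - d\<close>. There the exponent equals
  \<open>- (c_delta d * L / K)\<close>.\<close>

lemma Chernoff_exponent:
  fixes d K L e m :: real
  assumes d: "0 < d" "d < 1" and K: "K > 0" and e: "e > 0" and m: "m > 0"
    and L: "inverse (c_delta d) * K * ln (m / e) \<le> L"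
  shows "m * exp ((- ln (1 - d) / K) * ((1 - d) * L) - L * (1 - exp (- ((- ln (1 - d) / K) * K))) / K) \<le> e"
proof -
  have c: "c_delta d > 0" by (rule c_delta_pos[OF d])
  have "(- ln (1 - d) / K) * ((1 - d) * L) - L * (1 - exp (- ((- ln (1 - d) / K) * K))) / K = - (c_delta d * L / K)"
    using d K by (simp add: c_delta_def field_simps)
  moreover have "ln (m / e) \<le> c_delta d * L / K" using L c K by (simp add: field_simps)
  ultimately have "exp ((- ln (1 - d) / K) * ((1 - d) * L) - L * (1 - exp (- ((- ln (1 - d) / K) * K))) / K) \<le> exp (- ln (m / e))"
    by simp
  also have "\<dots> = e / m" using m e by (simp add: exp_minus)
  finally show ?thesis using m by (simp add: field_simps)
qed

section \<open>Transfer to the volume-weighted law and conditional error bounds\<close>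

context weighted_basis
begin

lemma whiten_det_meas:
  "(\<lambda>x :: 'n::finite \<Rightarrow> 'a. det (transpose (Phi_w phi w x) ** Phi_w phi w x)) \<in> borel_measurable (PiM UNIV (\<lambda>_. nu))"
proof -
  have m: "(\<lambda>x :: 'n \<Rightarrow> 'a. whiten phi w (x i) $ j) \<in> borel_measurable (PiM UNIV (\<lambda>_. nu))" for i j
  proof (rule measurable_compose[of "\<lambda>x. x i" _ nu])
    show "(\<lambda>a. whiten phi w a $ j) \<in> borel_measurable nu"
      using w_meas phi_meas[of j] by (simp add: whiten_nth nu_def)
  qed simp
  show ?thesis
    unfolding det_Phi_w
    unfolding det_def
    by (intro borel_measurable_sum borel_measurable_times borel_measurable_const borel_measurable_prod)
      (auto intro!: borel_measurable_sum borel_measurable_times m)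
qed

lemma AE_PiM_frame: "AE x in PiM (UNIV :: 'n::finite set) (\<lambda>_. nu). \<forall>i. frame (x i) = whiten phi w (x i)"
proof -
  have "AE x in PiM UNIV (\<lambda>_. nu). frame (x i) = whiten phi w (x i)" for i :: 'n
    by (rule AE_PiM_component) (use prob_nu AE_nu_frame in auto)
  then show ?thesis by (simp add: AE_all_countable)
qed

lemma nn_integral_gamma:
  fixes F :: "('n::finite \<Rightarrow> 'a) \<Rightarrow> ennreal"
  assumes F: "F \<in> borel_measurable (PiM UNIV (\<lambda>_. nu))"
  shows "(\<integral>\<^sup>+x. F x \<partial>gamma_meas phi w nu)
    = (\<integral>\<^sup>+x. ennreal (fact (CARD('n) - CARD('m)) / fact CARD('n)) * (ennreal (vol x) * F x) \<partial>PiM UNIV (\<lambda>_. nu))"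
proof -
  let ?c = "fact (CARD('n) - CARD('m)) / fact CARD('n) :: real"
  have "(\<integral>\<^sup>+x. F x \<partial>gamma_meas phi w nu)
      = (\<integral>\<^sup>+x. ennreal (?c * det (transpose (Phi_w phi w x) ** Phi_w phi w x)) * F x \<partial>PiM UNIV (\<lambda>_. nu))"
    unfolding gamma_meas_def
    by (intro nn_integral_density F measurable_compose[OF _ measurable_ennreal]
        borel_measurable_times borel_measurable_const whiten_det_meas)
  also have "\<dots> = (\<integral>\<^sup>+x. ennreal ?c * (ennreal (vol x) * F x) \<partial>PiM UNIV (\<lambda>_. nu))"
  proof (rule nn_integral_cong_AE)
    show "AE x in PiM UNIV (\<lambda>_. nu). ennreal (?c * det (transpose (Phi_w phi w x) ** Phi_w phi w x)) * F x
        = ennreal ?c * (ennreal (vol x) * F x)"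
      using AE_PiM_frame
    proof eventually_elim
      case (elim x)
      then have "det (transpose (Phi_w phi w x) ** Phi_w phi w x) = vol x"
        by (simp add: det_Phi_w vol_def)
      moreover have "ennreal (?c * vol x) = ennreal ?c * ennreal (vol x)"
        by (rule ennreal_mult''[OF vol_nonneg])
      ultimately show ?case by (simp only: mult.assoc)
    qed
  qed
  finally show ?thesis .
qed

lemma space_PiM_nu: "space (PiM (UNIV :: 'n::finite set) (\<lambda>_. nu)) = UNIV"
  by (simp add: space_PiM space_nu)

lemma sets_gamma: "sets (gamma_meas phi w nu) = sets (PiM UNIV (\<lambda>_. nu))"
  by (simp add: gamma_meas_def)

lemma space_gamma: "space (gamma_meas phi w nu) = UNIV"
  by (simp add: gamma_meas_def space_PiM_nu)

lemma ratio_card_inj: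
  assumes "CARD('m) < CARD('n::finite)"
  shows "fact (CARD('n) - CARD('m)) / fact CARD('n) * real (card {f :: 'm \<Rightarrow> 'n. inj f}) = 1"
proof -
  have "real (card {f :: 'm \<Rightarrow> 'n. inj f} * fact (CARD('n) - CARD('m))) = real (fact CARD('n))"
    using card_inj_funs[where 'm = 'm and 'n = 'n] assms by simp
  then show ?thesis by (simp add: field_simps)
qed

lemma prob_gamma:
  assumes nm: "CARD('m) < CARD('n::finite)"
  shows "prob_space (gamma_meas phi w nu :: ('n \<Rightarrow> 'a) measure)"
proof
  let ?c = "fact (CARD('n) - CARD('m)) / fact CARD('n) :: real"
  have "emeasure (gamma_meas phi w nu :: ('n \<Rightarrow> 'a) measure) (space (gamma_meas phi w nu))
    = (\<integral>\<^sup>+x. 1 \<partial>(gamma_meas phi w nu :: ('n \<Rightarrow> 'a) measure))" by simp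
  also have "\<dots> = (\<integral>\<^sup>+x. ennreal ?c * (ennreal (vol x) * 1) \<partial>PiM (UNIV :: 'n set) (\<lambda>_. nu))"
    by (rule nn_integral_gamma) simp
  also have "\<dots> = ennreal ?c * (\<integral>\<^sup>+x. ennreal (vol x) \<partial>PiM (UNIV :: 'n set) (\<lambda>_. nu))"
    unfolding mult_1_right by (rule nn_integral_cmult[OF measurable_compose[OF measurable_vol measurable_ennreal]])
  also have "\<dots> = ennreal ?c * ennreal (real (card {f :: 'm \<Rightarrow> 'n. inj f}))"
    using nn_integral_eq_integral[OF integrable_vol[where 'n = 'n] AE_I2[OF vol_nonneg]] integral_vol[where 'n = 'n]
    by simp
  also have "\<dots> = 1" by (simp only: ennreal_mult'[symmetric] divide_nonneg_nonneg fact_ge_zero ratio_card_inj[OF nm]) simp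
  finally show "emeasure (gamma_meas phi w nu :: ('n \<Rightarrow> 'a) measure) (space (gamma_meas phi w nu)) = 1" .
qed

text \<open>The common route from product-measure estimates to \<open>gamma_meas\<close>: the number
  of injections cancels the normalisation, and the pointwise bound is needed only where
  \<open>frame\<close> and \<open>whiten\<close> agree at all sample points.\<close>

lemma nn_integral_gamma_le:
  fixes F :: "('n::finite \<Rightarrow> 'a) \<Rightarrow> ennreal" and H :: "('n \<Rightarrow> 'a) \<Rightarrow> ennreal"
  assumes nm: "CARD('m) < CARD('n)" and F: "F \<in> borel_measurable (PiM UNIV (\<lambda>_. nu))"
    and FH: "\<And>x. (\<forall>i. frame (x i) = whiten phi w (x i)) \<Longrightarrow> ennreal (vol x) * F x \<le> H x"
    and H: "(\<integral>\<^sup>+x. H x \<partial>PiM UNIV (\<lambda>_. nu)) \<le> ennreal (real (card {f :: 'm \<Rightarrow> 'n. inj f}) * B)"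
    and B: "0 \<le> B"
  shows "(\<integral>\<^sup>+x. F x \<partial>gamma_meas phi w nu) \<le> ennreal B"
proof -
  let ?c = "fact (CARD('n) - CARD('m)) / fact CARD('n) :: real"
  have "(\<integral>\<^sup>+x. F x \<partial>gamma_meas phi w nu) = ennreal ?c * (\<integral>\<^sup>+x. ennreal (vol x) * F x \<partial>PiM UNIV (\<lambda>_. nu))"
  proof -
    have "(\<lambda>x. ennreal (vol x) * F x) \<in> borel_measurable (PiM UNIV (\<lambda>_. nu))"
      using F measurable_vol[where 'n = 'n] by measurable
    then show ?thesis unfolding nn_integral_gamma[OF F] by (rule nn_integral_cmult)
  qed
  also have "(\<integral>\<^sup>+x. ennreal (vol x) * F x \<partial>PiM UNIV (\<lambda>_. nu)) \<le> (\<integral>\<^sup>+x. H x \<partial>PiM UNIV (\<lambda>_. nu))"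
    using AE_PiM_frame by (intro nn_integral_mono_AE) (auto intro: FH elim: eventually_mono)
  also note H
  also have "ennreal ?c * ennreal (real (card {f :: 'm \<Rightarrow> 'n. inj f}) * B) = ennreal (?c * real (card {f :: 'm \<Rightarrow> 'n. inj f}) * B)"
    by (simp add: ennreal_mult'[symmetric] mult.assoc)
  also have "?c * real (card {f :: 'm \<Rightarrow> 'n. inj f}) * B = B" by (simp only: ratio_card_inj[OF nm] mult_1)
  finally show ?thesis by (simp add: mult_left_mono)
qed

text \<open>The event \<open>S\<close> in terms of quadratic forms, with the factor 1/n of the Gram
  matrix absorbed into \<open>t\<close>; it is used with
  \<open>t = (1 - d) * (n - m)\<close>.\<close>

definition good :: "real \<Rightarrow> ('n::finite \<Rightarrow> 'a) set" where
  "good t = {x. \<forall>c. t * (c \<bullet> c) \<le> (\<Sum>i\<in>UNIV. (whiten phi w (x i) \<bullet> c)\<^sup>2)}"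

lemma good_sets: "(good t :: ('n::finite \<Rightarrow> 'a) set) \<in> sets (PiM UNIV (\<lambda>_. nu))"
  unfolding good_def
  by (rule pd_sets_measurable) (use whiten_meas space_nu in \<open>auto simp: nu_def\<close>)

lemma prob_good:
  fixes d e :: real
  defines "L \<equiv> real CARD('n::finite) - real CARD('m)"
  assumes nm: "CARD('m) < CARD('n)" and d: "0 < d" "d < 1" and e: "0 < e"
    and L: "inverse (c_delta d) * K * ln (real CARD('m) / e) \<le> L"
  shows "measure (gamma_meas phi w nu) (good ((1 - d) * L) :: ('n \<Rightarrow> 'a) set) \<ge> 1 - e"
proof -
  let ?G = "gamma_meas phi w nu :: ('n \<Rightarrow> 'a) measure"
  let ?S = "good ((1 - d) * L) :: ('n \<Rightarrow> 'a) set"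
  interpret G: prob_space ?G by (rule prob_gamma[OF nm])
  define t where "t = (1 - d) * L"
  define th where "th = - ln (1 - d) / K"
  have L0: "L > 0" using nm by (simp add: L_def)
  have t: "0 \<le> t" using d L0 by (simp add: t_def)
  have th: "th > 0" using d K_pos by (simp add: th_def divide_neg_pos)
  have S: "?S \<in> sets ?G" using good_sets sets_gamma by blast
  have "emeasure ?G (space ?G - ?S) = (\<integral>\<^sup>+x. indicator (- ?S) x \<partial>?G)"
    using sets.compl_sets[OF S] by (simp add: space_gamma Compl_eq_Diff_UNIV)
  also have "\<dots> \<le> ennreal (real CARD('m) * exp (th * t - L * (1 - exp (- (th * K))) / K))"
  proof (rule nn_integral_gamma_le[OF nm])
    have "- ?S \<in> sets (PiM UNIV (\<lambda>_. nu))"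
      using sets.compl_sets[OF good_sets[of "(1 - d) * L", where 'n = 'n]] by (simp add: space_PiM_nu Compl_eq_Diff_UNIV)
    then show "(indicator (- ?S) :: _ \<Rightarrow> ennreal) \<in> borel_measurable (PiM UNIV (\<lambda>_. nu))" by simp
    show "ennreal (vol x) * indicator (- ?S) x \<le> ennreal (vol x) * indicator {x. bad (UNIV :: 'n set) t x} x"
      if "\<forall>i. frame (x i) = whiten phi w (x i)" for x :: "'n \<Rightarrow> 'a"
      using that by (intro mult_left_mono) (auto simp: indicator_def good_def bad_def t_def not_le)
    show "(\<integral>\<^sup>+x. ennreal (vol x) * indicator {x. bad (UNIV :: 'n set) t x} x \<partial>PiM UNIV (\<lambda>_. nu))
      \<le> ennreal (real (card {f :: 'm \<Rightarrow> 'n. inj f}) * (real CARD('m) * exp (th * t - L * (1 - exp (- (th * K))) / K)))"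
      unfolding L_def by (rule mean_vol_bad_le_exp[OF nm th t])
  qed simp
  also have "\<dots> \<le> ennreal e"
    unfolding t_def th_def
    by (intro ennreal_leI Chernoff_exponent d K_pos e L) simp
  finally have "emeasure ?G (space ?G - ?S) \<le> ennreal e" .
  then have "G.prob (space ?G - ?S) \<le> e" using e by (simp add: G.emeasure_eq_measure)
  then show ?thesis using G.prob_compl[OF S] by simp
qed

text \<open>Equal measures force \<open>w = wm phi\<close> almost everywhere, so the leverage is the
  constant m under \<open>nu\<close>. It leaves the integral, and orthogonality of noise and basis
  finishes.\<close>

lemma leverage_noise_orth:
  assumes eq: "density mu (\<lambda>y. ennreal (w y)) = density mu (\<lambda>y. ennreal (wm phi y))" and f: "in_L2 mu f"
  shows "(\<integral>a. (frame a \<bullet> frame a) * noise f a * frame a $ k \<partial>nu) = 0"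
proof -
  interpret mu: prob_space mu by (rule mu_prob)
  have wmm: "wm phi \<in> borel_measurable mu" unfolding wm_def[abs_def] by measurable
  have wm0: "0 \<le> wm phi a" for a by (simp add: wm_def sum_nonneg)
  have "AE a in mu. ennreal (w a) = ennreal (wm phi a)"
    using w_meas wmm by (intro mu.density_unique eq) auto
  then have 1: "AE a in mu. 0 < w a \<longrightarrow> frame a \<bullet> frame a = real CARD('m)"
    using AE_frame
  proof eventually_elim
    case (elim a)
    then have "w a = wm phi a" using w_nonneg wm0 by simp
    then show ?case using elim(2) by (auto simp: whiten_inner)
  qed
  have "AE a in nu. frame a \<bullet> frame a = real CARD('m)"
    unfolding nu_def using 1 w_meas by (subst AE_density) auto
  then have "(\<integral>a. (frame a \<bullet> frame a) * noise f a * frame a $ k \<partial>nu) = (\<integral>a. real CARD('m) * (noise f a * frame a $ k) \<partial>nu)"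
    using noise_meas_nu[OF f] v_measurable v_component_measurable
    by (intro integral_cong_AE) auto
  then show ?thesis by (simp add: integral_noise_frame[OF f])
qed

lemma err_bound:
  fixes x :: "'n::finite \<Rightarrow> 'a"
  assumes f: "in_L2 mu f" and t: "t > 0" and x: "x \<in> good t"
  shows "L2_norm_sq mu (\<lambda>y. f y - wls_proj phi w x f y)
      \<le> L2_norm_sq mu (resid f) + (\<Sum>i\<in>UNIV. (noise f (x i))\<^sup>2) / t"
    and "L2_norm_sq mu (\<lambda>y. f y - wls_proj phi w x f y)
      \<le> L2_norm_sq mu (resid f) + (norm (\<Sum>i\<in>UNIV. noise f (x i) *\<^sub>R whiten phi w (x i)))\<^sup>2 / t\<^sup>2"
proof -
  have feq: "f = (\<lambda>y. (\<Sum>j\<in>UNIV. coef f $ j * phi j y) + resid f y)" by (simp add: resid_def)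
  have pd: "t * (c \<bullet> c) \<le> (\<Sum>i\<in>UNIV. (whiten phi w (x i) \<bullet> c)\<^sup>2)" for c using x by (simp add: good_def)
  obtain b where b: "wls_proj phi w x f = (\<lambda>y. \<Sum>j\<in>UNIV. (coef f $ j + b $ j) * phi j y)"
    and b1: "t * (norm b)\<^sup>2 \<le> (\<Sum>i\<in>UNIV. (noise f (x i))\<^sup>2)"
    and b2: "t\<^sup>2 * (norm b)\<^sup>2 \<le> (norm (\<Sum>i\<in>UNIV. noise f (x i) *\<^sub>R whiten phi w (x i)))\<^sup>2"
    unfolding noise_def by (rule wls_proj_eq[OF w_nonneg t pd feq])
  have "(\<lambda>y. f y - wls_proj phi w x f y) = (\<lambda>y. resid f y - (\<Sum>j\<in>UNIV. b $ j * phi j y))"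
    unfolding b by (simp add: fun_eq_iff resid_def distrib_right sum.distrib)
  moreover have "(norm b)\<^sup>2 = (\<Sum>j\<in>UNIV. (b $ j)\<^sup>2)"
    by (simp only: power2_norm_eq_inner inner_vec_def) (simp add: power2_eq_square)
  ultimately have err: "L2_norm_sq mu (\<lambda>y. f y - wls_proj phi w x f y) = L2_norm_sq mu (resid f) + (norm b)\<^sup>2"
    by (simp add: Pythagoras[OF resid_L2[OF f] resid_orth[OF f]])
  show "L2_norm_sq mu (\<lambda>y. f y - wls_proj phi w x f y)
      \<le> L2_norm_sq mu (resid f) + (\<Sum>i\<in>UNIV. (noise f (x i))\<^sup>2) / t"
    unfolding err using b1 t by (simp add: field_simps)
  show "L2_norm_sq mu (\<lambda>y. f y - wls_proj phi w x f y)
      \<le> L2_norm_sq mu (resid f) + (norm (\<Sum>i\<in>UNIV. noise f (x i) *\<^sub>R whiten phi w (x i)))\<^sup>2 / t\<^sup>2"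
    unfolding err using b2 t by (simp add: field_simps)
qed

lemma noise_comp_meas:
  assumes "in_L2 mu f"
  shows "(\<lambda>x :: 'n::finite \<Rightarrow> 'a. noise f (x i)) \<in> borel_measurable (PiM UNIV (\<lambda>_. nu))"
  by (rule measurable_compose[OF _ noise_meas_nu[OF assms]]) simp

lemma cond_err_bounds:
  fixes f :: "'a \<Rightarrow> real" and p t :: real and S :: "('n::finite \<Rightarrow> 'a) set"
  assumes nm: "CARD('m) < CARD('n)" and f: "in_L2 mu f" and t: "t > 0" and S: "S = good t"
    and p: "p > 0" "p \<le> measure (gamma_meas phi w nu) S"
  defines "R \<equiv> L2_norm_sq mu (resid f)" and "n \<equiv> real CARD('n)" and "m \<equiv> real CARD('m)"
    and "xi \<equiv> (if density mu (\<lambda>y. ennreal (w y)) = density mu (\<lambda>y. ennreal (wm phi y)) then 0 else 1 :: real)"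
  shows "cond_exp_event (gamma_meas phi w nu) S (\<lambda>x. L2_norm_sq mu (\<lambda>y. f y - wls_proj phi w x f y))
      \<le> ennreal (R + inverse p * ((K + n - m) * R / t))"
    and "cond_exp_event (gamma_meas phi w nu) S (\<lambda>x. L2_norm_sq mu (\<lambda>y. f y - wls_proj phi w x f y))
      \<le> ennreal (R + inverse p * ((K * (K + n - m) + xi * K\<^sup>2) * R / t\<^sup>2))"
proof -
  let ?G = "gamma_meas phi w nu :: ('n \<Rightarrow> 'a) measure"
  note [measurable] = noise_comp_meas[OF f]
  have S': "S \<in> sets ?G" using good_sets[of t] S sets_gamma by blast
  have R: "0 \<le> R" by (simp add: R_def L2_norm_sq_def)
  have mn: "0 < n - m" using nm by (simp add: n_def m_def)
  have A: "0 \<le> K + n - m" using mn K_pos by simp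
  have NR: "(\<integral>a. (noise f a)\<^sup>2 \<partial>nu) \<le> R" unfolding R_def by (rule integral_noise_sq_le[OF f])
  have whm: "(\<lambda>x :: 'n \<Rightarrow> 'a. whiten phi w (x i)) \<in> borel_measurable (PiM UNIV (\<lambda>_. nu))" for i
    by (rule measurable_compose[of "\<lambda>x. x i" _ nu]) (use whiten_meas in \<open>simp_all add: nu_def\<close>)
  note [measurable] = whm
  have gm: "borel_measurable ?G = (borel_measurable (PiM (UNIV :: 'n set) (\<lambda>_. nu)) :: (('n \<Rightarrow> 'a) \<Rightarrow> real) set)"
    by (intro measurable_cong_sets sets_gamma refl)
  show "cond_exp_event ?G S (\<lambda>x. L2_norm_sq mu (\<lambda>y. f y - wls_proj phi w x f y))
      \<le> ennreal (R + inverse p * ((K + n - m) * R / t))"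
  proof (rule cond_exp_event_bound[OF prob_gamma[OF nm] S' p(2,1)])
    let ?Y = "\<lambda>x :: 'n \<Rightarrow> 'a. (\<Sum>i\<in>UNIV. (noise f (x i))\<^sup>2) / t"
    show "?Y \<in> borel_measurable ?G" unfolding gm by measurable
    show "0 \<le> ?Y x" for x using t by (simp add: sum_nonneg)
    show "L2_norm_sq mu (\<lambda>y. f y - wls_proj phi w x f y) \<le> R + ?Y x" if "x \<in> S" for x
      using err_bound(1)[OF f t, of x] that S by (simp add: R_def)
    show "0 \<le> R" by (rule R)
    show "0 \<le> (K + n - m) * R / t" using A R t by simp
    show "(\<integral>\<^sup>+x. ennreal (?Y x) \<partial>?G) \<le> ennreal ((K + n - m) * R / t)"
    proof (rule nn_integral_gamma_le[OF nm])
      show "(\<lambda>x. ennreal (?Y x)) \<in> borel_measurable (PiM UNIV (\<lambda>_. nu))" by measurable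
      show "0 \<le> (K + n - m) * R / t" by fact
      show "ennreal (vol x) * ennreal (?Y x) \<le> ennreal (vol x * (\<Sum>i\<in>UNIV. (noise f (x i))\<^sup>2 / t))" for x
        using vol_nonneg[of x] t by (simp add: ennreal_mult'[symmetric] sum_divide_distrib)
      have "integrable nu (\<lambda>a. (noise f a)\<^sup>2 / t)" using noise_sq_integrable[OF f] by simp
      then have "(\<integral>\<^sup>+x. ennreal (vol x * (\<Sum>i\<in>(UNIV :: 'n set). (noise f (x i))\<^sup>2 / t)) \<partial>PiM UNIV (\<lambda>_. nu))
        \<le> ennreal (real (card {f :: 'm \<Rightarrow> 'n. inj f}) * ((K + n - m) * (\<integral>a. (noise f a)\<^sup>2 / t \<partial>nu)))"
        unfolding n_def m_def using t nm by (intro mean_vol_sum_le) auto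
      also have "\<dots> \<le> ennreal (real (card {f :: 'm \<Rightarrow> 'n. inj f}) * ((K + n - m) * R / t))"
      proof (intro ennreal_leI mult_left_mono)
        have "(K + n - m) * (\<integral>a. (noise f a)\<^sup>2 \<partial>nu) / t \<le> (K + n - m) * R / t"
          using A t NR by (intro divide_right_mono mult_left_mono) auto
        then show "(K + n - m) * (\<integral>a. (noise f a)\<^sup>2 / t \<partial>nu) \<le> (K + n - m) * R / t" by simp
      qed simp
      finally show "(\<integral>\<^sup>+x. ennreal (vol x * (\<Sum>i\<in>(UNIV :: 'n set). (noise f (x i))\<^sup>2 / t)) \<partial>PiM UNIV (\<lambda>_. nu))
        \<le> ennreal (real (card {f :: 'm \<Rightarrow> 'n. inj f}) * ((K + n - m) * R / t))" .
    qed
  qed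
  have xi: "0 \<le> xi" by (simp add: xi_def)
  show "cond_exp_event ?G S (\<lambda>x. L2_norm_sq mu (\<lambda>y. f y - wls_proj phi w x f y))
      \<le> ennreal (R + inverse p * ((K * (K + n - m) + xi * K\<^sup>2) * R / t\<^sup>2))"
  proof (rule cond_exp_event_bound[OF prob_gamma[OF nm] S' p(2,1)])
    let ?Y = "\<lambda>x :: 'n \<Rightarrow> 'a. (norm (\<Sum>i\<in>UNIV. noise f (x i) *\<^sub>R whiten phi w (x i)))\<^sup>2 / t\<^sup>2"
    let ?H = "\<lambda>x :: 'n \<Rightarrow> 'a. ennreal (1 / t\<^sup>2) * ennreal (vol x * (norm (\<Sum>i\<in>UNIV. noise f (x i) *\<^sub>R frame (x i)))\<^sup>2)"
    have Y: "?Y \<in> borel_measurable (PiM UNIV (\<lambda>_. nu))" by measurable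
    then show "?Y \<in> borel_measurable ?G" unfolding gm .
    show "0 \<le> ?Y x" for x by simp
    show "L2_norm_sq mu (\<lambda>y. f y - wls_proj phi w x f y) \<le> R + ?Y x" if "x \<in> S" for x
      using err_bound(2)[OF f t, of x] that S by (simp add: R_def)
    show "0 \<le> R" by (rule R)
    show nn: "0 \<le> (K * (K + n - m) + xi * K\<^sup>2) * R / t\<^sup>2" using A R t K_pos xi by simp
    show "(\<integral>\<^sup>+x. ennreal (?Y x) \<partial>?G) \<le> ennreal ((K * (K + n - m) + xi * K\<^sup>2) * R / t\<^sup>2)"
    proof (rule nn_integral_gamma_le[OF nm])
      show "(\<lambda>x. ennreal (?Y x)) \<in> borel_measurable (PiM UNIV (\<lambda>_. nu))" using Y by measurable
      show "0 \<le> (K * (K + n - m) + xi * K\<^sup>2) * R / t\<^sup>2" by (rule nn)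
      show "ennreal (vol x) * ennreal (?Y x) \<le> ?H x" if "\<forall>i. frame (x i) = whiten phi w (x i)" for x
        using that vol_nonneg[of x] by (simp add: ennreal_mult'[symmetric] ennreal_mult''[symmetric])
      \<comment> \<open>The only place where the two values of \<open>xi\<close> are distinguished:
        constant leverage makes this sum vanish, otherwise Bessel's inequality bounds it.\<close>
      let ?C = "\<Sum>k\<in>UNIV. (\<integral>a. (frame a \<bullet> frame a) * noise f a * frame a $ k \<partial>nu)\<^sup>2"
      have C: "?C \<le> xi * K\<^sup>2 * R"
      proof (cases "density mu (\<lambda>y. ennreal (w y)) = density mu (\<lambda>y. ennreal (wm phi y))")
        case True
        then show ?thesis by (simp add: xi_def leverage_noise_orth[OF True f])
      next
        case False
        have "?C \<le> K\<^sup>2 * (\<integral>a. (noise f a)\<^sup>2 \<partial>nu)"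
          by (rule leverage_Bessel[OF noise_meas_nu[OF f] noise_sq_integrable[OF f]])
        also have "\<dots> \<le> K\<^sup>2 * R" using NR by (intro mult_left_mono) auto
        finally show ?thesis using False by (simp add: xi_def)
      qed
      have le: "K * (K + n - m) * (\<integral>a. (noise f a)\<^sup>2 \<partial>nu) + ?C \<le> (K * (K + n - m) + xi * K\<^sup>2) * R"
      proof -
        have "K * (K + n - m) * (\<integral>a. (noise f a)\<^sup>2 \<partial>nu) \<le> K * (K + n - m) * R"
          using A K_pos NR by (intro mult_left_mono) auto
        then show ?thesis using C by (simp add: algebra_simps)
      qed
      have "(\<integral>\<^sup>+x. ?H x \<partial>PiM UNIV (\<lambda>_. nu)) = ennreal (1 / t\<^sup>2) * (\<integral>\<^sup>+x. ennreal (vol x * (norm (\<Sum>i\<in>(UNIV :: 'n set). noise f (x i) *\<^sub>R frame (x i)))\<^sup>2) \<partial>PiM UNIV (\<lambda>_. nu))"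
      proof (rule nn_integral_cmult)
        have frm: "(\<lambda>x :: 'n \<Rightarrow> 'a. frame (x i)) \<in> borel_measurable (PiM UNIV (\<lambda>_. nu))" for i
          by (rule measurable_compose[OF _ v_measurable]) simp
        note [measurable] = frm measurable_vol[where 'n = 'n]
        show "(\<lambda>x. ennreal (vol x * (norm (\<Sum>i\<in>(UNIV :: 'n set). noise f (x i) *\<^sub>R frame (x i)))\<^sup>2)) \<in> borel_measurable (PiM UNIV (\<lambda>_. nu))"
          by measurable
      qed
      also have "\<dots> \<le> ennreal (1 / t\<^sup>2) * ennreal (real (card {f :: 'm \<Rightarrow> 'n. inj f})
            * (K * (K + n - m) * (\<integral>a. (noise f a)\<^sup>2 \<partial>nu) + ?C))"
        unfolding n_def m_def using nm
        by (intro mult_left_mono mean_vol_noise_le noise_meas_nu[OF f] noise_sq_integrable[OF f] integral_noise_frame[OF f]) auto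
      also have "\<dots> \<le> ennreal (1 / t\<^sup>2) * ennreal (real (card {f :: 'm \<Rightarrow> 'n. inj f}) * ((K * (K + n - m) + xi * K\<^sup>2) * R))"
        by (intro mult_left_mono ennreal_leI le) auto
      also have "\<dots> = ennreal (real (card {f :: 'm \<Rightarrow> 'n. inj f}) * ((K * (K + n - m) + xi * K\<^sup>2) * R / t\<^sup>2))"
        by (subst ennreal_mult'[symmetric]) (auto simp: mult_ac)
      finally show "(\<integral>\<^sup>+x. ?H x \<partial>PiM UNIV (\<lambda>_. nu))
        \<le> ennreal (real (card {f :: 'm \<Rightarrow> 'n. inj f}) * ((K * (K + n - m) + xi * K\<^sup>2) * R / t\<^sup>2))" .
    qed
  qed
qed

end

theorem mainTheorem10:
  fixes mu :: "'a::polish_space measure"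
    and phi :: "'m::finite \<Rightarrow> 'a \<Rightarrow> real"
    and w :: "'a \<Rightarrow> real"
    and alpha delta eta :: real
    and S :: "('n::finite \<Rightarrow> 'a) set"
  assumes mu_borel: "sets mu = sets borel"
    and mu_prob: "prob_space mu"
    and phi_L2: "\<And>j. in_L2 mu (phi j)"
    and phi_orth: "\<And>j k. (\<integral>y. phi j y * phi k y \<partial>mu) = (if j = k then 1 else 0)"
    and nm: "CARD('n) > CARD('m)"
    and w_meas: "w \<in> borel_measurable mu"
    and w_nonneg: "\<And>y. w y \<ge> 0"
    and w_int: "integrable mu w"
    and w_dens: "(\<integral>y. w y \<partial>mu) = 1"
    and alpha: "0 < alpha" "alpha \<le> 1"
    and w_lower: "AE y in mu. w y \<ge> alpha * wm phi y"
    and delta: "0 < delta" "delta < 1"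
    and eta: "0 < eta" "eta < 1"
    and n_large: "real CARD('n) \<ge> real CARD('m)
        + inverse (c_delta delta) * inverse alpha * real CARD('m) * ln (real CARD('m) / eta)"
    and S_def: "S = {x. lambda_min (G_w phi w x)
                        \<ge> (1 - delta) * (real CARD('n) - real CARD('m)) / real CARD('n)}"
  shows "measure (gamma_meas phi w (density mu (\<lambda>y. ennreal (w y)))) S \<ge> 1 - eta
    \<and> (\<forall>f. in_L2 mu f \<longrightarrow>
         (let gam = gamma_meas phi w (density mu (\<lambda>y. ennreal (w y)));
              m = real CARD('m); n = real CARD('n);
              beta = 1 + (inverse alpha - 1) * m / n;
              xi = (if density mu (\<lambda>y. ennreal (w y)) = density mu (\<lambda>y. ennreal (wm phi y))
                    then 0 else 1 :: real);
              best = (INF g\<in>Vspace phi. L2_norm_sq mu (\<lambda>y. f y - g y));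
              err = (\<lambda>x. L2_norm_sq mu (\<lambda>y. f y - wls_proj phi w x f y))
          in cond_exp_event gam S err
               \<le> ennreal ((1 + inverse (1 - eta) * inverse (1 - delta) * inverse (1 - m / n) * beta)
                          * best)
           \<and> cond_exp_event gam S err
               \<le> ennreal ((1 + inverse (1 - eta) * inverse ((1 - delta)\<^sup>2) * inverse ((1 - m / n)\<^sup>2)
                               * (m / n) * inverse alpha * (beta + xi * m * inverse alpha))
                          * best)))"
proof -
  interpret weighted_basis mu phi w alpha
    by (rule weighted_basis.intro[OF mu_borel mu_prob phi_L2 phi_orth w_meas w_nonneg w_int w_dens alpha(1) w_lower])
  let ?m = "real CARD('m)" and ?n = "real CARD('n)"
  define t where "t = (1 - delta) * (?n - ?m)"
  have mn: "0 < ?m" "?m < ?n" using nm by auto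
  have t: "t > 0" using delta mn by (simp add: t_def)
  have S: "S = good t"
    unfolding S_def good_def t_def lambda_min_G_w_ge_iff ..
  have gam: "gamma_meas phi w (density mu (\<lambda>y. ennreal (w y))) = (gamma_meas phi w nu :: ('n \<Rightarrow> 'a) measure)"
    by (simp add: nu_def)
  have P: "1 - eta \<le> measure (gamma_meas phi w nu) S"
    unfolding S t_def
    by (rule prob_good[OF nm delta eta(1)]) (use n_large in \<open>simp add: K_def divide_inverse mult_ac\<close>)
  \<comment> \<open>The error bounds are proved in terms of \<open>t\<close>; this translates them
    into the factors of the statement.\<close>
  have t1: "inverse (1 - delta) * inverse (1 - ?m / ?n) = ?n / t"
    using mn delta by (simp add: t_def field_simps)
  show ?thesis
    unfolding gam Let_def
  proof (intro conjI allI impI P)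
    fix f assume f: "in_L2 mu f"
    define R where "R = L2_norm_sq mu (resid f)"
    define best where "best = (INF g\<in>Vspace phi. L2_norm_sq mu (\<lambda>y. f y - g y))"
    define xi where "xi = (if density mu (\<lambda>y. ennreal (w y)) = density mu (\<lambda>y. ennreal (wm phi y)) then 0 else 1 :: real)"
    define beta where "beta = 1 + (inverse alpha - 1) * ?m / ?n"
    let ?err = "\<lambda>x :: 'n \<Rightarrow> 'a. L2_norm_sq mu (\<lambda>y. f y - wls_proj phi w x f y)"
    have Rb: "R \<le> best" unfolding R_def best_def by (rule resid_le_best[OF f])
    have p: "1 - eta > 0" using eta by simp
    have beta: "K + ?n - ?m = ?n * beta" using mn alpha by (simp add: beta_def K_def field_simps)
    have beta0: "0 \<le> beta" using beta K_pos mn by (metis add_pos_pos diff_gt_0_iff_gt add_diff_eq less_imp_le zero_less_mult_pos order_less_trans)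
    have xi0: "0 \<le> xi" by (simp add: xi_def)
    note bounds = cond_err_bounds[OF nm f t S p P, folded R_def xi_def]
    have "cond_exp_event (gamma_meas phi w nu) S ?err \<le> ennreal (R + inverse (1 - eta) * ((K + ?n - ?m) * R / t))"
      by (rule bounds(1))
    also have "R + inverse (1 - eta) * ((K + ?n - ?m) * R / t)
        = (1 + inverse (1 - eta) * (inverse (1 - delta) * inverse (1 - ?m / ?n)) * beta) * R"
      unfolding t1 beta by (simp add: algebra_simps)
    also have "ennreal \<dots> \<le> ennreal ((1 + inverse (1 - eta) * (inverse (1 - delta) * inverse (1 - ?m / ?n)) * beta) * best)"
      unfolding t1 using p t mn beta0 by (intro ennreal_leI mult_right_mono Rb mult_left_mono add_nonneg_nonneg mult_nonneg_nonneg) auto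
    finally show "cond_exp_event (gamma_meas phi w nu) S ?err
      \<le> ennreal ((1 + inverse (1 - eta) * inverse (1 - delta) * inverse (1 - ?m / ?n) * (1 + (inverse alpha - 1) * ?m / ?n))
          * (INF g\<in>Vspace phi. L2_norm_sq mu (\<lambda>y. f y - g y)))"
      by (simp only: beta_def best_def mult.assoc)
    let ?c = "inverse ((1 - delta)\<^sup>2) * inverse ((1 - ?m / ?n)\<^sup>2) * (?m / ?n) * inverse alpha * (beta + xi * ?m * inverse alpha)"
    have c: "?c = ?n * K * (beta + xi * K) / t\<^sup>2"
    proof -
      have "inverse ((1 - delta)\<^sup>2) * inverse ((1 - ?m / ?n)\<^sup>2) = (?n / t)\<^sup>2"
        unfolding t1[symmetric] by (simp add: power_mult_distrib power_inverse)
      then show ?thesis using mn by (simp add: K_def power2_eq_square divide_inverse mult_ac)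
    qed
    have c0: "0 \<le> ?c" unfolding c using mn K_pos beta0 xi0 by simp
    have "(K * (K + ?n - ?m) + xi * K\<^sup>2) \<le> ?n * K * (beta + xi * K)"
    proof -
      \<comment> \<open>The moment estimate gives \<open>xi * K^2\<close>, whereas the stated
        constant has room for n times as much; \<open>n >= 1\<close> closes the gap.\<close>
      have "1 * (xi * K\<^sup>2) \<le> ?n * (xi * K\<^sup>2)" using mn nm xi0 by (intro mult_right_mono) auto
      then show ?thesis unfolding beta by (simp add: algebra_simps power2_eq_square)
    qed
    then have "(K * (K + ?n - ?m) + xi * K\<^sup>2) * R / t\<^sup>2 \<le> ?n * K * (beta + xi * K) * R / t\<^sup>2"
      by (intro divide_right_mono mult_right_mono) (auto simp: R_def L2_norm_sq_def)
    also have "\<dots> = ?c * R" unfolding c by simp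
    finally have le: "(K * (K + ?n - ?m) + xi * K\<^sup>2) * R / t\<^sup>2 \<le> ?c * R" .
    have "cond_exp_event (gamma_meas phi w nu) S ?err
        \<le> ennreal (R + inverse (1 - eta) * ((K * (K + ?n - ?m) + xi * K\<^sup>2) * R / t\<^sup>2))"
      by (rule bounds(2))
    also have "\<dots> \<le> ennreal (R + inverse (1 - eta) * (?c * R))"
      using p le by (intro ennreal_leI add_left_mono mult_left_mono) auto
    also have "R + inverse (1 - eta) * (?c * R) = (1 + inverse (1 - eta) * ?c) * R"
      by (simp only: distrib_right mult_1_left mult.assoc)
    also have "ennreal \<dots> \<le> ennreal ((1 + inverse (1 - eta) * ?c) * best)"
    proof (intro ennreal_leI mult_left_mono Rb)
      show "0 \<le> 1 + inverse (1 - eta) * ?c"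
        using mult_nonneg_nonneg[OF _ c0, of "inverse (1 - eta)"] p by simp
    qed
    finally show "cond_exp_event (gamma_meas phi w nu) S ?err
      \<le> ennreal ((1 + inverse (1 - eta) * inverse ((1 - delta)\<^sup>2) * inverse ((1 - ?m / ?n)\<^sup>2) * (?m / ?n) * inverse alpha
            * (1 + (inverse alpha - 1) * ?m / ?n
              + (if density mu (\<lambda>y. ennreal (w y)) = density mu (\<lambda>y. ennreal (wm phi y)) then 0 else 1) * ?m * inverse alpha))
          * (INF g\<in>Vspace phi. L2_norm_sq mu (\<lambda>y. f y - g y)))"
      by (simp only: beta_def best_def xi_def mult.assoc)
  qed
qed

end
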